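(* Suppose $\phi^m\in[-1,1]$ in $\Omega$. Let $(\mathbf{u}^{m+1},p^{m+1},\phi^{m+1},\mu^{m+1})$ be any solution of the discrete scheme (S1)--(S4) (described in the context) for the data $(\mathbf{u}^m,\phi^m,\mu^m)$. Then $$\phi^{m+1}\in[-1,1]\quad\text{and}\quad \Pi^h_1\phi^{m+1}\in[-1,1]\quad\text{in }\Omega .$$
   Context: **Constants and functions.** $\Omega\subset\mathbb{R}^d$ ($d\in\{2,3\}$) is a bounded polygonal (polyhedral) domain; $0<\rho_1<\rho_2$, $\lambda>0$, $\varepsilon>0$, $\Delta t>0$; $\eta\in C^0([-1,1])$ with $\eta\ge C>0$. For a real-valued function $v$, $v_\oplus=\max\{v,0\}$, $v_\ominus=-\min\{v,0\}$. Put $\rho_{\mathrm{avg}}=\frac{\rho_1+\rho_2}{2}$, $\rho_{\mathrm{dif}}=\frac{\rho_2-\rho_1}{2}$, $\rho(\phi)=\rho_{\mathrm{avg}}+\rho_{\mathrm{dif}}\phi$, $M(\phi)=(1-\phi^2)_\oplus$, and $f(\phi_1,\phi_0)=F_i'(\phi_1)+F_e'(\phi_0)$ with $F_i(\phi)=\phi^2+\frac14$, $F_e(\phi)=\frac14\phi^4-\frac32\phi^2$. $M^\uparrow(z)=M(z)$ if $z\le0$ and $M(0)$ if $z>0$; $M^\downarrow(z)=0$ if $z\le 0$ and $M(z)-M(0)$ if $z>0$. $\mathbf{D}\mathbf{u}=\frac12(\nabla\mathbf{u}+\nabla\mathbf{u}^t)$. $(\cdot,\cdot)$ is the $L^2(\Omega)$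 scalar product (Frobenius product for tensors). $\delta_t v^{m+1}=(v^{m+1}-v^m)/\Delta t$. **Mesh.** $\mathcal{T}_h$ is a shape-regular simplicial mesh of $\overline\Omega$ such that for every interior edge (face) $e=K\cap L$ the line between the barycenters of $K$ and $L$ is orthogonal to $e$; $\mathcal{D}_e(\mathcal{T}_h)>0$ is the distance between these barycenters. $\mathcal{E}_h^{\mathrm i}$ is the set of interior edges (faces); each $e\in\mathcal{E}_h^{\mathrm i}$ has a fixed unit normal $\mathbf{n}_e$, and we write $e=K\cap L$ with $\mathbf{n}_e$ exterior to $K$ and pointing to $L$. On such $e$, $\{\!\{v\}\!\}=\frac{v_K+v_L}{2}$ and $[\![v]\!]=v_K-v_L$. **Spaces and projections.** $\mathbb{P}^{\mathrm{disc}}_k(\mathcal{T}_h)$ (resp. $\mathbb{P}^{\mathrm{cont}}_k(\mathcal{T}_h)$) is the space of discontinuous (resp. continuous) functions that are polynomials of degree at most $k$ on each $K\in\mathcal{T}_h$. $(\mathcal{U}_h,\mathcal{P}_h)$ is an inf-sup compatible (velocity, pressure) pair of finite-dimensional spaces with $\mathcal{U}_h\subset(C^0(\overline\Omega)\cap H^1_0(\Omega))^d$ and $\mathbb{P}^{\mathrm{disc}}_0(\mathcal{T}_h)\subset\mathcal{P}_h$. The mass-lumping product on $\mathbb{P}^{\mathrm{cont}}_1(\mathcal{T}_h)$ is $(\varphi,\psi)_h=\frac1{d+1}\sum_{K}|K|\sum_{j=1}^{d+1}\varphi(x_{j,K})\psi(x_{j,K})$, $x_{j,K}$ being the vertices of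 $K$. For $g\in L^1(\Omega)$: $\Pi_0g\in\mathbb{P}^{\mathrm{disc}}_0(\mathcal{T}_h)$ with $(\Pi_0g,\overline w)=(g,\overline w)$ for all $\overline w\in\mathbb{P}^{\mathrm{disc}}_0(\mathcal{T}_h)$; $\Pi_1g\in\mathbb{P}^{\mathrm{cont}}_1(\mathcal{T}_h)$ with $(\Pi_1g,\overline v)=(g,\overline v)$ for all $\overline v\in\mathbb{P}^{\mathrm{cont}}_1(\mathcal{T}_h)$ (applied componentwise to vector fields); $\Pi^h_1g\in\mathbb{P}^{\mathrm{cont}}_1(\mathcal{T}_h)$ with $(\Pi^h_1g,\overline v)_h=(g,\overline v)$ for all $\overline v\in\mathbb{P}^{\mathrm{cont}}_1(\mathcal{T}_h)$. **Forms** (differential operators are taken elementwise where needed): - $c_h(\phi,\mu,\overline{\mathbf u})=-\int_\Omega\nabla\cdot(\phi\overline{\mathbf u})\mu-\sum_{e\in\mathcal{E}_h^{\mathrm i}}\int_e(\overline{\mathbf u}\cdot\mathbf{n}_e)\{\!\{\phi\}\!\}[\![\mu]\!]$; - $a_h^{\mathrm{upw}}(\mathbf u;\phi,\overline\phi)=\sum_{e\in\mathcal{E}_h^{\mathrm i},e=K\cap L}\int_e\big((\mathbf u\cdot\mathbf n_e)_\oplus\phi_K-(\mathbf u\cdot\mathbf n_e)_\ominus\phi_L\big)[\![\overline\phi]\!]$; - $b_h^{\mathrm{upw}}(-\nabla^0_{\mathbf n}\mu;M(\phi),\overline\phi)=\sum_{e\in\mathcal{E}_h^{\mathrm i},e=K\cap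 L}\frac1{\mathcal{D}_e(\mathcal{T}_h)}\int_e\big([\![\Pi_0\mu]\!]_\oplus(M^\uparrow(\phi_K)+M^\downarrow(\phi_L))_\oplus-[\![\Pi_0\mu]\!]_\ominus(M^\uparrow(\phi_L)+M^\downarrow(\phi_K))_\oplus\big)[\![\overline\phi]\!]$, where $\nabla^0_{\mathbf n}\mu|_e=-[\![\Pi_0\mu]\!]/\mathcal{D}_e(\mathcal{T}_h)$; - $s_h^1(\mathbf u_1,\mathbf u_0,\phi_1,\phi_0,\mu,\overline{\mathbf u})=\frac12\Big\{\big(\tfrac{\rho(\phi_1)-\rho(\phi_0)}{\Delta t},\mathbf u_1\cdot\overline{\mathbf u}\big)-\big(\rho(\phi_0)\mathbf u_0-\rho_{\mathrm{dif}}M(\phi_0)\Pi_1(\nabla\mu),\nabla(\mathbf u_1\cdot\overline{\mathbf u})\big)\Big\}$; - $s_h^2(\mathbf u,\phi,\mu,\overline{\mathbf u})=-\frac12\sum_{e\in\mathcal{E}_h^{\mathrm i}}\int_e(\overline{\mathbf u}\cdot\mathbf n_e)\,\mathrm{sign}(\mathbf u\cdot\mathbf n_e)[\![\phi]\!][\![\mu]\!]$. **Scheme (one time step).** Given $\mathbf u^m\in\mathcal{U}_h$, $\phi^m\in\mathbb{P}^{\mathrm{disc}}_0(\mathcal{T}_h)$ with values in $[-1,1]$, $\mu^m\in\mathbb{P}^{\mathrm{cont}}_1(\mathcal{T}_h)$, and $\mathbf J_h^m=\rho_{\mathrm{dif}}M(\Pi^h_1\phi^m)\Pi_1(\nabla\mu^m)$,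 find $\mathbf u^{m+1}\in\mathcal{U}_h$, $p^{m+1}\in\mathcal{P}_h$ with $\int_\Omega p^{m+1}=0$, $\phi^{m+1}\in\mathbb{P}^{\mathrm{disc}}_0(\mathcal{T}_h)$, $\mu^{m+1}\in\mathbb{P}^{\mathrm{cont}}_1(\mathcal{T}_h)$ such that, for all $\overline{\mathbf u}\in\mathcal{U}_h$, $\overline p\in\mathcal{P}_h$, $\overline\phi\in\mathbb{P}^{\mathrm{disc}}_0(\mathcal{T}_h)$, $\overline\mu\in\mathbb{P}^{\mathrm{cont}}_1(\mathcal{T}_h)$: (S1) $(\rho(\Pi^h_1\phi^m)\delta_t\mathbf u^{m+1},\overline{\mathbf u})+([(\rho(\Pi^h_1\phi^m)\mathbf u^m-\mathbf J^m_h)\cdot\nabla]\mathbf u^{m+1},\overline{\mathbf u})+2(\eta(\phi^m)\mathbf D\mathbf u^{m+1},\mathbf D\overline{\mathbf u})-(p^{m+1},\nabla\cdot\overline{\mathbf u})+c_h(\phi^{m+1},\Pi_0\mu^{m+1},\overline{\mathbf u})+s_h^1(\mathbf u^{m+1},\mathbf u^m,\Pi^h_1\phi^{m+1},\Pi^h_1\phi^m,\mu^m,\overline{\mathbf u})+s_h^2(\mathbf u^{m+1},\phi^{m+1},\Pi_0\mu^{m+1},\overline{\mathbf u})=0$; (S2) $(\nabla\cdot\mathbf u^{m+1},\overline p)=0$; (S3) $(\delta_t\phi^{m+1},\overline\phi)+a_h^{\mathrm{upw}}(\mathbf u^{m+1};\phi^{m+1},\overline\phi)+b_h^{\mathrm{upw}}(-\nabla^0_{\mathbf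 n}\mu^{m+1};M(\phi^{m+1}),\overline\phi)=0$; (S4) $\lambda\varepsilon(\nabla\Pi^h_1\phi^{m+1},\nabla\overline\mu)+\frac\lambda\varepsilon(f(\Pi^h_1\phi^{m+1},\Pi^h_1\phi^m),\overline\mu)-(\mu^{m+1},\overline\mu)_h=0$. *)

theory Defs
  imports "HOL-Analysis.Analysis"
begin

section \<open>Lebesgue and Sobolev spaces on an open set\<close>

text \<open>
  Function spaces are sets of representatives \<open>real ^ 'n \<Rightarrow> 'b\<close>; only the values on the underlying
  set matter, and for Lebesgue and Sobolev spaces only up to a null set.
\<close>

definition L2 :: "(real ^ 'n) set \<Rightarrow> (real ^ 'n \<Rightarrow> 'b::euclidean_space) set" where
  "L2 S = {f \<in> borel_measurable (lebesgue_on S). integrable (lebesgue_on S) (\<lambda>x. (norm (f x))\<^sup>2)}"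

text \<open>On matrices \<open>real ^ 'n ^ 'n\<close> the library's inner product is the Frobenius product.\<close>

definition L2_prod ::
  "(real ^ 'n) set \<Rightarrow> (real ^ 'n \<Rightarrow> 'b::euclidean_space) \<Rightarrow> (real ^ 'n \<Rightarrow> 'b) \<Rightarrow> real" where
  "L2_prod S f g = (LINT x|lebesgue_on S. f x \<bullet> g x)"

definition L2_norm :: "(real ^ 'n) set \<Rightarrow> (real ^ 'n \<Rightarrow> 'b::euclidean_space) \<Rightarrow> real" where
  "L2_norm S f = sqrt (L2_prod S f f)"

definition partial :: "'n::finite \<Rightarrow> (real ^ 'n \<Rightarrow> real) \<Rightarrow> real ^ 'n \<Rightarrow> real" where
  "partial i f x = frechet_derivative f (at x) (axis i 1)"

text \<open>\<open>C_k k f\<close>: \<open>f\<close> is \<open>k\<close> times continuously differentiable on the whole space.\<close>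

primrec C_k :: "nat \<Rightarrow> (real ^ 'n \<Rightarrow> real) \<Rightarrow> bool" where
  "C_k 0 f \<longleftrightarrow> continuous_on UNIV f"
| "C_k (Suc k) f \<longleftrightarrow> (\<forall>x. f differentiable (at x)) \<and> (\<forall>i. C_k k (partial i f))"

definition test_functions :: "(real ^ 'n) set \<Rightarrow> (real ^ 'n \<Rightarrow> real) set" where
  "test_functions S = {\<psi>. (\<forall>k. C_k k \<psi>) \<and>
     compact (closure {x. \<psi> x \<noteq> 0}) \<and> closure {x. \<psi> x \<noteq> 0} \<subseteq> S}"

definition is_weak_gradient ::
  "(real ^ 'n) set \<Rightarrow> (real ^ 'n \<Rightarrow> real) \<Rightarrow> (real ^ 'n \<Rightarrow> real ^ 'n) \<Rightarrow> bool" where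
  "is_weak_gradient S f g \<longleftrightarrow> g \<in> L2 S \<and>
     (\<forall>\<psi>\<in>test_functions S. \<forall>i.
        (LINT x|lebesgue_on S. f x * partial i \<psi> x) = - (LINT x|lebesgue_on S. g x $ i * \<psi> x))"

text \<open>The weak gradient is unique up to a null set; \<open>grad\<close> picks a representative.\<close>

definition grad :: "(real ^ 'n) set \<Rightarrow> (real ^ 'n \<Rightarrow> real) \<Rightarrow> real ^ 'n \<Rightarrow> real ^ 'n" where
  "grad S f = (SOME g. is_weak_gradient S f g)"

definition H1 :: "(real ^ 'n) set \<Rightarrow> (real ^ 'n \<Rightarrow> real) set" where
  "H1 S = {f \<in> L2 S. \<exists>g. is_weak_gradient S f g}"

definition H1_norm :: "(real ^ 'n) set \<Rightarrow> (real ^ 'n \<Rightarrow> real) \<Rightarrow> real" where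
  "H1_norm S f = sqrt ((L2_norm S f)\<^sup>2 + (L2_norm S (grad S f))\<^sup>2)"

definition H1_0 :: "(real ^ 'n) set \<Rightarrow> (real ^ 'n \<Rightarrow> real) set" where
  "H1_0 S = {f \<in> H1 S. \<forall>\<epsilon>>0. \<exists>\<psi>\<in>test_functions S. H1_norm S (\<lambda>x. f x - \<psi> x) < \<epsilon>}"

text \<open>The \<open>i\<close>-th row of the Jacobian is the gradient of the \<open>i\<close>-th component.\<close>

definition jacobian :: "(real ^ 'n) set \<Rightarrow> (real ^ 'n \<Rightarrow> real ^ 'n) \<Rightarrow> real ^ 'n \<Rightarrow> real ^ 'n ^ 'n" where
  "jacobian S u x = (\<chi> i. grad S (\<lambda>y. u y $ i) x)"

definition divergence :: "(real ^ 'n) set \<Rightarrow> (real ^ 'n \<Rightarrow> real ^ 'n) \<Rightarrow> real ^ 'n \<Rightarrow> real" where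
  "divergence S u x = trace (jacobian S u x)"

definition sym_grad :: "(real ^ 'n) set \<Rightarrow> (real ^ 'n \<Rightarrow> real ^ 'n) \<Rightarrow> real ^ 'n \<Rightarrow> real ^ 'n ^ 'n" where
  "sym_grad S u x = (1/2) *\<^sub>R (jacobian S u x + transpose (jacobian S u x))"

definition H1_norm_vec :: "(real ^ 'n) set \<Rightarrow> (real ^ 'n \<Rightarrow> real ^ 'n) \<Rightarrow> real" where
  "H1_norm_vec S u = sqrt (\<Sum>i\<in>UNIV. (H1_norm S (\<lambda>x. u x $ i))\<^sup>2)"


section \<open>Domain and mesh\<close>

text \<open>
  \<open>interior (closure \<Omega>) = \<Omega>\<close> is the usual requirement that the domain lies on one side of its
  boundary (no slits), so that the mesh of \<open>closure \<Omega>\<close> determines which faces are interior.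
\<close>

definition polygonal_domain :: "(real ^ 'n) set \<Rightarrow> bool" where
  "polygonal_domain \<Omega> \<longleftrightarrow> open \<Omega> \<and> connected \<Omega> \<and> \<Omega> \<noteq> {} \<and> bounded \<Omega> \<and>
     interior (closure \<Omega>) = \<Omega> \<and>
     (\<exists>F. finite F \<and> frontier \<Omega> = \<Union>F \<and> (\<forall>P\<in>F. polytope P \<and> aff_dim P = int CARD('n) - 1))"

definition vertices :: "(real ^ 'n) set \<Rightarrow> (real ^ 'n) set" where
  "vertices K = {x. x extreme_point_of K}"

definition barycenter :: "(real ^ 'n) set \<Rightarrow> real ^ 'n" where
  "barycenter K = (1 / real (CARD('n) + 1)) *\<^sub>R (\<Sum>x\<in>vertices K. x)"

definition interior_faces :: "(real ^ 'n) set set \<Rightarrow> (real ^ 'n) set set" where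
  "interior_faces T = {K \<inter> L | K L. K \<in> T \<and> L \<in> T \<and> K \<noteq> L \<and>
     (K \<inter> L) facet_of K \<and> (K \<inter> L) facet_of L}"

definition simplicial_mesh :: "(real ^ 'n) set \<Rightarrow> (real ^ 'n) set set \<Rightarrow> bool" where
  "simplicial_mesh \<Omega> T \<longleftrightarrow>
     triangulation T \<and> (\<forall>K\<in>T. int CARD('n) simplex K) \<and> \<Union>T = closure \<Omega>"

definition shape_regular :: "real \<Rightarrow> (real ^ 'n) set set \<Rightarrow> bool" where
  "shape_regular \<sigma> T \<longleftrightarrow>
     (\<forall>K\<in>T. diameter K \<le> \<sigma> * (SUP r\<in>{r. 0 \<le> r \<and> (\<exists>x. cball x r \<subseteq> K)}. 2 * r))"

definition barycenters_orthogonal :: "(real ^ 'n) set set \<Rightarrow> bool" where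
  "barycenters_orthogonal T \<longleftrightarrow>
     (\<forall>K\<in>T. \<forall>L\<in>T. K \<noteq> L \<and> K \<inter> L \<in> interior_faces T \<longrightarrow>
        (\<forall>x\<in>K \<inter> L. \<forall>y\<in>K \<inter> L. (barycenter L - barycenter K) \<bullet> (x - y) = 0))"

definition unit_normals :: "(real ^ 'n) set set \<Rightarrow> ((real ^ 'n) set \<Rightarrow> real ^ 'n) \<Rightarrow> bool" where
  "unit_normals T n \<longleftrightarrow>
     (\<forall>e\<in>interior_faces T. norm (n e) = 1 \<and> (\<forall>x\<in>e. \<forall>y\<in>e. n e \<bullet> (x - y) = 0))"

text \<open>
  Each interior face \<open>e\<close> occurs here exactly once, as the pair \<open>(K, L)\<close> with \<open>e = K \<inter> L\<close> and
  \<open>n e\<close> exterior to \<open>K\<close>.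
\<close>

definition oriented_faces ::
  "(real ^ 'n) set set \<Rightarrow> ((real ^ 'n) set \<Rightarrow> real ^ 'n) \<Rightarrow> ((real ^ 'n) set \<times> (real ^ 'n) set) set" where
  "oriented_faces T n = {(K, L). K \<in> T \<and> L \<in> T \<and> K \<noteq> L \<and> K \<inter> L \<in> interior_faces T \<and>
     (\<forall>x\<in>K. \<forall>y\<in>K \<inter> L. n (K \<inter> L) \<bullet> (x - y) \<le> 0)}"

text \<open>
  Surface integral over a flat face \<open>e\<close> with unit normal \<open>\<nu>\<close>. The surface measure of a set in the
  hyperplane of \<open>e\<close> is the Lebesgue measure of the right prism of height one over it, so
  the integrand is extended constantly in the direction \<open>\<nu>\<close> and integrated over the prism over \<open>e\<close>;
  \<open>closest_point (affine hull e)\<close> is the orthogonal projection onto the hyperplane.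
\<close>

definition prism :: "(real ^ 'n) set \<Rightarrow> real ^ 'n \<Rightarrow> (real ^ 'n) set" where
  "prism e \<nu> = {y + t *\<^sub>R \<nu> | y t. y \<in> e \<and> t \<in> {0..1}}"

definition face_integral :: "(real ^ 'n) set \<Rightarrow> real ^ 'n \<Rightarrow> (real ^ 'n \<Rightarrow> real) \<Rightarrow> real" where
  "face_integral e \<nu> g = (LINT x|lebesgue_on (prism e \<nu>). g (closest_point (affine hull e) x))"

text \<open>\<open>cell_trace K v x\<close> is the value \<open>v\<^sub>K\<close> on a face of \<open>K\<close>: the limit of \<open>v\<close> from inside \<open>K\<close>.\<close>

definition cell_trace :: "(real ^ 'n) set \<Rightarrow> (real ^ 'n \<Rightarrow> real) \<Rightarrow> real ^ 'n \<Rightarrow> real" where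
  "cell_trace K v x = Lim (at x within interior K) v"

definition jump ::
  "(real ^ 'n) set \<Rightarrow> (real ^ 'n) set \<Rightarrow> (real ^ 'n \<Rightarrow> real) \<Rightarrow> real ^ 'n \<Rightarrow> real" where
  "jump K L v x = cell_trace K v x - cell_trace L v x"

definition average ::
  "(real ^ 'n) set \<Rightarrow> (real ^ 'n) set \<Rightarrow> (real ^ 'n \<Rightarrow> real) \<Rightarrow> real ^ 'n \<Rightarrow> real" where
  "average K L v x = (cell_trace K v x + cell_trace L v x) / 2"


section \<open>Discrete spaces and projections\<close>

text \<open>Values on the mesh skeleton are irrelevant for discontinuous functions.\<close>

definition P0_disc :: "(real ^ 'n) set set \<Rightarrow> (real ^ 'n \<Rightarrow> real) set" where
  "P0_disc T = {v. \<forall>K\<in>T. \<exists>c. \<forall>x\<in>interior K. v x = c}"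

definition P1_cont :: "(real ^ 'n) set set \<Rightarrow> (real ^ 'n \<Rightarrow> real) set" where
  "P1_cont T = {v. continuous_on (\<Union>T) v \<and> (\<forall>K\<in>T. \<exists>a b. \<forall>x\<in>K. v x = a \<bullet> x + b)}"

definition lumped_prod ::
  "(real ^ 'n) set set \<Rightarrow> (real ^ 'n \<Rightarrow> real) \<Rightarrow> (real ^ 'n \<Rightarrow> real) \<Rightarrow> real" where
  "lumped_prod T v w = 1 / real (CARD('n) + 1) *
     (\<Sum>K\<in>T. measure lebesgue K * (\<Sum>x\<in>vertices K. v x * w x))"

text \<open>
  The projections are determined by their variational equations up to irrelevant values (on the mesh
  skeleton for \<open>Pi0\<close>, outside \<open>closure \<Omega>\<close> for \<open>Pi1\<close> and \<open>Pi1h\<close>).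
\<close>

definition Pi0 ::
  "(real ^ 'n) set \<Rightarrow> (real ^ 'n) set set \<Rightarrow> (real ^ 'n \<Rightarrow> real) \<Rightarrow> real ^ 'n \<Rightarrow> real" where
  "Pi0 \<Omega> T g = (SOME v. v \<in> P0_disc T \<and> (\<forall>w\<in>P0_disc T. L2_prod \<Omega> v w = L2_prod \<Omega> g w))"

definition Pi1 ::
  "(real ^ 'n) set \<Rightarrow> (real ^ 'n) set set \<Rightarrow> (real ^ 'n \<Rightarrow> real) \<Rightarrow> real ^ 'n \<Rightarrow> real" where
  "Pi1 \<Omega> T g = (SOME v. v \<in> P1_cont T \<and> (\<forall>w\<in>P1_cont T. L2_prod \<Omega> v w = L2_prod \<Omega> g w))"

definition Pi1_vec ::
  "(real ^ 'n) set \<Rightarrow> (real ^ 'n) set set \<Rightarrow> (real ^ 'n \<Rightarrow> real ^ 'n) \<Rightarrow> real ^ 'n \<Rightarrow> real ^ 'n" where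
  "Pi1_vec \<Omega> T g x = (\<chi> i. Pi1 \<Omega> T (\<lambda>y. g y $ i) x)"

definition Pi1h ::
  "(real ^ 'n) set \<Rightarrow> (real ^ 'n) set set \<Rightarrow> (real ^ 'n \<Rightarrow> real) \<Rightarrow> real ^ 'n \<Rightarrow> real" where
  "Pi1h \<Omega> T g = (SOME v. v \<in> P1_cont T \<and> (\<forall>w\<in>P1_cont T. lumped_prod T v w = L2_prod \<Omega> g w))"

definition fun_subspace :: "('a \<Rightarrow> 'b::real_vector) set \<Rightarrow> bool" where
  "fun_subspace V \<longleftrightarrow> (\<lambda>x. 0) \<in> V \<and> (\<forall>f\<in>V. \<forall>g\<in>V. (\<lambda>x. f x + g x) \<in> V) \<and>
     (\<forall>c. \<forall>f\<in>V. (\<lambda>x. c *\<^sub>R f x) \<in> V)"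

text \<open>Finite dimension is meant for the space of almost-everywhere classes.\<close>

definition finite_dim_on :: "(real ^ 'n) set \<Rightarrow> (real ^ 'n \<Rightarrow> 'b::real_vector) set \<Rightarrow> bool" where
  "finite_dim_on S V \<longleftrightarrow>
     (\<exists>B. finite B \<and> B \<subseteq> V \<and> (\<forall>f\<in>V. \<exists>c. AE x in lebesgue_on S. f x = (\<Sum>b\<in>B. c b *\<^sub>R b x)))"

definition velocity_space :: "(real ^ 'n) set \<Rightarrow> (real ^ 'n \<Rightarrow> real ^ 'n) set \<Rightarrow> bool" where
  "velocity_space \<Omega> U \<longleftrightarrow> fun_subspace U \<and> finite_dim_on \<Omega> U \<and>
     (\<forall>u\<in>U. continuous_on (closure \<Omega>) u \<and> (\<forall>i. (\<lambda>x. u x $ i) \<in> H1_0 \<Omega>))"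

definition pressure_space ::
  "(real ^ 'n) set \<Rightarrow> (real ^ 'n) set set \<Rightarrow> (real ^ 'n \<Rightarrow> real) set \<Rightarrow> bool" where
  "pressure_space \<Omega> T P \<longleftrightarrow>
     fun_subspace P \<and> finite_dim_on \<Omega> P \<and> P \<subseteq> L2 \<Omega> \<and> P0_disc T \<subseteq> P"

definition inf_sup_compatible ::
  "real \<Rightarrow> (real ^ 'n) set \<Rightarrow> (real ^ 'n \<Rightarrow> real ^ 'n) set \<Rightarrow> (real ^ 'n \<Rightarrow> real) set \<Rightarrow> bool" where
  "inf_sup_compatible \<beta> \<Omega> U P \<longleftrightarrow> 0 < \<beta> \<and>
     ereal \<beta> \<le> (INF p\<in>{p \<in> P. (LINT x|lebesgue_on \<Omega>. p x) = 0 \<and> L2_norm \<Omega> p \<noteq> 0}.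
                  SUP u\<in>{u \<in> U. H1_norm_vec \<Omega> u \<noteq> 0}.
                    ereal (L2_prod \<Omega> p (divergence \<Omega> u) / (L2_norm \<Omega> p * H1_norm_vec \<Omega> u)))"


section \<open>Constitutive functions\<close>

definition pos_part :: "real \<Rightarrow> real" where
  "pos_part v = max v 0"

definition neg_part :: "real \<Rightarrow> real" where
  "neg_part v = - min v 0"

definition rho_dif :: "real \<Rightarrow> real \<Rightarrow> real" where
  "rho_dif \<rho>1 \<rho>2 = (\<rho>2 - \<rho>1) / 2"

definition rho :: "real \<Rightarrow> real \<Rightarrow> real \<Rightarrow> real" where
  "rho \<rho>1 \<rho>2 \<phi> = (\<rho>1 + \<rho>2) / 2 + rho_dif \<rho>1 \<rho>2 * \<phi>"

definition mob :: "real \<Rightarrow> real" where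
  "mob \<phi> = pos_part (1 - \<phi>\<^sup>2)"

definition mob_up :: "real \<Rightarrow> real" where
  "mob_up z = (if z \<le> 0 then mob z else mob 0)"

definition mob_down :: "real \<Rightarrow> real" where
  "mob_down z = (if z \<le> 0 then 0 else mob z - mob 0)"

definition F_i :: "real \<Rightarrow> real" where
  "F_i \<phi> = \<phi>\<^sup>2 + 1/4"

definition F_e :: "real \<Rightarrow> real" where
  "F_e \<phi> = \<phi>^4 / 4 - 3/2 * \<phi>\<^sup>2"

definition f_pot :: "real \<Rightarrow> real \<Rightarrow> real" where
  "f_pot \<phi>1 \<phi>0 = deriv F_i \<phi>1 + deriv F_e \<phi>0"


section \<open>Forms\<close>

definition c_h ::
  "(real ^ 'n) set set \<Rightarrow> ((real ^ 'n) set \<Rightarrow> real ^ 'n) \<Rightarrow>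
   (real ^ 'n \<Rightarrow> real) \<Rightarrow> (real ^ 'n \<Rightarrow> real) \<Rightarrow> (real ^ 'n \<Rightarrow> real ^ 'n) \<Rightarrow> real" where
  "c_h T n \<phi> \<mu> ub =
     - (\<Sum>K\<in>T. L2_prod (interior K) (divergence (interior K) (\<lambda>x. \<phi> x *\<^sub>R ub x)) \<mu>)
     - (\<Sum>(K, L)\<in>oriented_faces T n. face_integral (K \<inter> L) (n (K \<inter> L))
          (\<lambda>x. (ub x \<bullet> n (K \<inter> L)) * average K L \<phi> x * jump K L \<mu> x))"

definition a_upw ::
  "(real ^ 'n) set set \<Rightarrow> ((real ^ 'n) set \<Rightarrow> real ^ 'n) \<Rightarrow>
   (real ^ 'n \<Rightarrow> real ^ 'n) \<Rightarrow> (real ^ 'n \<Rightarrow> real) \<Rightarrow> (real ^ 'n \<Rightarrow> real) \<Rightarrow> real" where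
  "a_upw T n u \<phi> \<phi>b =
     (\<Sum>(K, L)\<in>oriented_faces T n. face_integral (K \<inter> L) (n (K \<inter> L))
        (\<lambda>x. (pos_part (u x \<bullet> n (K \<inter> L)) * cell_trace K \<phi> x
              - neg_part (u x \<bullet> n (K \<inter> L)) * cell_trace L \<phi> x) * jump K L \<phi>b x))"

text \<open>
  \<open>b_upw \<Omega> T n \<mu> \<phi> \<phi>b\<close> is the form with first argument \<open>-\<nabla>\<^sup>0\<mu>\<close>, whose normal
  component on \<open>e = K \<inter> L\<close> is \<open>jump K L (Pi0 \<Omega> T \<mu>) / \<D>\<^sub>e\<close>.
\<close>

definition b_upw ::
  "(real ^ 'n) set \<Rightarrow> (real ^ 'n) set set \<Rightarrow> ((real ^ 'n) set \<Rightarrow> real ^ 'n) \<Rightarrow>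
   (real ^ 'n \<Rightarrow> real) \<Rightarrow> (real ^ 'n \<Rightarrow> real) \<Rightarrow> (real ^ 'n \<Rightarrow> real) \<Rightarrow> real" where
  "b_upw \<Omega> T n \<mu> \<phi> \<phi>b =
     (\<Sum>(K, L)\<in>oriented_faces T n. 1 / dist (barycenter K) (barycenter L) *
        face_integral (K \<inter> L) (n (K \<inter> L))
          (\<lambda>x. (pos_part (jump K L (Pi0 \<Omega> T \<mu>) x)
                  * pos_part (mob_up (cell_trace K \<phi> x) + mob_down (cell_trace L \<phi> x))
                - neg_part (jump K L (Pi0 \<Omega> T \<mu>) x)
                  * pos_part (mob_up (cell_trace L \<phi> x) + mob_down (cell_trace K \<phi> x)))
               * jump K L \<phi>b x))"

definition s1_h ::
  "(real ^ 'n) set \<Rightarrow> (real ^ 'n) set set \<Rightarrow> real \<Rightarrow> real \<Rightarrow> real \<Rightarrow>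
   (real ^ 'n \<Rightarrow> real ^ 'n) \<Rightarrow> (real ^ 'n \<Rightarrow> real ^ 'n) \<Rightarrow>
   (real ^ 'n \<Rightarrow> real) \<Rightarrow> (real ^ 'n \<Rightarrow> real) \<Rightarrow> (real ^ 'n \<Rightarrow> real) \<Rightarrow>
   (real ^ 'n \<Rightarrow> real ^ 'n) \<Rightarrow> real" where
  "s1_h \<Omega> T \<rho>1 \<rho>2 \<Delta>t u1 u0 \<phi>1 \<phi>0 \<mu> ub = 1/2 *
     (L2_prod \<Omega> (\<lambda>x. (rho \<rho>1 \<rho>2 (\<phi>1 x) - rho \<rho>1 \<rho>2 (\<phi>0 x)) / \<Delta>t) (\<lambda>x. u1 x \<bullet> ub x)
      - L2_prod \<Omega>
          (\<lambda>x. rho \<rho>1 \<rho>2 (\<phi>0 x) *\<^sub>R u0 x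
                - (rho_dif \<rho>1 \<rho>2 * mob (\<phi>0 x)) *\<^sub>R Pi1_vec \<Omega> T (grad \<Omega> \<mu>) x)
          (grad \<Omega> (\<lambda>x. u1 x \<bullet> ub x)))"

definition s2_h ::
  "(real ^ 'n) set set \<Rightarrow> ((real ^ 'n) set \<Rightarrow> real ^ 'n) \<Rightarrow> (real ^ 'n \<Rightarrow> real ^ 'n) \<Rightarrow>
   (real ^ 'n \<Rightarrow> real) \<Rightarrow> (real ^ 'n \<Rightarrow> real) \<Rightarrow> (real ^ 'n \<Rightarrow> real ^ 'n) \<Rightarrow> real" where
  "s2_h T n u \<phi> \<mu> ub = - 1/2 *
     (\<Sum>(K, L)\<in>oriented_faces T n. face_integral (K \<inter> L) (n (K \<inter> L))
        (\<lambda>x. (ub x \<bullet> n (K \<inter> L)) * sgn (u x \<bullet> n (K \<inter> L)) * jump K L \<phi> x * jump K L \<mu> x))"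


section \<open>The scheme\<close>

text \<open>In the equations below, index \<open>0\<close> refers to time step \<open>m\<close> and index \<open>1\<close> to \<open>m + 1\<close>.\<close>

definition flux_J ::
  "(real ^ 'n) set \<Rightarrow> (real ^ 'n) set set \<Rightarrow> real \<Rightarrow> real \<Rightarrow>
   (real ^ 'n \<Rightarrow> real) \<Rightarrow> (real ^ 'n \<Rightarrow> real) \<Rightarrow> real ^ 'n \<Rightarrow> real ^ 'n" where
  "flux_J \<Omega> T \<rho>1 \<rho>2 \<phi>0 \<mu>0 x =
     (rho_dif \<rho>1 \<rho>2 * mob (Pi1h \<Omega> T \<phi>0 x)) *\<^sub>R Pi1_vec \<Omega> T (grad \<Omega> \<mu>0) x"

definition eq_momentum ::
  "(real ^ 'n) set \<Rightarrow> (real ^ 'n) set set \<Rightarrow> ((real ^ 'n) set \<Rightarrow> real ^ 'n) \<Rightarrow>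
   real \<Rightarrow> real \<Rightarrow> real \<Rightarrow> (real \<Rightarrow> real) \<Rightarrow>
   (real ^ 'n \<Rightarrow> real ^ 'n) \<Rightarrow> (real ^ 'n \<Rightarrow> real) \<Rightarrow> (real ^ 'n \<Rightarrow> real) \<Rightarrow>
   (real ^ 'n \<Rightarrow> real ^ 'n) \<Rightarrow> (real ^ 'n \<Rightarrow> real) \<Rightarrow> (real ^ 'n \<Rightarrow> real) \<Rightarrow> (real ^ 'n \<Rightarrow> real) \<Rightarrow>
   (real ^ 'n \<Rightarrow> real ^ 'n) \<Rightarrow> bool" where
  "eq_momentum \<Omega> T n \<rho>1 \<rho>2 \<Delta>t \<eta> u0 \<phi>0 \<mu>0 u1 p1 \<phi>1 \<mu>1 ub \<longleftrightarrow>
     L2_prod \<Omega> (\<lambda>x. rho \<rho>1 \<rho>2 (Pi1h \<Omega> T \<phi>0 x) *\<^sub>R ((1 / \<Delta>t) *\<^sub>R (u1 x - u0 x))) ub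
     + L2_prod \<Omega> (\<lambda>x. jacobian \<Omega> u1 x *v
           (rho \<rho>1 \<rho>2 (Pi1h \<Omega> T \<phi>0 x) *\<^sub>R u0 x - flux_J \<Omega> T \<rho>1 \<rho>2 \<phi>0 \<mu>0 x)) ub
     + 2 * L2_prod \<Omega> (\<lambda>x. \<eta> (\<phi>0 x) *\<^sub>R sym_grad \<Omega> u1 x) (sym_grad \<Omega> ub)
     - L2_prod \<Omega> p1 (divergence \<Omega> ub)
     + c_h T n \<phi>1 (Pi0 \<Omega> T \<mu>1) ub
     + s1_h \<Omega> T \<rho>1 \<rho>2 \<Delta>t u1 u0 (Pi1h \<Omega> T \<phi>1) (Pi1h \<Omega> T \<phi>0) \<mu>0 ub
     + s2_h T n u1 \<phi>1 (Pi0 \<Omega> T \<mu>1) ub = 0"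

definition eq_incompressible ::
  "(real ^ 'n) set \<Rightarrow> (real ^ 'n \<Rightarrow> real ^ 'n) \<Rightarrow> (real ^ 'n \<Rightarrow> real) \<Rightarrow> bool" where
  "eq_incompressible \<Omega> u1 pb \<longleftrightarrow> L2_prod \<Omega> (divergence \<Omega> u1) pb = 0"

definition eq_phase ::
  "(real ^ 'n) set \<Rightarrow> (real ^ 'n) set set \<Rightarrow> ((real ^ 'n) set \<Rightarrow> real ^ 'n) \<Rightarrow> real \<Rightarrow>
   (real ^ 'n \<Rightarrow> real) \<Rightarrow>
   (real ^ 'n \<Rightarrow> real ^ 'n) \<Rightarrow> (real ^ 'n \<Rightarrow> real) \<Rightarrow> (real ^ 'n \<Rightarrow> real) \<Rightarrow>
   (real ^ 'n \<Rightarrow> real) \<Rightarrow> bool" where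
  "eq_phase \<Omega> T n \<Delta>t \<phi>0 u1 \<phi>1 \<mu>1 \<phi>b \<longleftrightarrow>
     L2_prod \<Omega> (\<lambda>x. (\<phi>1 x - \<phi>0 x) / \<Delta>t) \<phi>b + a_upw T n u1 \<phi>1 \<phi>b + b_upw \<Omega> T n \<mu>1 \<phi>1 \<phi>b = 0"

definition eq_potential ::
  "(real ^ 'n) set \<Rightarrow> (real ^ 'n) set set \<Rightarrow> real \<Rightarrow> real \<Rightarrow>
   (real ^ 'n \<Rightarrow> real) \<Rightarrow> (real ^ 'n \<Rightarrow> real) \<Rightarrow> (real ^ 'n \<Rightarrow> real) \<Rightarrow>
   (real ^ 'n \<Rightarrow> real) \<Rightarrow> bool" where
  "eq_potential \<Omega> T lam \<epsilon> \<phi>0 \<phi>1 \<mu>1 \<mu>b \<longleftrightarrow>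
     lam * \<epsilon> * L2_prod \<Omega> (grad \<Omega> (Pi1h \<Omega> T \<phi>1)) (grad \<Omega> \<mu>b)
     + lam / \<epsilon> * L2_prod \<Omega> (\<lambda>x. f_pot (Pi1h \<Omega> T \<phi>1 x) (Pi1h \<Omega> T \<phi>0 x)) \<mu>b
     - lumped_prod T \<mu>1 \<mu>b = 0"

definition scheme_solution ::
  "(real ^ 'n) set \<Rightarrow> (real ^ 'n) set set \<Rightarrow> ((real ^ 'n) set \<Rightarrow> real ^ 'n) \<Rightarrow>
   (real ^ 'n \<Rightarrow> real ^ 'n) set \<Rightarrow> (real ^ 'n \<Rightarrow> real) set \<Rightarrow>
   real \<Rightarrow> real \<Rightarrow> real \<Rightarrow> real \<Rightarrow> real \<Rightarrow> (real \<Rightarrow> real) \<Rightarrow>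
   (real ^ 'n \<Rightarrow> real ^ 'n) \<Rightarrow> (real ^ 'n \<Rightarrow> real) \<Rightarrow> (real ^ 'n \<Rightarrow> real) \<Rightarrow>
   (real ^ 'n \<Rightarrow> real ^ 'n) \<Rightarrow> (real ^ 'n \<Rightarrow> real) \<Rightarrow> (real ^ 'n \<Rightarrow> real) \<Rightarrow> (real ^ 'n \<Rightarrow> real) \<Rightarrow>
   bool" where
  "scheme_solution \<Omega> T n U P \<rho>1 \<rho>2 lam \<epsilon> \<Delta>t \<eta> u0 \<phi>0 \<mu>0 u1 p1 \<phi>1 \<mu>1 \<longleftrightarrow>
     u1 \<in> U \<and> p1 \<in> P \<and> (LINT x|lebesgue_on \<Omega>. p1 x) = 0 \<and> \<phi>1 \<in> P0_disc T \<and> \<mu>1 \<in> P1_cont T \<and>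
     (\<forall>ub\<in>U. eq_momentum \<Omega> T n \<rho>1 \<rho>2 \<Delta>t \<eta> u0 \<phi>0 \<mu>0 u1 p1 \<phi>1 \<mu>1 ub) \<and>
     (\<forall>pb\<in>P. eq_incompressible \<Omega> u1 pb) \<and>
     (\<forall>\<phi>b\<in>P0_disc T. eq_phase \<Omega> T n \<Delta>t \<phi>0 u1 \<phi>1 \<mu>1 \<phi>b) \<and>
     (\<forall>\<mu>b\<in>P1_cont T. eq_potential \<Omega> T lam \<epsilon> \<phi>0 \<phi>1 \<mu>1 \<mu>b)"

end

theory Submission
  imports Defs
begin

text \<open>
  Test the phase equation with the indicator of a cell \<open>K\<close> on which the new phase attains its maximum.
  If that maximum exceeded one, the degenerate mobility would block every diffusive inflow into \<open>K\<close>,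
  and the upwind transport could only lower the value, because the total flux of the discretely divergence-free
  velocity through the interior faces of \<open>K\<close> vanishes; so the value would already have exceeded one
  at the previous step. The minimum is symmetric, and the lumped projection takes at each node a weighted
  average of cell values.

  The vanishing of the flux is a divergence theorem for functions that are merely continuous and in \<open>H\<^sup>1\<^sub>0\<close>.
  For an edge vector \<open>v\<close> of \<open>K\<close> and \<open>f \<in> H\<^sup>1\<^sub>0\<close>, extended by zero, the integral of \<open>f\<close> over \<open>K + hv\<close> has
  right derivative \<open>\<integral>\<^sub>K \<nabla>f \<bullet> v\<close> at \<open>h = 0\<close>. On the other hand
  \<open>K + hv\<close> and \<open>K\<close> differ exactly by the prisms that two of the facets sweep out. Taking edges that end at a vertex
  opposite an interior face, boundary facets are only crossed outwards, where \<open>f\<close> is zero, so no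
  trace theorem is needed; these edges span the space.
\<close>

text \<open>Incompressibility is tested only with pressures, and what the argument draws from it is
  one number per cell, the integral of the divergence. The transport term needs this number as a sum
  of face integrals, although the velocity has only weak derivatives and \<open>grad\<close> is a
  mere choice of one. Two features overcome this. A face integral is by definition a volume integral
  over a unit prism, and an affine map carries that prism to the thin one swept in direction
  \<open>h *\<^sub>R v\<close>, with Jacobian proportional to \<open>h\<close>. And for fixed
  \<open>h\<close> the error of replacing \<open>f\<close> by a test function can be made
  arbitrarily small, so the test function is gone before the division by \<open>h\<close>. An inward
  sweep over a boundary facet would bring in boundary values of \<open>f\<close>, whose vanishing is
  a trace statement; hence the condition on the edges. As for the mobility: above one
  \<open>mob_down\<close> equals -1, which outweighs \<open>mob_up\<close>, at most 1; below minus
  one \<open>mob_up\<close> is 0 and \<open>mob_down\<close> is never positive.\<close>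

section \<open>Volume change under affine maps that move points in a fixed direction\<close>

text \<open>
  Integrating over the fibres in direction \<open>a\<close> reduces the substitution to a real affine one. The library's
  substitution rule for linear maps requires a well-ordered index type.
\<close>

lemma nn_integral_lborel_fibre:
  fixes f :: "'a::euclidean_space \<Rightarrow> ennreal" and a w :: 'a
  assumes f: "f \<in> borel_measurable borel" and a: "a \<noteq> 0" and c: "1 + w \<bullet> a \<noteq> 0"
  shows "(\<integral>\<^sup>+x. f x \<partial>lborel) = ennreal \<bar>1 + w \<bullet> a\<bar> * (\<integral>\<^sup>+x. f (x + (w \<bullet> x + b) *\<^sub>R a) \<partial>lborel)"
proof -
  \<comment> \<open>With \<open>m \<bullet> a = 1\<close>, a shift of \<open>x\<close> by
    \<open>s *\<^sub>R a\<close> changes \<open>m \<bullet> x\<close> by exactly \<open>s\<close>.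
    The weight \<open>k (m \<bullet> x + s)\<close> has integral one in \<open>s\<close> for every
    \<open>x\<close>, so it inserts a fibre variable without changing the integral.\<close>
  define m where "m = (1 / (a \<bullet> a)) *\<^sub>R a"
  have ma: "m \<bullet> a = 1" using a by (simp add: m_def)
  define k :: "real \<Rightarrow> ennreal" where "k = indicator {0..1}"
  have k1: "(\<integral>\<^sup>+s. k (r + s) \<partial>lborel) = 1" for r :: real
  proof -
    have "(\<integral>\<^sup>+s. k s \<partial>lborel) = 1" by (simp add: k_def)
    then have "(\<integral>\<^sup>+s. k (r + 1 * s) \<partial>lborel) = 1"
      using nn_integral_real_affine[of k 1 r] by (simp add: k_def)
    then show ?thesis by simp
  qed
  have kb [measurable]: "k \<in> borel_measurable borel" by (simp add: k_def)
  note f [measurable]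
  \<comment> \<open>Stated for arbitrary \<open>w\<close> and \<open>b\<close>: the instance with
    both zero rewrites the left side of the goal, the given one the right side. The inner fibre
    integrals then differ only by a real affine substitution.\<close>
  have key: "(\<integral>\<^sup>+x. f (x + (w \<bullet> x + b) *\<^sub>R a) \<partial>lborel)
      = (\<integral>\<^sup>+y. k (m \<bullet> y) * (\<integral>\<^sup>+s. f (y + (w \<bullet> y + b) *\<^sub>R a + (- s * (1 + w \<bullet> a)) *\<^sub>R a) \<partial>lborel) \<partial>lborel)"
    for w :: 'a and b :: real
  proof -
    let ?T = "\<lambda>x. x + (w \<bullet> x + b) *\<^sub>R a"
    have T: "?T (y - s *\<^sub>R a) = y + (w \<bullet> y + b) *\<^sub>R a + (- s * (1 + w \<bullet> a)) *\<^sub>R a" for y and s :: real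
      by (simp add: algebra_simps)
    have "(\<integral>\<^sup>+x. f (?T x) \<partial>lborel) = (\<integral>\<^sup>+x. (\<integral>\<^sup>+s. f (?T x) * k (m \<bullet> x + s) \<partial>lborel) \<partial>lborel)"
      by (subst nn_integral_cmult) (auto simp: k1)
    also have "\<dots> = (\<integral>\<^sup>+s. (\<integral>\<^sup>+x. f (?T x) * k (m \<bullet> x + s) \<partial>lborel) \<partial>lborel)"
      by (rule lborel_pair.Fubini'[symmetric]) measurable
    also have "\<dots> = (\<integral>\<^sup>+s. (\<integral>\<^sup>+y. f (?T (y - s *\<^sub>R a)) * k (m \<bullet> y) \<partial>lborel) \<partial>lborel)"
    proof (rule nn_integral_cong)
      fix s :: real
      let ?g = "\<lambda>x. f (?T x) * k (m \<bullet> x + s)"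
      have "(\<integral>\<^sup>+x. ?g x \<partial>lborel) = (\<integral>\<^sup>+x. ?g x \<partial>distr lborel borel ((+) (- s *\<^sub>R a)))"
        by (simp only: lborel_distr_plus)
      also have "\<dots> = (\<integral>\<^sup>+y. ?g (- s *\<^sub>R a + y) \<partial>lborel)"
        by (rule nn_integral_distr) measurable
      finally show "(\<integral>\<^sup>+x. ?g x \<partial>lborel) = (\<integral>\<^sup>+y. f (?T (y - s *\<^sub>R a)) * k (m \<bullet> y) \<partial>lborel)"
        by (simp add: ma inner_diff_right)
    qed
    also have "\<dots> = (\<integral>\<^sup>+y. (\<integral>\<^sup>+s. f (?T (y - s *\<^sub>R a)) * k (m \<bullet> y) \<partial>lborel) \<partial>lborel)"
      by (rule lborel_pair.Fubini') measurable
    also have "\<dots> = (\<integral>\<^sup>+y. k (m \<bullet> y) * (\<integral>\<^sup>+s. f (?T (y - s *\<^sub>R a)) \<partial>lborel) \<partial>lborel)"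
      by (subst nn_integral_multc) (auto simp: mult.commute)
    finally show ?thesis unfolding T .
  qed
  have aff: "(\<integral>\<^sup>+s. f (y + - s *\<^sub>R a) \<partial>lborel)
      = ennreal \<bar>1 + w \<bullet> a\<bar> * (\<integral>\<^sup>+s. f (y + (w \<bullet> y + b) *\<^sub>R a + (- s * (1 + w \<bullet> a)) *\<^sub>R a) \<partial>lborel)" for y
  proof -
    have "(\<integral>\<^sup>+s. f (y + - s *\<^sub>R a) \<partial>lborel) = ennreal \<bar>1 + w \<bullet> a\<bar> *
        (\<integral>\<^sup>+s. f (y + - (- (w \<bullet> y + b) + (1 + w \<bullet> a) * s) *\<^sub>R a) \<partial>lborel)"
      by (rule nn_integral_real_affine) (use c in \<open>simp_all\<close>)
    also have "(\<lambda>s. f (y + - (- (w \<bullet> y + b) + (1 + w \<bullet> a) * s) *\<^sub>R a))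
      = (\<lambda>s. f (y + (w \<bullet> y + b) *\<^sub>R a + (- s * (1 + w \<bullet> a)) *\<^sub>R a))"
      by (simp add: algebra_simps)
    finally show ?thesis .
  qed
  have "(\<integral>\<^sup>+x. f x \<partial>lborel) = (\<integral>\<^sup>+y. k (m \<bullet> y) * (\<integral>\<^sup>+s. f (y + - s *\<^sub>R a) \<partial>lborel) \<partial>lborel)"
    using key[of 0 0] by simp
  also have "\<dots> = (\<integral>\<^sup>+y. ennreal \<bar>1 + w \<bullet> a\<bar> * (k (m \<bullet> y) *
      (\<integral>\<^sup>+s. f (y + (w \<bullet> y + b) *\<^sub>R a + (- s * (1 + w \<bullet> a)) *\<^sub>R a) \<partial>lborel)) \<partial>lborel)"
    unfolding aff by (simp add: ac_simps)
  also have "\<dots> = ennreal \<bar>1 + w \<bullet> a\<bar> * (\<integral>\<^sup>+x. f (x + (w \<bullet> x + b) *\<^sub>R a) \<partial>lborel)"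
    unfolding key[of w b] by (rule nn_integral_cmult) measurable
  finally show ?thesis .
qed

text \<open>The linear part is the identity plus a matrix of rank one, whose determinant is
  \<open>1 + w \<bullet> a\<close>. The tilting of a prism and the exchange of two vertices of a
  simplex are both of this form.\<close>

lemma lborel_rank_one_affine:
  fixes a w :: "'a::euclidean_space"
  assumes c: "1 + w \<bullet> a \<noteq> 0"
  shows "lborel = density (distr lborel borel (\<lambda>x. x + (w \<bullet> x + b) *\<^sub>R a)) (\<lambda>_. ennreal \<bar>1 + w \<bullet> a\<bar>)"
    (is "_ = density ?D _")
proof (cases "a = 0")
  case True
  have "distr lborel borel (\<lambda>x. x) = (lborel :: 'a measure)"
    by (rule distr_id2) simp
  with True show ?thesis by (simp add: density_1)
next
  case False
  show ?thesis
  proof (rule measure_eqI)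
    fix A :: "'a set" assume "A \<in> sets lborel"
    then have A [measurable]: "A \<in> sets borel" by simp
    have "emeasure lborel A = (\<integral>\<^sup>+x. indicator A x \<partial>lborel)" by simp
    also have "\<dots> = ennreal \<bar>1 + w \<bullet> a\<bar> * (\<integral>\<^sup>+x. indicator A (x + (w \<bullet> x + b) *\<^sub>R a) \<partial>lborel)"
      by (rule nn_integral_lborel_fibre[OF _ False c]) simp
    also have "(\<integral>\<^sup>+x. indicator A (x + (w \<bullet> x + b) *\<^sub>R a) \<partial>lborel) = (\<integral>\<^sup>+x. indicator A x \<partial>?D)"
      by (rule nn_integral_distr[symmetric]) measurable
    also have "\<dots> = emeasure ?D A" by simp
    finally show "emeasure lborel A = emeasure (density ?D (\<lambda>_. ennreal \<bar>1 + w \<bullet> a\<bar>)) A"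
      by (subst emeasure_density) (auto simp: nn_integral_cmult)
  qed simp
qed

lemma integral_rank_one_affine:
  fixes a w :: "'a::euclidean_space" and f :: "'a \<Rightarrow> real"
  assumes c: "1 + w \<bullet> a \<noteq> 0" and f [measurable]: "f \<in> borel_measurable borel"
  shows "(LINT x|lborel. f x) = \<bar>1 + w \<bullet> a\<bar> * (LINT x|lborel. f (x + (w \<bullet> x + b) *\<^sub>R a))"
proof -
  have "(LINT x|lborel. f x)
      = (LINT x|density (distr lborel borel (\<lambda>x. x + (w \<bullet> x + b) *\<^sub>R a)) (\<lambda>_. ennreal \<bar>1 + w \<bullet> a\<bar>). f x)"
    using lborel_rank_one_affine[OF c, of b] by simp
  also have "\<dots> = \<bar>1 + w \<bullet> a\<bar> * (LINT x|distr lborel borel (\<lambda>x. x + (w \<bullet> x + b) *\<^sub>R a). f x)"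
    by (subst integral_density) auto
  also have "(LINT x|distr lborel borel (\<lambda>x. x + (w \<bullet> x + b) *\<^sub>R a). f x)
      = (LINT x|lborel. f (x + (w \<bullet> x + b) *\<^sub>R a))"
    by (rule integral_distr) auto
  finally show ?thesis .
qed

section \<open>Barycentric coordinates\<close>

text \<open>After translating a vertex \<open>d\<close> to the origin the remaining ones are
  linearly independent, so a linear functional with prescribed values exists; its adjoint at 1 is
  the representing vector \<open>w\<close>.\<close>

lemma affine_coordinate_exists:
  fixes C :: "'a::euclidean_space set"
  assumes C: "\<not> affine_dependent C" and c: "c \<in> C"
  shows "\<exists>w b. \<forall>a\<in>C. w \<bullet> a + b = of_bool (a = c)"
proof (cases "C = {c}")
  case True
  then show ?thesis by (intro exI[of _ 0] exI[of _ 1]) simp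
next
  case False
  then obtain d where d: "d \<in> C" "d \<noteq> c" using c by blast
  let ?B = "(\<lambda>x. -d + x) ` (C - {d})"
  have "independent ?B"
    using C affine_dependent_iff_dependent2[OF d(1)] by blast
  then obtain g where g: "linear g" "\<forall>x\<in>?B. g x = (if x = c - d then 1 else (0::real))"
    using linear_independent_extend[of ?B "\<lambda>x. if x = c - d then 1 else (0::real)"] by blast
  define w where "w = adjoint g 1"
  have gw: "g x = w \<bullet> x" for x
    using adjoint_works[OF g(1), of x 1] by (simp add: w_def inner_commute)
  have "w \<bullet> a + - (w \<bullet> d) = of_bool (a = c)" if "a \<in> C" for a
  proof (cases "a = d")
    case True with d show ?thesis by simp
  next
    case False
    with that have "-d + a \<in> ?B" by blast
    with g have "g (-d + a) = (if -d + a = c - d then 1 else 0)" by blast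
    then show ?thesis by (auto simp: gw inner_add_right inner_diff_right split: if_splits)
  qed
  then show ?thesis by blast
qed

text \<open>Coefficients of the barycentric coordinate that belongs to \<open>c\<close>. Keeping
  vector and offset apart puts the interior of a simplex into the form
  \<open>0 < p i \<bullet> x + b i\<close>, in which all polyhedra are treated below.\<close>

definition bary_pair :: "'a::euclidean_space set \<Rightarrow> 'a \<Rightarrow> 'a \<times> real" where
  "bary_pair C c = (SOME p. \<forall>a\<in>C. fst p \<bullet> a + snd p = of_bool (a = c))"

definition bgrad :: "'a::euclidean_space set \<Rightarrow> 'a \<Rightarrow> 'a" where
  "bgrad C c = fst (bary_pair C c)"

definition bary :: "'a::euclidean_space set \<Rightarrow> 'a \<Rightarrow> 'a \<Rightarrow> real" where
  "bary C c x = bgrad C c \<bullet> x + snd (bary_pair C c)"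

locale full_simplex =
  fixes C :: "(real ^ 'n) set"
  assumes indep: "\<not> affine_dependent C" and card_C: "card C = CARD('n) + 1"
begin

abbreviation "K \<equiv> convex hull C"

lemma finite_C [simp, intro]: "finite C"
  using aff_independent_finite indep by blast

lemma bary_vertex: "c \<in> C \<Longrightarrow> a \<in> C \<Longrightarrow> bary C c a = of_bool (a = c)"
proof -
  assume c: "c \<in> C" and a: "a \<in> C"
  have "\<exists>p. \<forall>a\<in>C. fst p \<bullet> a + snd p = of_bool (a = c)"
    using affine_coordinate_exists[OF indep c] by auto
  from someI_ex[OF this] a show ?thesis
    by (simp add: bary_def bgrad_def bary_pair_def)
qed

lemma bary_add: "bary C c (x + t *\<^sub>R v) = bary C c x + t * (bgrad C c \<bullet> v)"
  by (simp add: bary_def inner_add_right)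

lemma bary_sub: "bary C c x - bary C c y = bgrad C c \<bullet> (x - y)"
  by (simp add: bary_def inner_diff_right)

lemma bgrad_edge:
  "c \<in> C \<Longrightarrow> i \<in> C \<Longrightarrow> j \<in> C \<Longrightarrow> bgrad C c \<bullet> (j - i) = of_bool (j = c) - of_bool (i = c)"
  using bary_sub[of c j i] by (simp add: bary_vertex)

lemma continuous_on_bary [continuous_intros]:
  "continuous_on S f \<Longrightarrow> continuous_on S (\<lambda>x. bary C c (f x))"
  unfolding bary_def by (intro continuous_intros)

lemma bary_measurable [measurable]: "bary C c \<in> borel_measurable borel"
  by (intro borel_measurable_continuous_onI continuous_intros)

lemma bary_combination:
  assumes "sum u C = 1" and "c \<in> C"
  shows "bary C c (\<Sum>a\<in>C. u a *\<^sub>R a) = u c"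
proof -
  have "bary C c (\<Sum>a\<in>C. u a *\<^sub>R a) = (\<Sum>a\<in>C. u a * (bgrad C c \<bullet> a)) + (\<Sum>a\<in>C. u a) * snd (bary_pair C c)"
    using assms by (simp add: bary_def inner_sum_right)
  also have "\<dots> = (\<Sum>a\<in>C. u a * bary C c a)"
    by (simp add: bary_def algebra_simps sum.distrib sum_distrib_right)
  also have "\<dots> = (\<Sum>a\<in>C. if a = c then u a else 0)"
    by (intro sum.cong) (auto simp: bary_vertex assms)
  also have "\<dots> = u c" using assms by simp
  finally show ?thesis .
qed

lemma affine_hull_C: "affine hull C = UNIV"
proof -
  have "aff_dim C = int (CARD('n))"
    using aff_dim_affine_independent[OF indep] card_C by simp
  then show ?thesis by (simp add: aff_dim_eq_full[symmetric])
qed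

lemma bary_rep: "(\<Sum>c\<in>C. bary C c x) = 1" "(\<Sum>c\<in>C. bary C c x *\<^sub>R c) = x"
proof -
  have "x \<in> affine hull C" using affine_hull_C by simp
  then obtain u where u: "sum u C = 1" "(\<Sum>a\<in>C. u a *\<^sub>R a) = x"
    by (auto simp: affine_hull_finite)
  have "bary C c x = u c" if "c \<in> C" for c
    using bary_combination[OF u(1) that] u(2) by simp
  with u show "(\<Sum>c\<in>C. bary C c x) = 1" "(\<Sum>c\<in>C. bary C c x *\<^sub>R c) = x"
    by simp_all
qed

lemma mem_K: "x \<in> K \<longleftrightarrow> (\<forall>c\<in>C. 0 \<le> bary C c x)"
proof
  assume "x \<in> K"
  then obtain u where u: "\<forall>c\<in>C. 0 \<le> u c" "sum u C = 1" "(\<Sum>a\<in>C. u a *\<^sub>R a) = x"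
    by (auto simp: convex_hull_finite)
  then show "\<forall>c\<in>C. 0 \<le> bary C c x"
    using bary_combination[OF u(2)] by auto
next
  assume "\<forall>c\<in>C. 0 \<le> bary C c x"
  then show "x \<in> K"
    using bary_rep[of x] by (auto simp: convex_hull_finite intro!: exI[of _ "\<lambda>c. bary C c x"])
qed

lemma bary_le_1: "x \<in> K \<Longrightarrow> c \<in> C \<Longrightarrow> bary C c x \<le> 1"
proof -
  assume x: "x \<in> K" and c: "c \<in> C"
  have "bary C c x \<le> (\<Sum>c\<in>C. bary C c x)"
    using x c by (intro member_le_sum) (auto simp: mem_K)
  then show ?thesis by (simp add: bary_rep)
qed

lemma other_vertex: "c \<in> C \<Longrightarrow> \<exists>a\<in>C. a \<noteq> c"
proof (rule ccontr)
  assume "c \<in> C" "\<not> (\<exists>a\<in>C. a \<noteq> c)"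
  then have "C = {c}" by blast
  with card_C show False by simp
qed

lemma C_ne: "C \<noteq> {}"
  using card_C by auto

lemma bgrad_nz: "c \<in> C \<Longrightarrow> bgrad C c \<noteq> 0"
proof
  assume c: "c \<in> C" and 0: "bgrad C c = 0"
  obtain a where "a \<in> C" "a \<noteq> c" using other_vertex[OF c] by blast
  with bgrad_edge[OF c, of a c] c 0 show False by simp
qed

lemma negligible_bary: "c \<in> C \<Longrightarrow> negligible {x. bary C c x = r}"
proof -
  assume c: "c \<in> C"
  have "{x. bary C c x = r} = {x. bgrad C c \<bullet> x = r - snd (bary_pair C c)}"
    by (auto simp: bary_def)
  then show ?thesis using negligible_hyperplane[of "bgrad C c"] bgrad_nz[OF c] by simp
qed

lemma interior_K: "interior K = {x. \<forall>c\<in>C. 0 < bary C c x}"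
proof
  have "{x. \<forall>c\<in>C. 0 < bary C c x} = (\<Inter>c\<in>C. {x. 0 < bary C c x})" by auto
  also have "open \<dots>"
    by (intro open_INT ballI finite_C open_Collect_less continuous_intros)
  finally show "{x. \<forall>c\<in>C. 0 < bary C c x} \<subseteq> interior K"
    by (intro interior_maximal) (auto simp: mem_K less_imp_le)
  show "interior K \<subseteq> {x. \<forall>c\<in>C. 0 < bary C c x}"
  proof safe
    fix x c assume x: "x \<in> interior K" and c: "c \<in> C"
    obtain e where e: "e > 0" "ball x e \<subseteq> K" using x by (auto simp: mem_interior)
    \<comment> \<open>A step of this size against the gradient has length \<open>e / 2\<close>, so
      it stays in the ball and lowers the coordinate by a positive amount.\<close>
    define t where "t = e / (2 * norm (bgrad C c))"
    have n0: "norm (bgrad C c) > 0" using bgrad_nz[OF c] by simp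
    have t: "t > 0" using e n0 by (simp add: t_def)
    have "dist x (x + (-t) *\<^sub>R bgrad C c) = e / 2"
      using n0 e by (simp add: dist_norm t_def)
    then have "x + (-t) *\<^sub>R bgrad C c \<in> K" using e by (intro subsetD[OF e(2)]) simp
    then have "0 \<le> bary C c (x + (-t) *\<^sub>R bgrad C c)" using c by (simp add: mem_K)
    then have "bary C c x \<ge> t * (bgrad C c \<bullet> bgrad C c)" unfolding bary_add by simp
    moreover have "t * (bgrad C c \<bullet> bgrad C c) > 0" using t bgrad_nz[OF c] by simp
    ultimately show "0 < bary C c x" by linarith
  qed
qed

lemma interior_ne: "interior K \<noteq> {}"
proof -
  let ?u = "\<lambda>c::real ^ 'n. 1 / real (card C)"
  have pos: "real (card C) > 0" using card_C by linarith
  have "sum ?u C = 1" using C_ne by simp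
  then have "(\<Sum>a\<in>C. ?u a *\<^sub>R a) \<in> interior K"
    using bary_combination[of ?u] pos unfolding interior_K by auto
  then show ?thesis by blast
qed

lemma compact_K: "compact K"
  by (simp add: finite_imp_compact compact_convex_hull)

lemma closure_interior_K: "closure (interior K) = K"
  using convex_closure_interior[of K] interior_ne compact_K
  by (simp add: compact_imp_closed)

abbreviation "facet c \<equiv> convex hull (C - {c})"

lemma mem_facet: "c \<in> C \<Longrightarrow> x \<in> facet c \<longleftrightarrow> x \<in> K \<and> bary C c x = 0"
proof
  assume c: "c \<in> C" and "x \<in> facet c"
  then obtain u where u: "\<forall>a\<in>C - {c}. 0 \<le> u a" "sum u (C - {c}) = 1" "(\<Sum>a\<in>C - {c}. u a *\<^sub>R a) = x"
    by (auto simp: convex_hull_finite)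
  define u' where "u' = u(c := 0)"
  have "sum u' C = sum u (C - {c})" "(\<Sum>a\<in>C. u' a *\<^sub>R a) = (\<Sum>a\<in>C - {c}. u a *\<^sub>R a)"
    using c by (auto simp: u'_def sum.remove[of C c] intro!: sum.cong)
  with u have u'1: "sum u' C = 1" and u'x: "(\<Sum>a\<in>C. u' a *\<^sub>R a) = x" by simp_all
  have b: "bary C a x = u' a" if "a \<in> C" for a
    using bary_combination[OF u'1 that] u'x by simp
  then show "x \<in> K \<and> bary C c x = 0"
    using u c by (auto simp: mem_K u'_def)
next
  assume c: "c \<in> C" and x: "x \<in> K \<and> bary C c x = 0"
  have "(\<Sum>a\<in>C - {c}. bary C a x) = 1" "(\<Sum>a\<in>C - {c}. bary C a x *\<^sub>R a) = x"
    using bary_rep[of x] x c by (simp_all add: sum.remove[of C c])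
  moreover have "\<forall>a\<in>C - {c}. 0 \<le> bary C a x" using x by (simp add: mem_K)
  moreover have "finite (C - {c})" by simp
  ultimately show "x \<in> facet c"
    unfolding convex_hull_finite[OF \<open>finite (C - {c})\<close>]
    by (intro CollectI exI[of _ "\<lambda>a. bary C a x"] conjI)
qed

lemma affine_hull_facet: "c \<in> C \<Longrightarrow> affine hull (facet c) = {x. bary C c x = 0}"
proof -
  assume c: "c \<in> C"
  have "affine hull (C - {c}) = {x. bary C c x = 0}"
  proof
    have "{x. bary C c x = 0} = {x. bgrad C c \<bullet> x = - snd (bary_pair C c)}"
      by (auto simp: bary_def)
    then have "affine {x. bary C c x = 0}" by (simp add: affine_hyperplane)
    then show "affine hull (C - {c}) \<subseteq> {x. bary C c x = 0}"
      by (intro hull_minimal) (auto simp: bary_vertex c)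
    show "{x. bary C c x = 0} \<subseteq> affine hull (C - {c})"
    proof safe
      fix x assume x: "bary C c x = 0"
      have "(\<Sum>a\<in>C - {c}. bary C a x) = 1" "(\<Sum>a\<in>C - {c}. bary C a x *\<^sub>R a) = x"
        using bary_rep[of x] x c by (simp_all add: sum.remove[of C c])
      then show "x \<in> affine hull (C - {c})"
        by (auto simp: affine_hull_finite intro!: exI[of _ "\<lambda>c. bary C c x"])
    qed
  qed
  then show ?thesis by simp
qed

lemma facet_of_K: "S facet_of K \<longleftrightarrow> (\<exists>c\<in>C. S = facet c)"
proof -
  have "C - {c} \<noteq> {}" if "c \<in> C" for c using other_vertex[OF that] by blast
  then show ?thesis
    by (auto simp: facet_of_convex_hull_affine_independent[OF indep])
qed

lemma face_of_K: "S face_of K \<longleftrightarrow> (\<exists>D\<subseteq>C. S = convex hull D)"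
  using face_of_convex_hull_affine_independent[OF indep] by auto

lemma facet_inj: "c \<in> C \<Longrightarrow> d \<in> C \<Longrightarrow> facet c = facet d \<Longrightarrow> c = d"
proof (rule ccontr)
  assume c: "c \<in> C" and d: "d \<in> C" and eq: "facet c = facet d" and ne: "c \<noteq> d"
  have "c \<in> facet d" using c ne by (intro hull_inc) simp
  then have "bary C c c = 0" using mem_facet[OF c, of c] eq by simp
  then show False using c by (simp add: bary_vertex)
qed

lemma negligible_frontier_K: "negligible (K - interior K)"
proof (rule negligible_subset)
  show "negligible (\<Union>c\<in>C. {x. bary C c x = 0})"
    by (intro negligible_Union) (auto intro: negligible_bary)
  show "K - interior K \<subseteq> (\<Union>c\<in>C. {x. bary C c x = 0})"
    by (force simp: interior_K mem_K)
qed

text \<open>The component \<open>d\<close> of \<open>n\<close> orthogonal to the gradient is a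
  direction inside the hyperplane of the facet, and \<open>n\<close> is orthogonal to all such
  directions; hence \<open>d \<bullet> d = 0\<close>.\<close>

lemma facet_normal:
  assumes c: "c \<in> C" and n: "\<And>x y. x \<in> facet c \<Longrightarrow> y \<in> facet c \<Longrightarrow> n \<bullet> (x - y) = 0"
  shows "n = (n \<bullet> bgrad C c / (bgrad C c \<bullet> bgrad C c)) *\<^sub>R bgrad C c"
proof -
  let ?w = "bgrad C c"
  define r where "r = n \<bullet> ?w / (?w \<bullet> ?w)"
  define d where "d = n - r *\<^sub>R ?w"
  have ww: "?w \<bullet> ?w \<noteq> 0" using bgrad_nz[OF c] by simp
  have dw: "d \<bullet> ?w = 0" using ww by (simp add: d_def r_def inner_diff_left)
  obtain a where a: "a \<in> C" "a \<noteq> c" using other_vertex[OF c] by blast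
  have nd: "n \<bullet> d = 0"
  proof -
    have "bary C c (a + 1 *\<^sub>R d) = 0"
      unfolding bary_add using dw a c by (simp add: bary_vertex inner_commute)
    then have "a + d \<in> affine hull (C - {c})"
      using affine_hull_facet[OF c] by simp
    moreover have "affine hull (C - {c}) \<subseteq> {x. n \<bullet> x = n \<bullet> a}"
    proof (rule hull_minimal)
      show "C - {c} \<subseteq> {x. n \<bullet> x = n \<bullet> a}"
      proof
        fix y assume "y \<in> C - {c}"
        then have "n \<bullet> (y - a) = 0" using a by (intro n hull_inc) auto
        then show "y \<in> {x. n \<bullet> x = n \<bullet> a}" by (simp add: inner_diff_right)
      qed
    qed (rule affine_hyperplane)
    ultimately have "n \<bullet> (a + d) = n \<bullet> a" by blast
    then show ?thesis by (simp add: inner_add_right)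
  qed
  have "d \<bullet> d = n \<bullet> d - r * (d \<bullet> ?w)" 
  proof -
    have "d \<bullet> d = d \<bullet> n - r * (d \<bullet> ?w)"
      using inner_diff_right[of d n "r *\<^sub>R ?w"] by (simp only: d_def[symmetric] inner_scaleR_right)
    then show ?thesis by (simp add: inner_commute)
  qed
  then have "d = 0" using nd dw by simp
  then show ?thesis by (simp add: d_def r_def)
qed

end

section \<open>Smooth test functions\<close>

lemma has_derivative_partial:
  fixes f :: "real ^ 'n \<Rightarrow> real"
  assumes "f differentiable (at x)"
  shows "(f has_derivative (\<lambda>h. \<Sum>i\<in>UNIV. h $ i * partial i f x)) (at x)"
proof -
  have f: "(f has_derivative frechet_derivative f (at x)) (at x)"
    using assms frechet_derivative_works by blast
  have lin: "linear (frechet_derivative f (at x))"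
    using f has_derivative_linear by blast
  have "frechet_derivative f (at x) h = (\<Sum>i\<in>UNIV. h $ i * partial i f x)" for h
  proof -
    have "frechet_derivative f (at x) h = frechet_derivative f (at x) (\<Sum>i\<in>UNIV. h $ i *\<^sub>R axis i 1)"
      using basis_expansion[of h] by (simp add: scalar_mult_eq_scaleR)
    also have "\<dots> = (\<Sum>i\<in>UNIV. h $ i * partial i f x)"
      by (simp add: linear_sum[OF lin] linear_scale[OF lin] partial_def)
    finally show ?thesis .
  qed
  then have "frechet_derivative f (at x) = (\<lambda>h. \<Sum>i\<in>UNIV. h $ i * partial i f x)" by (rule ext)
  with f show ?thesis by simp
qed

lemma partial_eq:
  assumes "(f has_derivative f') (at x)"
  shows "partial i f x = f' (axis i 1)"
  using frechet_derivative_at[OF assms] by (simp add: partial_def)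

lemma partial_mult:
  assumes "f differentiable (at x)" "g differentiable (at x)"
  shows "partial i (\<lambda>x. f x * g x) x = f x * partial i g x + partial i f x * g x"
proof -
  note f = assms(1)[unfolded frechet_derivative_works] and g = assms(2)[unfolded frechet_derivative_works]
  show ?thesis
    using partial_eq[OF has_derivative_mult[OF f g], of i] by (simp add: partial_def)
qed

lemma partial_add:
  assumes "f differentiable (at x)" "g differentiable (at x)"
  shows "partial i (\<lambda>x. f x + g x) x = partial i f x + partial i g x"
proof -
  note f = assms(1)[unfolded frechet_derivative_works] and g = assms(2)[unfolded frechet_derivative_works]
  show ?thesis
    using partial_eq[OF has_derivative_add[OF f g], of i] by (simp add: partial_def)
qed

lemma C_k_Suc_imp: "C_k (Suc k) f \<Longrightarrow> C_k k f"
proof (induction k arbitrary: f)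
  case 0
  then show ?case
    by (auto intro!: continuous_at_imp_continuous_on differentiable_imp_continuous_within)
qed simp

lemma C_k_const [simp]: "C_k k (\<lambda>x. c)"
proof (induction k arbitrary: c)
  case (Suc k)
  have "partial i (\<lambda>x. c) = (\<lambda>x. 0)" for i :: 'a
    by (rule ext) (simp add: partial_eq[OF has_derivative_const])
  with Suc show ?case by simp
qed simp

lemma C_k_add: "C_k k f \<Longrightarrow> C_k k g \<Longrightarrow> C_k k (\<lambda>x. f x + g x)"
proof (induction k arbitrary: f g)
  case (Suc k)
  then have "partial i (\<lambda>x. f x + g x) = (\<lambda>x. partial i f x + partial i g x)" for i
    by (auto intro!: partial_add)
  with Suc show ?case by auto
qed (auto intro: continuous_intros)

lemma C_k_mult: "C_k k f \<Longrightarrow> C_k k g \<Longrightarrow> C_k k (\<lambda>x. f x * g x)"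
proof (induction k arbitrary: f g)
  case (Suc k)
  then have "partial i (\<lambda>x. f x * g x) = (\<lambda>x. f x * partial i g x + partial i f x * g x)" for i
    by (auto intro!: partial_mult)
  moreover have "C_k k f" "C_k k g" using Suc.prems by (auto intro: C_k_Suc_imp simp del: C_k.simps)
  ultimately show ?case using Suc by (auto intro!: C_k_add)
qed (auto intro: continuous_intros)

lemma C_k_diff: "C_k k f \<Longrightarrow> C_k k g \<Longrightarrow> C_k k (\<lambda>x. f x - g x)"
  using C_k_add[of k f "\<lambda>x. -1 * g x"] C_k_mult[of k "\<lambda>x. -1" g] by simp

lemma C_k_power: "C_k k f \<Longrightarrow> C_k k (\<lambda>x. f x ^ m)"
  by (induction m) (auto intro: C_k_mult)

lemma C_k_prod: "finite I \<Longrightarrow> (\<And>i. i \<in> I \<Longrightarrow> C_k k (f i)) \<Longrightarrow> C_k k (\<lambda>x. \<Prod>i\<in>I. f i x)"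
  by (induction I rule: finite_induct) (auto intro: C_k_mult)

lemma C_k_affine: "C_k k (\<lambda>x. w \<bullet> x + b)"
proof (cases k)
  case (Suc j)
  have d: "((\<lambda>x. w \<bullet> x + b) has_derivative (\<lambda>h. w \<bullet> h)) (at x)" for x
    by (auto intro!: derivative_eq_intros)
  then have "partial i (\<lambda>x. w \<bullet> x + b) = (\<lambda>x. w \<bullet> axis i 1)" for i
    unfolding fun_eq_iff by (simp add: partial_eq[OF d])
  with d Suc show ?thesis by (auto simp: differentiable_def)
qed (auto intro!: continuous_intros)

text \<open>The outer functions come as a family closed under differentiation, \<open>s j\<close>
  being the index of the derivative of \<open>D j\<close>. The induction on \<open>k\<close> runs
  over all indices at once.\<close>

lemma C_k_compose:
  fixes D :: "'b \<Rightarrow> real \<Rightarrow> real"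
  assumes D: "\<And>j t. (D j has_real_derivative D (s j) t) (at t)" and p: "\<And>k. C_k k p"
  shows "C_k k (\<lambda>x. D j (p x))"
proof (induction k arbitrary: j)
  case 0
  have "continuous_on UNIV (D j)"
    using D by (intro continuous_at_imp_continuous_on ballI DERIV_isCont) blast
  moreover have "continuous_on UNIV p" using p[of 0] by simp
  ultimately show ?case
    using continuous_on_compose2[of UNIV "D j" UNIV p] by simp
next
  case (Suc k)
  have pd: "p differentiable (at x)" for x using p[of 1] by simp
  have d: "((\<lambda>x. D j (p x)) has_derivative (\<lambda>h. D (s j) (p x) * frechet_derivative p (at x) h)) (at x)" for x
    using has_derivative_compose[OF pd[of x, unfolded frechet_derivative_works]
      D[of j "p x", unfolded has_field_derivative_def]] by simp
  then have "partial i (\<lambda>x. D j (p x)) = (\<lambda>x. D (s j) (p x) * partial i p x)" for i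
    unfolding fun_eq_iff by (simp add: partial_eq[OF d] partial_def)
  moreover have "C_k k (partial i p)" for i using p[of "Suc k"] by simp
  ultimately show ?case
    using d Suc by (auto simp: differentiable_def intro!: C_k_mult)
qed

section \<open>Smooth bump functions on polyhedra\<close>

text \<open>The classical flat function \<open>exp (- (1 / t))\<close> with a polynomial factor in
  \<open>1 / t\<close>. The factor closes the family under differentiation: the derivative replaces
  \<open>p\<close> by \<open>[:0, 0, 1:] * (p - pderiv p)\<close>.\<close>

definition flat :: "real poly \<Rightarrow> real \<Rightarrow> real" where
  "flat p t = (if 0 < t then poly p (1 / t) * exp (- (1 / t)) else 0)"

lemma poly_times_exp_tendsto_0: "((\<lambda>x. poly p x * exp (- x)) \<longlongrightarrow> (0::real)) at_top"
proof -
  \<comment> \<open>The extra power \<open>x ^ k\<close> absorbs the factor \<open>x\<close> that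
    each step of the induction on \<open>p\<close> brings in.\<close>
  have "((\<lambda>x. x ^ k * (poly p x * exp (- x))) \<longlongrightarrow> (0::real)) at_top" for k
  proof (induction p arbitrary: k)
    case (pCons a p)
    have "((\<lambda>x. a * (x ^ k / exp x) + x ^ Suc k * (poly p x * exp (- x))) \<longlongrightarrow> a * 0 + 0) at_top"
      by (intro tendsto_intros tendsto_power_div_exp_0 pCons.IH)
    then show ?case
      by (simp add: algebra_simps exp_minus divide_inverse)
  qed simp
  from this[of 0] show ?thesis by simp
qed

lemma flat_derivative:
  "(flat p has_real_derivative flat ([:0, 0, 1:] * (p - pderiv p)) t) (at t)"
proof -
  let ?q = "[:0, 0, 1:] * (p - pderiv p)"
  consider "t > 0" | "t < 0" | "t = 0" by linarith
  then show ?thesis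
  proof cases
    case 1
    have "((\<lambda>t. poly p (1 / t) * exp (- (1 / t))) has_real_derivative flat ?q t) (at t)"
      using 1 by (auto simp: flat_def field_simps power2_eq_square
          intro!: derivative_eq_intros DERIV_chain'[where g="poly p"])
    then show ?thesis
      using 1 by (rule_tac has_field_derivative_transform_within_open[where S="{0<..}"])
        (auto simp: flat_def)
  next
    case 2
    have "((\<lambda>t. 0) has_real_derivative flat ?q t) (at t)"
      using 2 by (simp add: flat_def)
    then show ?thesis
      using 2 by (rule_tac has_field_derivative_transform_within_open[where S="{..<0}"])
        (auto simp: flat_def)
  next
    case 3
    have "((\<lambda>h. (flat p (0 + h) - flat p 0) / h) \<longlongrightarrow> 0) (at_right 0)"
    proof -
      \<comment> \<open>Division by \<open>h\<close> raises the polynomial in \<open>1 / h\<close>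
        by one power, which gives \<open>pCons 0 p\<close>.\<close>
      have "((\<lambda>h. poly (pCons 0 p) (inverse h) * exp (- inverse h)) \<longlongrightarrow> 0) (at_right 0)"
        by (rule filterlim_compose[OF poly_times_exp_tendsto_0 filterlim_inverse_at_top_right])
      moreover have "\<forall>\<^sub>F h in at_right 0. poly (pCons 0 p) (inverse h) * exp (- inverse h)
          = (flat p (0 + h) - flat p 0) / h"
        by (auto simp: flat_def eventually_at_filter field_simps)
      ultimately show ?thesis by (rule Lim_transform_eventually)
    qed
    moreover have "((\<lambda>h. (flat p (0 + h) - flat p 0) / h) \<longlongrightarrow> 0) (at_left 0)"
      by (rule Lim_transform_eventually[OF tendsto_const]) (auto simp: flat_def eventually_at_filter)
    ultimately show ?thesis
      using 3 by (simp add: DERIV_def filterlim_split_at flat_def)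
  qed
qed

definition flat_exp :: "real \<Rightarrow> real" where
  "flat_exp = flat 1"

lemma flat_exp_pos: "0 < flat_exp t \<longleftrightarrow> 0 < t"
  and flat_exp_le_1: "flat_exp t \<le> 1"
  and flat_exp_nonneg: "0 \<le> flat_exp t"
  by (auto simp: flat_exp_def flat_def)

lemma C_k_flat_exp: "(\<And>k. C_k k p) \<Longrightarrow> C_k k (\<lambda>x. flat_exp (p x))"
  unfolding flat_exp_def
  by (rule C_k_compose[where D=flat and s="\<lambda>p. [:0, 0, 1:] * (p - pderiv p)"])
    (rule flat_derivative)

text \<open>Positive exactly where all forms \<open>w i \<bullet> x + b i\<close> are. The support
  need not be compact, so this is not yet a test function; \<open>annihilator_polyhedron\<close>
  multiplies by a factor supported in finitely many boxes.\<close>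

definition poly_bump :: "('b \<Rightarrow> real ^ 'n) \<Rightarrow> ('b \<Rightarrow> real) \<Rightarrow> 'b set \<Rightarrow> real ^ 'n \<Rightarrow> real" where
  "poly_bump w b I x = (\<Prod>i\<in>I. flat_exp (w i \<bullet> x + b i))"

lemma poly_bump_C_k: "finite I \<Longrightarrow> C_k k (poly_bump w b I)"
  unfolding poly_bump_def by (intro C_k_prod C_k_flat_exp C_k_affine)

lemma poly_bump_bounds: "0 \<le> poly_bump w b I x" "poly_bump w b I x \<le> 1"
  unfolding poly_bump_def by (auto intro!: prod_nonneg prod_le_1 flat_exp_nonneg flat_exp_le_1)

lemma poly_bump_pos: "finite I \<Longrightarrow> 0 < poly_bump w b I x \<longleftrightarrow> (\<forall>i\<in>I. 0 < w i \<bullet> x + b i)"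
proof
  assume I: "finite I" and "0 < poly_bump w b I x"
  then have "\<forall>i\<in>I. flat_exp (w i \<bullet> x + b i) \<noteq> 0"
    unfolding poly_bump_def by (metis prod_zero less_irrefl)
  then show "\<forall>i\<in>I. 0 < w i \<bullet> x + b i"
    using flat_exp_nonneg flat_exp_pos by (metis order_less_le)
qed (auto simp: poly_bump_def flat_exp_pos intro!: prod_pos)

lemma box_bump:
  fixes l r :: "real ^ 'n"
  shows "\<exists>B. (\<forall>k. C_k k B) \<and> (\<forall>x. 0 \<le> B x \<and> B x \<le> 1 \<and> (0 < B x \<longleftrightarrow> x \<in> box l r))"
proof -
  \<comment> \<open>One factor per side of the box: \<open>s = 1\<close> stands for the lower bound
    in coordinate \<open>i\<close>, \<open>s = -1\<close> for the upper one.\<close>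
  let ?w = "\<lambda>(i, s). s *\<^sub>R axis i (1::real)"
  let ?b = "\<lambda>(i, s). if s = 1 then - l $ i else r $ i"
  let ?I = "UNIV \<times> {1, -1 :: real}"
  let ?B = "poly_bump ?w ?b ?I"
  have "C_k k ?B" for k by (intro poly_bump_C_k) simp
  moreover have "0 \<le> ?B x" "?B x \<le> 1" for x by (rule poly_bump_bounds)+
  moreover have "0 < ?B x \<longleftrightarrow> x \<in> box l r" for x
    by (subst poly_bump_pos) (auto simp: mem_box_cart inner_axis' split: if_splits)
  ultimately show ?thesis by (intro exI[of _ ?B] conjI allI)
qed

lemma one_minus_power_tendsto:
  fixes b :: real
  assumes "0 \<le> b" "b \<le> 1"
  shows "(\<lambda>m. 1 - (1 - b) ^ m) \<longlonglongrightarrow> of_bool (0 < b)"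
proof (cases "b = 0")
  case False
  with assms have "(\<lambda>m. (1 - b) ^ m) \<longlonglongrightarrow> 0" by (intro LIMSEQ_power_zero) auto
  then have "(\<lambda>m. 1 - (1 - b) ^ m) \<longlonglongrightarrow> 1 - 0"
    by (rule tendsto_diff[OF tendsto_const])
  moreover have "of_bool (0 < b) = (1 - 0 :: real)" using False assms by simp
  ultimately show ?thesis by (simp only:)
qed simp

section \<open>Functions orthogonal to all test functions\<close>

text \<open>An open set is a countable union of closed boxes, and passing to the open boxes loses
  only a null set. The closed boxes provide compact supports inside \<open>S\<close>, the open ones
  carry the bumps.\<close>

lemma open_eq_boxes_ae:
  fixes S :: "(real ^ 'n) set"
  assumes "open S"
  obtains l r :: "nat \<Rightarrow> real ^ 'n" where "\<And>j. cbox (l j) (r j) \<subseteq> S"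
    "negligible (S - (\<Union>j. box (l j) (r j)))"
proof (cases "S = {}")
  case True
  have "cbox 1 (0 :: real ^ 'n) = {}" by (simp add: interval_eq_empty_cart)
  then show ?thesis using True that[of "\<lambda>_. 1" "\<lambda>_. 0"] by simp
next
  case False
  obtain D where D: "countable D" "D \<subseteq> Pow S" "\<And>X. X \<in> D \<Longrightarrow> \<exists>a b. X = cbox a b" "\<Union>D = S"
    using open_countable_Union_open_cbox[OF assms] by metis
  have "D \<noteq> {}" using D(4) False by auto
  then have rng: "range (from_nat_into D) = D" using D(1) by (simp add: range_from_nat_into)
  have "\<forall>j. \<exists>a b. from_nat_into D j = cbox a b"
    using D(3)[OF from_nat_into[OF \<open>D \<noteq> {}\<close>]] by simp
  then obtain l r where lr: "\<And>j. from_nat_into D j = cbox (l j) (r j)" by metis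
  show ?thesis
  proof
    show "cbox (l j) (r j) \<subseteq> S" for j
      using subsetD[OF D(2) from_nat_into[OF \<open>D \<noteq> {}\<close>, of j]] lr[of j] by simp
    show "negligible (S - (\<Union>j. box (l j) (r j)))"
    proof (rule negligible_subset)
      show "negligible (\<Union>j. cbox (l j) (r j) - box (l j) (r j))"
        by (intro negligible_Union_nat) (simp add: negligible_frontier_interval)
      have "(\<lambda>j. cbox (l j) (r j)) = from_nat_into D" using lr by (simp add: fun_eq_iff)
      then have "S = (\<Union>j. cbox (l j) (r j))" using D(4) rng by metis
      then show "S - (\<Union>j. box (l j) (r j)) \<subseteq> (\<Union>j. cbox (l j) (r j) - box (l j) (r j))" by auto
    qed
  qed
qed

text \<open>For a bump \<open>B\<close> with values in \<open>[0, 1]\<close>, the functions \<open>1 - (1 - B)\<^sup>m\<close> are smooth and tend to the indicator of \<open>B > 0\<close>.\<close>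

lemma annihilator_polyhedron:
  fixes q :: "real ^ 'n \<Rightarrow> real" and w :: "'b \<Rightarrow> real ^ 'n"
  assumes S: "open S" and q: "integrable (lebesgue_on S) q"
    and ann: "\<And>\<theta>. \<theta> \<in> test_functions S \<Longrightarrow> (LINT x|lebesgue_on S. q x * \<theta> x) = 0"
    and I: "finite I"
  shows "(LINT x|lebesgue_on S. q x * indicator {x. \<forall>i\<in>I. 0 < w i \<bullet> x + b i} x) = 0"
proof -
  let ?A = "{x. \<forall>i\<in>I. 0 < w i \<bullet> x + b i}"
  let ?P = "poly_bump w b I"
  obtain l r :: "nat \<Rightarrow> real ^ 'n" where lr: "\<And>j. cbox (l j) (r j) \<subseteq> S" "negligible (S - (\<Union>j. box (l j) (r j)))"
    using open_eq_boxes_ae[OF S] by blast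
  have "\<exists>B :: nat \<Rightarrow> real ^ 'n \<Rightarrow> real.
      \<forall>j. (\<forall>k. C_k k (B j)) \<and> (\<forall>x. 0 \<le> B j x \<and> B j x \<le> 1 \<and> (0 < B j x \<longleftrightarrow> x \<in> box (l j) (r j)))"
    by (intro choice allI box_bump)
  then obtain B :: "nat \<Rightarrow> real ^ 'n \<Rightarrow> real" where B: "\<And>j k. C_k k (B j)" "\<And>j x. 0 \<le> B j x"
    "\<And>j x. B j x \<le> 1" "\<And>j x. 0 < B j x \<longleftrightarrow> x \<in> box (l j) (r j)"
    by auto
  \<comment> \<open>The first factor tends to the indicator of the polyhedron. The second vanishes
    outside the first \<open>m\<close> boxes, which makes the support compact in \<open>S\<close>,
    and tends to 1 on the union of the open boxes.\<close>
  define \<theta> where "\<theta> m x = (1 - (1 - ?P x) ^ m) * (1 - (\<Prod>j<m. (1 - B j x) ^ m))" for m x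
  have prod01: "0 \<le> (\<Prod>j<m. (1 - B j x) ^ m)" "(\<Prod>j<m. (1 - B j x) ^ m) \<le> 1" for m x
    using B(2,3)[of _ x] by (auto intro!: prod_nonneg prod_le_1 zero_le_power power_le_one)
  have pow01: "0 \<le> (1 - ?P x) ^ m" "(1 - ?P x) ^ m \<le> 1" for m x
    using poly_bump_bounds[of w b I x] by (auto intro!: zero_le_power power_le_one)
  have \<theta>01: "0 \<le> \<theta> m x" "\<theta> m x \<le> 1" for m x
    using prod01[where m=m and x=x] pow01[where m=m and x=x] by (auto simp: \<theta>_def intro!: mult_le_one)
  have test: "\<theta> m \<in> test_functions S" for m
  proof -
    have supp: "{x. \<theta> m x \<noteq> 0} \<subseteq> (\<Union>j<m. cbox (l j) (r j))"
    proof (rule subsetI, rule ccontr)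
      fix x assume x: "x \<in> {x. \<theta> m x \<noteq> 0}" and "x \<notin> (\<Union>j<m. cbox (l j) (r j))"
      then have "x \<notin> box (l j) (r j)" if "j < m" for j
        using that box_subset_cbox[of "l j" "r j"] by auto
      then have "\<forall>j<m. B j x = 0"
        using B(2)[of _ x] B(4)[of _ x] by (metis order_less_le)
      then have "\<theta> m x = 0" by (simp add: \<theta>_def)
      with x show False by simp
    qed
    have comp: "compact (\<Union>j<m. cbox (l j) (r j))" by (intro compact_UN) auto
    have cl: "closure {x. \<theta> m x \<noteq> 0} \<subseteq> (\<Union>j<m. cbox (l j) (r j))"
      using closure_minimal[OF supp] comp compact_imp_closed by blast
    then have "compact (closure {x. \<theta> m x \<noteq> 0})"
      using compact_Int_closed[OF comp closed_closure, of "{x. \<theta> m x \<noteq> 0}"] by (simp add: Int_absorb1)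
    moreover have "C_k k (\<theta> m)" for k
      unfolding \<theta>_def[abs_def] using B(1) I
      by (intro C_k_mult C_k_diff C_k_power C_k_prod C_k_const poly_bump_C_k) auto
    ultimately show ?thesis
      using cl lr(1) by (auto simp: test_functions_def)
  qed
  have [measurable]: "\<theta> m \<in> borel_measurable borel" for m
    using test[of m] by (intro borel_measurable_continuous_onI) (auto simp: test_functions_def elim!: allE[of _ 0])
  have A: "?A \<in> sets borel"
  proof -
    have "?A = (\<Inter>i\<in>I. {x. 0 < w i \<bullet> x + b i})" by auto
    moreover have "open \<dots>"
      by (intro open_INT I ballI open_Collect_less continuous_intros)
    ultimately show ?thesis by simp
  qed
  have meas: "h \<in> borel_measurable borel \<Longrightarrow> h \<in> borel_measurable (lebesgue_on S)" for h :: "real ^ 'n \<Rightarrow> real"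
    by (simp add: measurable_restrict_space1 measurable_completion)
  note [measurable] = borel_measurable_integrable[OF q]
  have lim: "(\<lambda>m. \<theta> m x) \<longlonglongrightarrow> indicator ?A x" if x: "x \<in> (\<Union>j. box (l j) (r j))" for x
  proof -
    have "(\<lambda>m. 1 - (1 - ?P x) ^ m) \<longlonglongrightarrow> of_bool (0 < ?P x)"
      by (intro one_minus_power_tendsto poly_bump_bounds)
    moreover have "(\<lambda>m. \<Prod>j<m. (1 - B j x) ^ m) \<longlonglongrightarrow> 0"
    proof -
      obtain j where j: "x \<in> box (l j) (r j)" using x by blast
      have "(\<lambda>m. (1 - B j x) ^ m) \<longlonglongrightarrow> 0"
        using j B(3)[of j x] B(4)[of j x] by (intro LIMSEQ_power_zero) auto
      \<comment> \<open>All factors lie in [0, 1], so a single box that contains \<open>x\<close>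
        forces the product to zero.\<close>
      moreover have "\<forall>\<^sub>F m in sequentially. (\<Prod>j<m. (1 - B j x) ^ m) \<le> (1 - B j x) ^ m"
      proof (rule eventually_sequentiallyI[of "Suc j"])
        fix m assume "Suc j \<le> m"
        then have "(\<Prod>j<m. (1 - B j x) ^ m) = (1 - B j x) ^ m * (\<Prod>j\<in>{..<m} - {j}. (1 - B j x) ^ m)"
          by (intro prod.remove) auto
        also have "\<dots> \<le> (1 - B j x) ^ m * 1"
          using B(2,3)[of _ x] by (intro mult_left_mono prod_le_1) (auto intro!: zero_le_power power_le_one)
        finally show "(\<Prod>j<m. (1 - B j x) ^ m) \<le> (1 - B j x) ^ m" by simp
      qed
      ultimately show ?thesis
        using tendsto_sandwich[of "\<lambda>_. 0" _ sequentially "\<lambda>m. (1 - B j x) ^ m" 0] prod01(1) by auto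
    qed
    ultimately have "(\<lambda>m. \<theta> m x) \<longlonglongrightarrow> of_bool (0 < ?P x) * (1 - 0)"
      unfolding \<theta>_def by (intro tendsto_intros)
    moreover have "(of_bool (0 < ?P x) :: real) = indicator ?A x"
      using poly_bump_pos[OF I, of w b x] by (auto simp: indicator_def)
    ultimately show ?thesis by simp
  qed
  have ae: "AE x in lebesgue_on S. x \<in> (\<Union>j. box (l j) (r j))"
  proof -
    have "AE x in lebesgue. x \<notin> S - (\<Union>j. box (l j) (r j))"
      using lr(2) negligible_iff_null_sets AE_not_in by blast
    then have "AE x in lebesgue. x \<in> S \<longrightarrow> x \<in> (\<Union>j. box (l j) (r j))" by eventually_elim auto
    then show ?thesis using S by (simp add: AE_restrict_space_iff)
  qed
  have "(\<lambda>m. LINT x|lebesgue_on S. q x * \<theta> m x) \<longlonglongrightarrow> (LINT x|lebesgue_on S. q x * indicator ?A x)"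
  proof (rule integral_dominated_convergence[where w="\<lambda>x. norm (q x)"])
    show "(\<lambda>x. q x * indicator ?A x) \<in> borel_measurable (lebesgue_on S)"
      using A by (intro borel_measurable_times[OF borel_measurable_integrable[OF q] meas]
          borel_measurable_indicator) auto
    show "(\<lambda>x. q x * \<theta> m x) \<in> borel_measurable (lebesgue_on S)" for m
      by (intro borel_measurable_times[OF borel_measurable_integrable[OF q] meas]) auto
    show "integrable (lebesgue_on S) (\<lambda>x. norm (q x))" using q by simp
    show "AE x in lebesgue_on S. (\<lambda>m. q x * \<theta> m x) \<longlonglongrightarrow> q x * indicator ?A x"
      using ae by eventually_elim (intro tendsto_mult tendsto_const lim)
    show "AE x in lebesgue_on S. norm (q x * \<theta> m x) \<le> norm (q x)" for m
    proof (rule AE_I2)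
      show "norm (q x * \<theta> m x) \<le> norm (q x)" for x
        using \<theta>01[where m=m and x=x] mult_left_le[of "\<theta> m x" "\<bar>q x\<bar>"] by (simp add: abs_mult)
    qed
  qed
  then show ?thesis
    by (simp add: ann[OF test] LIMSEQ_const_iff)
qed

section \<open>Increments and integration by parts\<close>

definition dirder :: "(real ^ 'n \<Rightarrow> real) \<Rightarrow> real ^ 'n \<Rightarrow> real ^ 'n \<Rightarrow> real" where
  "dirder f v x = (\<Sum>i\<in>UNIV. v $ i * partial i f x)"

lemma dirder_axis: "dirder f (axis i 1) x = partial i f x"
proof -
  have "dirder f (axis i 1) x = (\<Sum>j\<in>UNIV. if j = i then partial i f x else 0)"
    unfolding dirder_def by (intro sum.cong) (auto simp: axis_def)
  then show ?thesis by simp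
qed

lemma continuous_dirder: "C_k (Suc 0) f \<Longrightarrow> continuous_on UNIV (dirder f v)"
  unfolding dirder_def by (intro continuous_intros) auto

lemma dirder_along_line:
  assumes "C_k (Suc 0) f"
  shows "((\<lambda>s. f (x + s *\<^sub>R v)) has_real_derivative dirder f v (x + s *\<^sub>R v)) (at s)"
proof -
  have f: "f differentiable (at (x + s *\<^sub>R v))" using assms by simp
  have "((\<lambda>s. x + s *\<^sub>R v) has_derivative (\<lambda>h. h *\<^sub>R v)) (at s)"
    by (auto intro!: derivative_eq_intros)
  from has_derivative_compose[OF this has_derivative_partial[OF f]]
  have "((\<lambda>s. f (x + s *\<^sub>R v)) has_derivative (\<lambda>h. dirder f v (x + s *\<^sub>R v) * h)) (at s)"
    by (simp add: dirder_def sum_distrib_left ac_simps)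
  then show ?thesis by (simp add: has_field_derivative_def)
qed

lemma compact_support_bounded:
  fixes g :: "'a::euclidean_space \<Rightarrow> real"
  assumes "compact S" "continuous_on UNIV g" "\<And>x. x \<notin> S \<Longrightarrow> g x = 0"
  obtains M where "0 < M" "\<And>x. \<bar>g x\<bar> \<le> M"
proof -
  have "bounded (g ` S)"
    using assms by (intro compact_imp_bounded compact_continuous_image) (auto intro: continuous_on_subset)
  then obtain M where M: "0 < M" "\<forall>y\<in>g ` S. norm y \<le> M" unfolding bounded_pos by blast
  have "\<bar>g x\<bar> \<le> M" for x using M assms(3)[of x] by (cases "x \<in> S") auto
  with M show ?thesis using that by blast
qed

text \<open>The fundamental theorem of calculus on each segment from \<open>x\<close> to
  \<open>x + h *\<^sub>R v\<close>, followed by an exchange of the integrals over \<open>x\<close>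
  and \<open>s\<close>.\<close>

lemma
  fixes f :: "real ^ 'n \<Rightarrow> real"
  assumes f: "C_k (Suc 0) f" and S: "compact S" "\<And>x. x \<notin> S \<Longrightarrow> dirder f v x = 0"
    and A [measurable]: "A \<in> sets borel" and h: "0 \<le> h"
  shows increment_integrable:
      "integrable lborel (\<lambda>s. indicator {0..h} s * (LINT x|lborel. indicator A x * dirder f v (x + s *\<^sub>R v)))"
        (is "integrable _ ?G")
    and increment_eq:
      "(LINT x|lborel. indicator A x * (f (x + h *\<^sub>R v) - f x)) =
       (LINT s|lborel. indicator {0..h} s * (LINT x|lborel. indicator A x * dirder f v (x + s *\<^sub>R v)))"
proof -
  let ?D = "dirder f v"
  obtain M where M: "0 < M" "\<And>x. \<bar>?D x\<bar> \<le> M"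
    using compact_support_bounded[OF S(1) continuous_dirder[OF f] S(2)] by blast
  have Dc: "continuous_on UNIV ?D" by (rule continuous_dirder[OF f])
  then have [measurable]: "?D \<in> borel_measurable borel" by (rule borel_measurable_continuous_onI)
  \<comment> \<open>All starting points of segments that meet the support; it is compact, so the
    integrand on the product space vanishes off a set of finite measure.\<close>
  define S' where "S' = (\<lambda>(y, s). y - s *\<^sub>R v) ` (S \<times> {0..h})"
  have S': "compact S'"
    unfolding S'_def case_prod_unfold
    by (intro compact_continuous_image compact_Times S(1) compact_Icc continuous_intros)
  then have [measurable]: "S' \<in> sets borel" by (rule borel_compact)
  let ?F = "\<lambda>x s. indicator A x * indicator {0..h} s * ?D (x + s *\<^sub>R v)"
  have F: "integrable (lborel \<Otimes>\<^sub>M lborel) (case_prod ?F)"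
  proof (rule integrableI_bounded_set[where A="S' \<times> {0..h}" and B=M])
    show "S' \<times> {0..h} \<in> sets (lborel \<Otimes>\<^sub>M lborel)" by measurable
    show "case_prod ?F \<in> borel_measurable (lborel \<Otimes>\<^sub>M lborel)" by measurable
    have "emeasure lborel S' < \<infinity>" using S' by (rule emeasure_compact_finite)
    then show "emeasure (lborel \<Otimes>\<^sub>M lborel) (S' \<times> {0..h}) < \<infinity>"
      using h by (subst lborel.emeasure_pair_measure_Times) (auto simp: ennreal_mult_less_top)
    show "AE z in lborel \<Otimes>\<^sub>M lborel. z \<in> S' \<times> {0..h} \<longrightarrow> norm (case_prod ?F z) \<le> M"
      using M by (intro AE_I2) (auto simp: indicator_def intro: less_imp_le)
    show "AE z in lborel \<Otimes>\<^sub>M lborel. z \<notin> S' \<times> {0..h} \<longrightarrow> case_prod ?F z = 0"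
    proof (intro AE_I2 impI)
      fix z :: "(real ^ 'n) \<times> real" assume z: "z \<notin> S' \<times> {0..h}"
      obtain x s where xs: "z = (x, s)" by (cases z)
      show "case_prod ?F z = 0"
      proof (cases "s \<in> {0..h}")
        case True
        have "x + s *\<^sub>R v \<notin> S"
        proof
          assume "x + s *\<^sub>R v \<in> S"
          then have "(\<lambda>(y, s). y - s *\<^sub>R v) (x + s *\<^sub>R v, s) \<in> S'"
            unfolding S'_def using True by (intro imageI) simp
          with z True xs show False by simp
        qed
        then show ?thesis using S(2) by (simp add: xs)
      qed (simp add: xs)
    qed
  qed
  have inner: "(LINT x|lborel. ?F x s) = indicator {0..h} s * (LINT x|lborel. indicator A x * ?D (x + s *\<^sub>R v))" for s
  proof -
    have "(\<lambda>x. ?F x s) = (\<lambda>x. indicator {0..h} s * (indicator A x * ?D (x + s *\<^sub>R v)))"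
      by (simp add: ac_simps)
    then show ?thesis by simp
  qed
  show "integrable lborel ?G"
    using lborel_pair.integrable_snd[OF F] unfolding inner .
  have ftc: "(LINT s|lborel. ?F x s) = indicator A x * (f (x + h *\<^sub>R v) - f x)" for x
  proof -
    have "(LINT s|lborel. ?D (x + s *\<^sub>R v) * indicator {0..h} s) = f (x + h *\<^sub>R v) - f (x + 0 *\<^sub>R v)"
    proof (rule integral_FTC_Icc_real[OF h])
      show "isCont (\<lambda>s. ?D (x + s *\<^sub>R v)) s" for s
        using continuous_on_compose2[OF Dc, of UNIV "\<lambda>s. x + s *\<^sub>R v"]
        by (simp add: continuous_on_eq_continuous_at continuous_intros)
    qed (rule dirder_along_line[OF f])
    moreover have "(\<lambda>s. ?F x s) = (\<lambda>s. indicator A x * (?D (x + s *\<^sub>R v) * indicator {0..h} s))"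
      by (simp add: ac_simps)
    ultimately show ?thesis by simp
  qed
  show "(LINT x|lborel. indicator A x * (f (x + h *\<^sub>R v) - f x)) = integral\<^sup>L lborel ?G"
    using lborel_pair.Fubini_integral[OF F] unfolding inner ftc by simp
qed

lemma test_functionsD:
  assumes "f \<in> test_functions S"
  shows "C_k k f" "compact (closure {x. f x \<noteq> 0})" "closure {x. f x \<noteq> 0} \<subseteq> S"
    and "x \<notin> closure {x. f x \<noteq> 0} \<Longrightarrow> f x = 0"
    and "x \<notin> closure {x. f x \<noteq> 0} \<Longrightarrow> partial i f x = 0"
    and "x \<notin> closure {x. f x \<noteq> 0} \<Longrightarrow> dirder f v x = 0"
    and "continuous_on UNIV f" "continuous_on UNIV (partial i f)" "f differentiable (at x)"
proof -
  let ?S = "closure {x. f x \<noteq> 0}"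
  show Ck: "C_k k f" for k using assms by (simp add: test_functions_def)
  show "compact ?S" "?S \<subseteq> S" using assms by (simp_all add: test_functions_def)
  show "continuous_on UNIV f" using Ck[of 0] by simp
  show "continuous_on UNIV (partial i f)" "f differentiable (at x)" using Ck[of "Suc 0"] by simp_all
  have z: "f x = 0" if "x \<notin> ?S" for x using that closure_subset[of "{x. f x \<noteq> 0}"] by blast
  then show "x \<notin> ?S \<Longrightarrow> f x = 0" .
  have p: "partial i f x = 0" if "x \<notin> ?S" for x i
  proof -
    have "(f has_derivative (\<lambda>h. 0)) (at x)"
    proof (rule has_derivative_transform_within_open[OF has_derivative_const[of 0]])
      show "open (- ?S)" by (intro open_Compl closed_closure)
      show "x \<in> - ?S" using that by simp
      show "0 = f y" if "y \<in> - ?S" for y using z[of y] that by simp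
    qed
    then show ?thesis by (simp add: partial_eq)
  qed
  then show "x \<notin> ?S \<Longrightarrow> partial i f x = 0" .
  show "x \<notin> ?S \<Longrightarrow> dirder f v x = 0" using p by (simp add: dirder_def)
qed

lemma test_function_support:
  assumes "f \<in> test_functions S"
  obtains C where "compact C" "C \<subseteq> S" "\<And>x. x \<notin> C \<Longrightarrow> f x = 0" "\<And>x i. x \<notin> C \<Longrightarrow> partial i f x = 0"
    "\<And>x v. x \<notin> C \<Longrightarrow> dirder f v x = 0"
  by (rule that[OF test_functionsD(2-6)[OF assms]])

lemma integrable_compact_support:
  fixes g :: "'a::euclidean_space \<Rightarrow> real"
  assumes "compact S" "continuous_on UNIV g" "\<And>x. x \<notin> S \<Longrightarrow> g x = 0"
  shows "integrable lborel g"
proof -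
  have "integrable lborel (\<lambda>x. indicator S x *\<^sub>R g x)"
    using assms by (intro borel_integrable_compact) (auto intro: continuous_on_subset)
  also have "(\<lambda>x. indicator S x *\<^sub>R g x) = g"
    using assms(3) by (auto simp: indicator_def fun_eq_iff)
  finally show ?thesis .
qed

text \<open>With the whole space for \<open>A\<close> and \<open>h = 1\<close>, the increment
  formula equates this integral with that of \<open>f (x + axis i 1) - f x\<close>, which vanishes
  by translation invariance.\<close>

lemma integral_partial_test:
  assumes f: "f \<in> test_functions S"
  shows "(LINT x|lborel. partial i f x) = 0"
proof -
  note T = test_functionsD[OF f]
  let ?v = "axis i (1::real)"
  have "(LINT x|lborel. indicator UNIV x * (f (x + 1 *\<^sub>R ?v) - f x)) =
    (LINT s|lborel. indicator {0..1} s * (LINT x|lborel. indicator UNIV x * dirder f ?v (x + s *\<^sub>R ?v)))"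
    by (rule increment_eq[OF T(1) T(2) T(6)]) auto
  also have "(\<lambda>s. LINT x|lborel. indicator UNIV x * dirder f ?v (x + s *\<^sub>R ?v)) = (\<lambda>s. LINT x|lborel. partial i f x)"
  proof
    fix s :: real
    have "(LINT x|lborel. partial i f x) = (LINT x|distr lborel borel ((+) (s *\<^sub>R ?v)). partial i f x)"
      by (simp only: lborel_distr_plus)
    also have "\<dots> = (LINT x|lborel. partial i f (s *\<^sub>R ?v + x))"
      using T(8)[of i] by (intro integral_distr) (auto intro: borel_measurable_continuous_onI)
    finally show "(LINT x|lborel. indicator UNIV x * dirder f ?v (x + s *\<^sub>R ?v)) = (LINT x|lborel. partial i f x)"
      by (simp add: dirder_axis add.commute)
  qed
  also have "(LINT s|lborel. indicator {0..1::real} s * (LINT x|lborel. partial i f x)) = (LINT x|lborel. partial i f x)"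
    by simp
  finally have "(LINT x|lborel. partial i f x) = (LINT x|lborel. f (x + ?v) - f x)" by simp
  also have "\<dots> = (LINT x|lborel. f (x + ?v)) - (LINT x|lborel. f x)"
  proof (rule Bochner_Integration.integral_diff)
    show fi: "integrable lborel f" by (rule integrable_compact_support[OF T(2) T(7) T(4)])
    then have "integrable (distr lborel borel ((+) ?v)) f" by (simp add: lborel_distr_plus)
    then show "integrable lborel (\<lambda>x. f (x + ?v))"
      using T(7) by (subst (asm) integrable_distr_eq)
        (auto intro: borel_measurable_continuous_onI simp: add.commute)
  qed
  also have "(LINT x|lborel. f x) = (LINT x|distr lborel borel ((+) ?v). f x)"
    by (simp only: lborel_distr_plus)
  also have "\<dots> = (LINT x|lborel. f (?v + x))"
    using T(7) by (intro integral_distr) (auto intro: borel_measurable_continuous_onI)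
  finally show ?thesis by (simp add: add.commute)
qed

lemma test_functions_mult:
  assumes f: "f \<in> test_functions S" and g: "g \<in> test_functions S"
  shows "(\<lambda>x. f x * g x) \<in> test_functions S"
proof -
  have sub: "closure {x. f x * g x \<noteq> 0} \<subseteq> closure {x. f x \<noteq> 0}"
    by (intro closure_mono) auto
  then have "compact (closure {x. f x * g x \<noteq> 0})"
    using compact_Int_closed[OF test_functionsD(2)[OF f] closed_closure, of "{x. f x * g x \<noteq> 0}"]
    by (simp add: Int_absorb1)
  then show ?thesis
    using sub test_functionsD(3)[OF f] test_functionsD(1)[OF f] test_functionsD(1)[OF g]
    by (auto simp: test_functions_def intro: C_k_mult)
qed

lemma lebesgue_on_borel:
  "f \<in> borel_measurable borel \<Longrightarrow> f \<in> borel_measurable (lebesgue_on S)"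
  by (simp add: measurable_restrict_space1 measurable_completion)

text \<open>The forms of the scheme are integrals over \<open>lebesgue_on\<close>, while Fubini's
  theorem and substitution are applied on \<open>lborel\<close>. For Borel integrands the completion
  makes no difference.\<close>

lemma lebesgue_on_lborel:
  fixes f :: "'a::euclidean_space \<Rightarrow> real"
  assumes S: "S \<in> sets borel" and f: "(\<lambda>x. indicator S x * f x) \<in> borel_measurable borel"
  shows "(LINT x|lebesgue_on S. f x) = (LINT x|lborel. indicator S x * f x)"
    and "integrable (lebesgue_on S) f \<longleftrightarrow> integrable lborel (\<lambda>x. indicator S x * f x)"
proof -
  have "(LINT x|lebesgue_on S. f x) = (LINT x|lebesgue. indicator S x * f x)"
    using S by (subst integral_restrict_space) auto
  then show "(LINT x|lebesgue_on S. f x) = (LINT x|lborel. indicator S x * f x)"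
    using f by (simp add: integral_completion)
  have "integrable (lebesgue_on S) f \<longleftrightarrow> integrable lebesgue (\<lambda>x. indicator S x * f x)"
    using S by (subst integrable_restrict_space) auto
  then show "integrable (lebesgue_on S) f \<longleftrightarrow> integrable lborel (\<lambda>x. indicator S x * f x)"
    using f by (simp add: integrable_completion)
qed

lemma lebesgue_on_compact_support:
  fixes g :: "'a::euclidean_space \<Rightarrow> real"
  assumes "open S" "compact C" "C \<subseteq> S" "continuous_on UNIV g" "\<And>x. x \<notin> C \<Longrightarrow> g x = 0"
  shows "(LINT x|lebesgue_on S. g x) = (LINT x|lborel. g x)" "integrable (lebesgue_on S) g"
proof -
  have eq: "(\<lambda>x. indicator S x * g x) = g" using assms(3,5) by (auto simp: indicator_def fun_eq_iff)
  have "g \<in> borel_measurable borel" using assms(4) by (rule borel_measurable_continuous_onI)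
  with eq assms(1) integrable_compact_support[OF assms(2,4,5)]
  show "(LINT x|lebesgue_on S. g x) = (LINT x|lborel. g x)" "integrable (lebesgue_on S) g"
    by (auto simp: lebesgue_on_lborel)
qed

lemma integration_by_parts_test:
  assumes S: "open S" and f: "f \<in> test_functions S" and g: "g \<in> test_functions S"
  shows "(LINT x|lebesgue_on S. f x * partial i g x) = - (LINT x|lebesgue_on S. partial i f x * g x)"
proof -
  note F = test_functionsD[OF f] and G = test_functionsD[OF g]
  obtain C where C: "compact C" "C \<subseteq> S" "\<And>x. x \<notin> C \<Longrightarrow> f x = 0" "\<And>x i. x \<notin> C \<Longrightarrow> partial i f x = 0"
    using test_function_support[OF f] by metis
  note L = lebesgue_on_compact_support[OF S C(1,2)]
  have 1: "integrable (lebesgue_on S) (\<lambda>x. f x * partial i g x)"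
    and 2: "integrable (lebesgue_on S) (\<lambda>x. partial i f x * g x)"
    by (intro L(2) continuous_intros F(7,8) G(7,8); simp add: C(3,4))+
  have "(LINT x|lebesgue_on S. f x * partial i g x + partial i f x * g x)
      = (LINT x|lborel. f x * partial i g x + partial i f x * g x)"
    by (intro L(1) continuous_intros F(7,8) G(7,8)) (simp add: C(3,4))
  also have "\<dots> = (LINT x|lborel. partial i (\<lambda>x. f x * g x) x)"
    by (simp add: partial_mult[OF F(9) G(9)])
  also have "\<dots> = 0"
    by (rule integral_partial_test[OF test_functions_mult[OF f g]])
  finally show ?thesis
    unfolding Bochner_Integration.integral_add[OF 1 2] by simp
qed

section \<open>Weak gradients\<close>

lemma integrable_times_bounded:
  fixes f k :: "'a \<Rightarrow> real"
  assumes f: "integrable M f" and k: "k \<in> borel_measurable M" "\<And>x. \<bar>k x\<bar> \<le> B"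
  shows "integrable M (\<lambda>x. f x * k x)"
proof (rule Bochner_Integration.integrable_bound[where f="\<lambda>x. B * f x"])
  show "integrable M (\<lambda>x. B * f x)" using f by simp
  show "(\<lambda>x. f x * k x) \<in> borel_measurable M" using f k(1) by simp
  show "AE x in M. norm (f x * k x) \<le> norm (B * f x)"
  proof (rule AE_I2)
    fix x
    have "\<bar>k x\<bar> \<le> \<bar>B\<bar>" using k(2)[of x] by linarith
    then have "\<bar>f x\<bar> * \<bar>k x\<bar> \<le> \<bar>f x\<bar> * \<bar>B\<bar>" by (rule mult_left_mono) simp
    then show "norm (f x * k x) \<le> norm (B * f x)" by (simp add: abs_mult mult.commute)
  qed
qed

section \<open>Integral bounds and weak gradients on a bounded open set\<close>

context
  fixes S :: "(real ^ 'n) set"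
  assumes S: "open S" "bounded S"
begin

lemma finite_measure_lebesgue_on: "finite_measure (lebesgue_on S)"
proof
  have "S \<in> lmeasurable" using S by (simp add: lmeasurable_open)
  then have "emeasure lebesgue S \<noteq> \<infinity>" using fmeasurableD2 by fastforce
  then show "emeasure (lebesgue_on S) (space (lebesgue_on S)) \<noteq> \<infinity>"
    using S by (simp add: emeasure_restrict_space)
qed

interpretation finite_measure "lebesgue_on S" by (rule finite_measure_lebesgue_on)

lemma integrable_L2:
  assumes "f \<in> L2 S"
  shows "integrable (lebesgue_on S) f"
proof (rule Bochner_Integration.integrable_bound[where f="\<lambda>x. 1 + (norm (f x))\<^sup>2"])
  show "integrable (lebesgue_on S) (\<lambda>x. 1 + (norm (f x))\<^sup>2)"
    using assms by (auto simp: L2_def)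
  show "f \<in> borel_measurable (lebesgue_on S)" using assms by (simp add: L2_def)
  show "AE x in lebesgue_on S. norm (f x) \<le> norm (1 + (norm (f x))\<^sup>2)"
  proof (rule AE_I2)
    fix x
    have "0 \<le> (norm (f x) - 1)\<^sup>2" by simp
    then have "2 * norm (f x) \<le> 1 + (norm (f x))\<^sup>2" by (simp add: power2_eq_square algebra_simps)
    then show "norm (f x) \<le> norm (1 + (norm (f x))\<^sup>2)"
      using norm_ge_zero[of "f x"] by (simp only: real_norm_def)
  qed
qed

text \<open>Integrates the pointwise inequality
  \<open>t \<le> \<eta> / 2 + t\<^sup>2 / (2 * \<eta>)\<close> in place of Cauchy-Schwarz; only
  proportionality to \<eta> matters afterwards.\<close>

lemma L1_bound_L2:
  assumes f: "f \<in> L2 S" and n: "L2_norm S f < \<eta>"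
  shows "(LINT x|lebesgue_on S. norm (f x)) \<le> \<eta> * (1 + measure lebesgue S)"
proof -
  have int: "integrable (lebesgue_on S) (\<lambda>x. (norm (f x))\<^sup>2)" using f by (simp add: L2_def)
  have "0 \<le> L2_norm S f"
    by (auto simp: L2_norm_def L2_prod_def intro!: Bochner_Integration.integral_nonneg)
  then have \<eta>: "0 < \<eta>" using n by linarith
  have sq: "(LINT x|lebesgue_on S. (norm (f x))\<^sup>2) \<le> \<eta>\<^sup>2"
  proof -
    have "(L2_norm S f)\<^sup>2 = (LINT x|lebesgue_on S. (norm (f x))\<^sup>2)"
      unfolding L2_norm_def L2_prod_def
      by (subst real_sqrt_pow2) (auto intro!: Bochner_Integration.integral_nonneg simp: power2_norm_eq_inner)
    moreover have "(L2_norm S f)\<^sup>2 \<le> \<eta>\<^sup>2" using \<open>0 \<le> L2_norm S f\<close> n by (intro power_mono) auto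
    ultimately show ?thesis by simp
  qed
  have "(LINT x|lebesgue_on S. norm (f x)) \<le> (LINT x|lebesgue_on S. \<eta> / 2 + (norm (f x))\<^sup>2 / (2 * \<eta>))"
  proof (rule integral_mono)
    show "integrable (lebesgue_on S) (\<lambda>x. norm (f x))" using integrable_L2[OF f] by simp
    show "integrable (lebesgue_on S) (\<lambda>x. \<eta> / 2 + (norm (f x))\<^sup>2 / (2 * \<eta>))" using int by simp
    fix x
    have "0 \<le> (norm (f x) - \<eta>)\<^sup>2" by simp
    then show "norm (f x) \<le> \<eta> / 2 + (norm (f x))\<^sup>2 / (2 * \<eta>)"
      using \<eta> by (simp add: field_simps power2_eq_square)
  qed
  also have "\<dots> = \<eta> / 2 * measure lebesgue S + (LINT x|lebesgue_on S. (norm (f x))\<^sup>2) / (2 * \<eta>)"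
    using int S by (simp add: measure_restrict_space)
  also have "\<dots> \<le> \<eta> / 2 * measure lebesgue S + \<eta>\<^sup>2 / (2 * \<eta>)"
    using sq \<eta> by (intro add_left_mono divide_right_mono) auto
  also have "\<dots> = \<eta> / 2 * (1 + measure lebesgue S)"
    using \<eta> by (simp add: power2_eq_square field_simps)
  also have "\<dots> \<le> \<eta> * (1 + measure lebesgue S)"
    using \<eta> by (intro mult_right_mono) (auto simp: add_nonneg_nonneg)
  finally show ?thesis .
qed

lemma L2_diff:
  assumes f: "f \<in> L2 S" and g: "g \<in> L2 S"
  shows "(\<lambda>x. f x - g x) \<in> L2 S"
proof -
  have m: "(\<lambda>x. f x - g x) \<in> borel_measurable (lebesgue_on S)"
    using f g by (intro borel_measurable_diff) (auto simp: L2_def)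
  have "integrable (lebesgue_on S) (\<lambda>x. (norm (f x - g x))\<^sup>2)"
  proof (rule Bochner_Integration.integrable_bound[where f="\<lambda>x. 2 * (norm (f x))\<^sup>2 + 2 * (norm (g x))\<^sup>2"])
    show "integrable (lebesgue_on S) (\<lambda>x. 2 * (norm (f x))\<^sup>2 + 2 * (norm (g x))\<^sup>2)"
      using f g by (simp add: L2_def)
    show "(\<lambda>x. (norm (f x - g x))\<^sup>2) \<in> borel_measurable (lebesgue_on S)" using m by simp
    show "AE x in lebesgue_on S. norm ((norm (f x - g x))\<^sup>2) \<le> norm (2 * (norm (f x))\<^sup>2 + 2 * (norm (g x))\<^sup>2)"
    proof (rule AE_I2)
      fix x
      have "(norm (f x - g x))\<^sup>2 \<le> (norm (f x) + norm (g x))\<^sup>2"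
        by (intro power_mono norm_triangle_ineq4) simp
      moreover have "0 \<le> (norm (f x) - norm (g x))\<^sup>2" by simp
      ultimately show "norm ((norm (f x - g x))\<^sup>2) \<le> norm (2 * (norm (f x))\<^sup>2 + 2 * (norm (g x))\<^sup>2)"
        by (simp add: power2_eq_square algebra_simps)
    qed
  qed
  with m show ?thesis by (simp add: L2_def)
qed

lemma L2_continuous_bounded:
  assumes "continuous_on UNIV f" "\<And>x. norm (f x) \<le> B"
  shows "f \<in> L2 S"
proof -
  have m: "f \<in> borel_measurable (lebesgue_on S)"
    using assms(1) by (intro lebesgue_on_borel borel_measurable_continuous_onI)
  moreover have "integrable (lebesgue_on S) (\<lambda>x. (norm (f x))\<^sup>2)"
    by (rule integrable_const_bound[of "\<lambda>x. (norm (f x))\<^sup>2" "B\<^sup>2"])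
      (use m assms(2) in \<open>auto intro!: AE_I2 power_mono\<close>)
  ultimately show ?thesis by (simp add: L2_def)
qed

lemma test_bounded:
  assumes "\<psi> \<in> test_functions S"
  obtains M where "\<And>x. \<bar>\<psi> x\<bar> \<le> M" "\<And>i x. \<bar>partial i \<psi> x\<bar> \<le> M" "\<And>x. \<bar>dirder \<psi> v x\<bar> \<le> M"
proof -
  obtain C where C: "compact C" "C \<subseteq> S" "\<And>x. x \<notin> C \<Longrightarrow> \<psi> x = 0" "\<And>x i. x \<notin> C \<Longrightarrow> partial i \<psi> x = 0"
    "\<And>x v. x \<notin> C \<Longrightarrow> dirder \<psi> v x = 0"
    using test_function_support[OF assms] by metis
  note T = test_functionsD[OF assms]
  obtain M1 where M1: "0 < M1" "\<And>x. \<bar>\<psi> x\<bar> \<le> M1"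
    using compact_support_bounded[OF C(1) T(7) C(3)] by blast
  have "\<exists>M. 0 < M \<and> (\<forall>x. \<bar>partial i \<psi> x\<bar> \<le> M)" for i
    using compact_support_bounded[OF C(1) T(8) C(4)] by metis
  then obtain M2 where M2: "\<And>i. 0 < M2 i" "\<And>i x. \<bar>partial i \<psi> x\<bar> \<le> M2 i" by metis
  obtain M3 where M3: "0 < M3" "\<And>x. \<bar>dirder \<psi> v x\<bar> \<le> M3"
    using compact_support_bounded[OF C(1) continuous_dirder[OF T(1)] C(5)] by blast
  have le: "M2 i \<le> sum M2 UNIV" for i
    using M2(1) by (intro member_le_sum) (auto intro: less_imp_le)
  have pos: "0 \<le> sum M2 UNIV" using M2(1) by (intro sum_nonneg) (auto intro: less_imp_le)
  show ?thesis
  proof (rule that)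
    show "\<bar>\<psi> x\<bar> \<le> M1 + sum M2 UNIV + M3" for x using M1(2)[of x] M3(1) pos by linarith
    show "\<bar>partial i \<psi> x\<bar> \<le> M1 + sum M2 UNIV + M3" for i x
      using M2(2)[of i x] le[of i] M3(1) M1(1) by linarith
    show "\<bar>dirder \<psi> v x\<bar> \<le> M1 + sum M2 UNIV + M3" for x using M3(2)[of x] M1(1) pos by linarith
  qed
qed

text \<open>Besides the formula, this shows that \<open>f - \<psi>\<close> has a weak gradient at
  all, without which the choice in \<open>grad\<close>, and with it the norm of
  \<open>f - \<psi>\<close> in \<open>H1_norm\<close>, would carry no information.\<close>

lemma weak_gradient_diff_test:
  assumes f: "f \<in> L2 S" and g: "is_weak_gradient S f g" and \<psi>: "\<psi> \<in> test_functions S"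
  shows "is_weak_gradient S (\<lambda>x. f x - \<psi> x) (\<lambda>x. g x - (\<Sum>i\<in>UNIV. partial i \<psi> x *\<^sub>R axis i 1))"
  unfolding is_weak_gradient_def
proof (intro conjI ballI allI)
  let ?D = "\<lambda>x. \<Sum>i\<in>UNIV. partial i \<psi> x *\<^sub>R (axis i 1 :: real ^ 'n)"
  obtain M where M: "\<And>x. \<bar>\<psi> x\<bar> \<le> M" "\<And>i x. \<bar>partial i \<psi> x\<bar> \<le> M" "\<And>x. \<bar>dirder \<psi> 0 x\<bar> \<le> M"
    using test_bounded[OF \<psi>] by metis
  note T = test_functionsD[OF \<psi>]
  have "norm (?D x) \<le> (\<Sum>i\<in>(UNIV :: 'n set). M)" for x
    by (rule sum_norm_le) (simp add: M(2))
  then have "?D \<in> L2 S"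
    by (rule L2_continuous_bounded[rotated]) (intro continuous_intros T(8))
  then show "(\<lambda>x. g x - ?D x) \<in> L2 S"
    using g by (intro L2_diff) (simp_all add: is_weak_gradient_def)
  fix \<theta> i assume \<theta>: "\<theta> \<in> test_functions S"
  obtain N where N: "\<And>x. \<bar>\<theta> x\<bar> \<le> N" "\<And>i x. \<bar>partial i \<theta> x\<bar> \<le> N" "\<And>x. \<bar>dirder \<theta> 0 x\<bar> \<le> N"
    using test_bounded[OF \<theta>] by metis
  note U = test_functionsD[OF \<theta>]
  have m: "\<theta> \<in> borel_measurable (lebesgue_on S)" "partial i \<theta> \<in> borel_measurable (lebesgue_on S)"
    using U(7,8) by (auto intro: lebesgue_on_borel borel_measurable_continuous_onI)
  have ci: "?D x $ i = partial i \<psi> x" for x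
  proof -
    have "?D x $ i = (\<Sum>j\<in>UNIV. if j = i then partial i \<psi> x else 0)"
      unfolding sum_component by (intro sum.cong) (auto simp: axis_def)
    then show ?thesis by simp
  qed
  have gi: "integrable (lebesgue_on S) (\<lambda>x. g x $ i)"
  proof -
    have "integrable (lebesgue_on S) g" using g by (intro integrable_L2) (simp add: is_weak_gradient_def)
    then have "integrable (lebesgue_on S) (\<lambda>x. g x \<bullet> axis i 1)" by simp
    then show ?thesis by (simp add: inner_axis)
  qed
  have \<psi>i: "integrable (lebesgue_on S) \<psi>" "integrable (lebesgue_on S) (partial i \<psi>)"
    using T(7,8) M by (auto intro!: integrable_L2 L2_continuous_bounded[where B=M])
  have "(LINT x|lebesgue_on S. (f x - \<psi> x) * partial i \<theta> x)
      = (LINT x|lebesgue_on S. f x * partial i \<theta> x) - (LINT x|lebesgue_on S. \<psi> x * partial i \<theta> x)"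
    unfolding left_diff_distrib
    by (intro Bochner_Integration.integral_diff integrable_times_bounded[where B=N] integrable_L2 f \<psi>i m N)
  also have "(LINT x|lebesgue_on S. f x * partial i \<theta> x) = - (LINT x|lebesgue_on S. g x $ i * \<theta> x)"
    using g \<theta> by (simp add: is_weak_gradient_def)
  also have "(LINT x|lebesgue_on S. \<psi> x * partial i \<theta> x) = - (LINT x|lebesgue_on S. partial i \<psi> x * \<theta> x)"
    by (rule integration_by_parts_test[OF S(1) \<psi> \<theta>])
  also have "- (LINT x|lebesgue_on S. g x $ i * \<theta> x) - - (LINT x|lebesgue_on S. partial i \<psi> x * \<theta> x)
      = - (LINT x|lebesgue_on S. g x $ i * \<theta> x - partial i \<psi> x * \<theta> x)"
    by (subst Bochner_Integration.integral_diff)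
      (auto intro!: integrable_times_bounded[where B=N] gi \<psi>i m N)
  finally show "(LINT x|lebesgue_on S. (f x - \<psi> x) * partial i \<theta> x) = - (LINT x|lebesgue_on S. (g x - ?D x) $ i * \<theta> x)"
    unfolding vector_minus_component ci left_diff_distrib .
qed

text \<open>Translation invariance trades the shift of the function for a shift of the set. As
  \<open>k\<close> is supported in \<open>S\<close>, the right side can be an integral over
  \<open>S\<close> even when the shifted set leaves \<open>S\<close>.\<close>

lemma translate_indicator_integral:
  fixes k :: "real ^ 'n \<Rightarrow> real"
  assumes k: "continuous_on UNIV k" "compact C" "C \<subseteq> S" "\<And>x. x \<notin> C \<Longrightarrow> k x = 0"
    and A [measurable]: "A \<in> sets borel"
  shows "(LINT x|lborel. indicator A x * k (x + u)) = (LINT x|lebesgue_on S. k x * indicator A (x - u))"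
proof -
  have [measurable]: "k \<in> borel_measurable borel" using k(1) by (rule borel_measurable_continuous_onI)
  have eq: "(\<lambda>x. indicator S x * (k x * indicator A (x - u))) = (\<lambda>x. k x * indicator A (x - u))"
    using k(3,4) by (auto simp: indicator_def fun_eq_iff)
  have "(LINT x|lebesgue_on S. k x * indicator A (x - u)) = (LINT x|lborel. k x * indicator A (x - u))"
    using S(1) by (subst lebesgue_on_lborel) (auto simp: eq)
  also have "\<dots> = (LINT x|distr lborel borel ((+) u). k x * indicator A (x - u))"
    by (simp only: lborel_distr_plus)
  also have "\<dots> = (LINT x|lborel. k (u + x) * indicator A (u + x - u))"
    by (rule integral_distr) measurable
  finally show ?thesis by (simp add: ac_simps)
qed

lemma H1_0_approx:
  assumes f: "f \<in> H1_0 S" and \<eta>: "0 < \<eta>"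
  obtains \<psi> w where "\<psi> \<in> test_functions S" "is_weak_gradient S (\<lambda>x. f x - \<psi> x) w"
    "L2_norm S (\<lambda>x. f x - \<psi> x) < \<eta>" "L2_norm S w < \<eta>" "(\<lambda>x. f x - \<psi> x) \<in> L2 S" "w \<in> L2 S"
proof -
  have fH: "f \<in> L2 S" and "\<exists>g. is_weak_gradient S f g"
    using f by (auto simp: H1_0_def H1_def)
  then obtain g where g: "is_weak_gradient S f g" by blast
  obtain \<psi> where \<psi>: "\<psi> \<in> test_functions S" "H1_norm S (\<lambda>x. f x - \<psi> x) < \<eta>"
    using f \<eta> by (auto simp: H1_0_def)
  let ?w = "grad S (\<lambda>x. f x - \<psi> x)"
  have w: "is_weak_gradient S (\<lambda>x. f x - \<psi> x) ?w"
    using someI[of "is_weak_gradient S (\<lambda>x. f x - \<psi> x)", OF weak_gradient_diff_test[OF fH g \<psi>(1)]]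
    by (simp add: grad_def)
  have le: "L2_norm S (\<lambda>x. f x - \<psi> x) \<le> H1_norm S (\<lambda>x. f x - \<psi> x)" "L2_norm S ?w \<le> H1_norm S (\<lambda>x. f x - \<psi> x)"
    unfolding H1_norm_def by (rule real_le_rsqrt; simp)+
  obtain M where M: "\<And>x. \<bar>\<psi> x\<bar> \<le> M"
    using test_bounded[OF \<psi>(1)] by metis
  have "\<psi> \<in> L2 S"
    using M test_functionsD(7)[OF \<psi>(1)] by (intro L2_continuous_bounded[where B=M]) auto
  then have "(\<lambda>x. f x - \<psi> x) \<in> L2 S" by (intro L2_diff fH)
  with \<psi> w le show ?thesis using that[of \<psi> ?w] by (auto simp: is_weak_gradient_def)
qed

text \<open>The difference of two weak gradients is orthogonal to all test functions. Equality in
  this integrated form is enough to cope with the choice made by \<open>grad\<close>, since open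
  cells and their translates are such polyhedra.\<close>

lemma weak_gradient_unique_polyhedron:
  assumes g: "is_weak_gradient S f g" and w: "is_weak_gradient S f w"
    and I: "finite I" and A: "A = {x. \<forall>i\<in>I. 0 < p i \<bullet> x + b i}"
  shows "(LINT x|lebesgue_on S. (g x \<bullet> v) * indicator A x) = (LINT x|lebesgue_on S. (w x \<bullet> v) * indicator A x)"
proof -
  have gv: "integrable (lebesgue_on S) (\<lambda>x. g x \<bullet> y)" and wv: "integrable (lebesgue_on S) (\<lambda>x. w x \<bullet> y)" for y
    using integrable_L2[of g] integrable_L2[of w] g w by (simp_all add: is_weak_gradient_def)
  let ?q = "\<lambda>x. g x \<bullet> v - w x \<bullet> v"
  have "(LINT x|lebesgue_on S. ?q x * indicator A x) = 0"
    unfolding A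
  proof (rule annihilator_polyhedron[OF S(1) _ _ I])
    show "integrable (lebesgue_on S) ?q" using gv wv by simp
    fix \<theta> assume \<theta>: "\<theta> \<in> test_functions S"
    obtain N where N: "\<And>x. \<bar>\<theta> x\<bar> \<le> N"
      using test_bounded[OF \<theta>] by metis
    have m: "\<theta> \<in> borel_measurable (lebesgue_on S)"
      using test_functionsD(7)[OF \<theta>] by (intro lebesgue_on_borel borel_measurable_continuous_onI)
    have int: "integrable (lebesgue_on S) (\<lambda>x. g x $ i * \<theta> x)" "integrable (lebesgue_on S) (\<lambda>x. w x $ i * \<theta> x)" for i
      using integrable_times_bounded[OF gv[of "axis i 1"] m N] integrable_times_bounded[OF wv[of "axis i 1"] m N]
      by (simp_all add: inner_axis)
    have eq: "(LINT x|lebesgue_on S. g x $ i * \<theta> x) = (LINT x|lebesgue_on S. w x $ i * \<theta> x)" for i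
    proof -
      have "(LINT x|lebesgue_on S. f x * partial i \<theta> x) = - (LINT x|lebesgue_on S. g x $ i * \<theta> x)"
        "(LINT x|lebesgue_on S. f x * partial i \<theta> x) = - (LINT x|lebesgue_on S. w x $ i * \<theta> x)"
        using g w \<theta> by (simp_all add: is_weak_gradient_def)
      then show ?thesis by linarith
    qed
    have "(\<lambda>x. ?q x * \<theta> x) = (\<lambda>x. \<Sum>i\<in>UNIV. v $ i * (g x $ i * \<theta> x - w x $ i * \<theta> x))"
    proof
      fix x
      have "?q x = (\<Sum>i\<in>UNIV. v $ i * (g x $ i - w x $ i))"
        by (simp add: inner_vec_def sum_subtractf[symmetric] algebra_simps)
      then show "?q x * \<theta> x = (\<Sum>i\<in>UNIV. v $ i * (g x $ i * \<theta> x - w x $ i * \<theta> x))"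
        by (simp add: sum_distrib_right mult.assoc left_diff_distrib)
    qed
    then show "(LINT x|lebesgue_on S. ?q x * \<theta> x) = 0"
      using int eq by simp
  qed
  moreover have Am: "indicator A \<in> borel_measurable (lebesgue_on S)"
  proof -
    have "A = (\<Inter>i\<in>I. {x. 0 < p i \<bullet> x + b i})" unfolding A by auto
    moreover have "open \<dots>" by (intro open_INT I ballI open_Collect_less continuous_intros)
    ultimately have "A \<in> sets borel" by simp
    then show ?thesis by (intro lebesgue_on_borel borel_measurable_indicator)
  qed
  ultimately show ?thesis
    using integrable_times_bounded[OF gv[of v] Am, of 1] integrable_times_bounded[OF wv[of v] Am, of 1]
    by (simp add: left_diff_distrib)
qed

text \<open>Both \<open>w\<close> and \<open>g\<close> minus the classical gradient of \<psi> are
  weak gradients of \<open>f - \<psi>\<close>, so their integrals over a polyhedron agree.\<close>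

lemma weak_gradient_polyhedron:
  assumes \<psi>: "\<psi> \<in> test_functions S" and f: "f \<in> L2 S"
    and g: "is_weak_gradient S f g" and w: "is_weak_gradient S (\<lambda>x. f x - \<psi> x) w"
    and I: "finite I" and A: "A = {x. \<forall>i\<in>I. 0 < p i \<bullet> x + b i}"
  shows "(LINT x|lebesgue_on S. dirder \<psi> v x * indicator A x)
       = (LINT x|lebesgue_on S. (g x \<bullet> v) * indicator A x) - (LINT x|lebesgue_on S. (w x \<bullet> v) * indicator A x)"
proof -
  let ?D = "\<lambda>x. \<Sum>i\<in>UNIV. partial i \<psi> x *\<^sub>R (axis i 1 :: real ^ 'n)"
  have D: "?D x \<bullet> v = dirder \<psi> v x" for x
    by (simp add: inner_sum_left inner_axis' dirder_def mult.commute)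
  have gD: "is_weak_gradient S (\<lambda>x. f x - \<psi> x) (\<lambda>x. g x - ?D x)" by (rule weak_gradient_diff_test[OF f g \<psi>])
  have A': "A \<in> sets borel"
  proof -
    have "A = (\<Inter>i\<in>I. {x. 0 < p i \<bullet> x + b i})" unfolding A by auto
    moreover have "open \<dots>" by (intro open_INT I ballI open_Collect_less continuous_intros)
    ultimately show ?thesis by simp
  qed
  then have Am: "indicator A \<in> borel_measurable (lebesgue_on S)"
    by (intro lebesgue_on_borel borel_measurable_indicator)
  have int: "integrable (lebesgue_on S) (\<lambda>x. (h x \<bullet> v) * indicator A x)" if "h \<in> L2 S" for h
    using integrable_L2[OF that] by (intro integrable_times_bounded[OF _ Am, where B=1]) (simp_all add: indicator_def)
  have gL: "g \<in> L2 S" "(\<lambda>x. g x - ?D x) \<in> L2 S" using g gD by (simp_all add: is_weak_gradient_def)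
  have "(LINT x|lebesgue_on S. (g x \<bullet> v) * indicator A x) - (LINT x|lebesgue_on S. (w x \<bullet> v) * indicator A x)
      = (LINT x|lebesgue_on S. (g x \<bullet> v) * indicator A x) - (LINT x|lebesgue_on S. ((g x - ?D x) \<bullet> v) * indicator A x)"
    by (simp only: weak_gradient_unique_polyhedron[OF gD w I A])
  also have "\<dots> = (LINT x|lebesgue_on S. (g x \<bullet> v) * indicator A x - ((g x - ?D x) \<bullet> v) * indicator A x)"
    by (rule Bochner_Integration.integral_diff[symmetric, OF int[OF gL(1)] int[OF gL(2)]])
  also have "\<dots> = (LINT x|lebesgue_on S. dirder \<psi> v x * indicator A x)"
    by (simp add: inner_diff_left D left_diff_distrib)
  finally show ?thesis by simp
qed

end

section \<open>Right derivative of the integral over a translated polyhedron\<close>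

lemma open_polyhedron:
  fixes p :: "'b \<Rightarrow> 'a::real_inner"
  assumes "finite I"
  shows "open {x. \<forall>i\<in>I. 0 < p i \<bullet> x + b i}" "convex {x. \<forall>i\<in>I. 0 < p i \<bullet> x + b i}"
proof -
  have eq: "{x. \<forall>i\<in>I. 0 < p i \<bullet> x + b i} = (\<Inter>i\<in>I. {x. 0 < p i \<bullet> x + b i})" by auto
  show "open {x. \<forall>i\<in>I. 0 < p i \<bullet> x + b i}"
    unfolding eq by (intro open_INT assms ballI open_Collect_less continuous_intros)
  have "{x. 0 < p i \<bullet> x + b i} = {x. p i \<bullet> x > - b i}" for i by auto
  then show "convex {x. \<forall>i\<in>I. 0 < p i \<bullet> x + b i}"
    unfolding eq by (intro convex_INT) (simp add: convex_halfspace_gt)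
qed

lemma indicator_translate_tendsto:
  fixes A :: "'a::euclidean_space set"
  assumes "open A" "x \<notin> frontier A" and u: "(u \<longlongrightarrow> 0) F"
  shows "((\<lambda>n. indicator A (x - u n) :: real) \<longlongrightarrow> indicator A x) F"
proof -
  have lim: "((\<lambda>n. x - u n) \<longlongrightarrow> x) F" using tendsto_diff[OF tendsto_const u, of x] by simp
  have "\<forall>\<^sub>F n in F. (x - u n \<in> A) = (x \<in> A)"
  proof (cases "x \<in> A")
    case True
    with topological_tendstoD[OF lim \<open>open A\<close>] show ?thesis by simp
  next
    case False
    then have "x \<in> - closure A" using assms(1,2) by (simp add: frontier_def interior_open)
    with topological_tendstoD[OF lim, of "- closure A"] have "\<forall>\<^sub>F n in F. x - u n \<in> - closure A" by auto
    then show ?thesis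
      using False closure_subset[of A] by (auto elim: eventually_mono)
  qed
  then show ?thesis
    by (intro tendsto_eventually) (auto simp: indicator_def elim: eventually_mono)
qed

text \<open>For a test function the increment is the integral over \<open>s\<close> in [0, h] of its
  directional derivative integrated over the translate of \<open>A\<close> by
  \<open>s *\<^sub>R v\<close>. Density carries this to \<open>f\<close> up to an error, which is
  sent to zero for fixed \<open>h\<close>; what is left is \<open>h\<close> times the deviation of
  \<open>G\<close> from \<open>G 0\<close> on [0, h]. Right continuity of \<open>G\<close> gives the
  limit.\<close>

lemma H1_0_difference_quotient:
  fixes f :: "real ^ 'n \<Rightarrow> real"
  assumes S: "open S" "bounded S" and f: "f \<in> H1_0 S"
    and I: "finite I" and A: "A = {x. \<forall>i\<in>I. 0 < p i \<bullet> x + b i}"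
  shows "((\<lambda>h. (LINT x|lebesgue_on S. f x * (indicator A (x - h *\<^sub>R v) - indicator A x)) / h)
      \<longlongrightarrow> (LINT x|lebesgue_on S. (grad S f x \<bullet> v) * indicator A x)) (at_right 0)"
proof -
  interpret finite_measure "lebesgue_on S" by (rule finite_measure_lebesgue_on[OF S])
  have Ao: "open A" and Ac: "convex A" unfolding A by (rule open_polyhedron[OF I])+
  have Ab [measurable]: "A \<in> sets borel" using Ao by simp
  have fL: "f \<in> L2 S" and "\<exists>g. is_weak_gradient S f g"
    using f by (auto simp: H1_0_def H1_def)
  define g where "g = grad S f"
  have g: "is_weak_gradient S f g"
    unfolding g_def grad_def using \<open>\<exists>g. is_weak_gradient S f g\<close> by (rule someI_ex)
  then have gL: "g \<in> L2 S" by (simp add: is_weak_gradient_def)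
  have gv: "integrable (lebesgue_on S) (\<lambda>x. g x \<bullet> v)"
    using integrable_L2[OF S gL] by simp
  have Am: "(\<lambda>x. indicator A (x - u)) \<in> borel_measurable (lebesgue_on S)" for u
    by (intro lebesgue_on_borel) measurable
  have Am0: "indicator A \<in> borel_measurable (lebesgue_on S)"
    using Am[of 0] by simp
  define G where "G s = (LINT x|lebesgue_on S. (g x \<bullet> v) * indicator A (x - s *\<^sub>R v))" for s
  define P where "P h = (LINT x|lebesgue_on S. f x * (indicator A (x - h *\<^sub>R v) - indicator A x))" for h
  have G_cont: "(G \<longlongrightarrow> G 0) (at_right 0)"
    unfolding tendsto_at_iff_sequentially
  proof (intro allI impI)
    fix X :: "nat \<Rightarrow> real" assume "X \<longlonglongrightarrow> 0"
    then have X: "(\<lambda>n. X n *\<^sub>R v) \<longlonglongrightarrow> 0" using tendsto_scaleR[OF _ tendsto_const, of X 0 _ v] by simp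
    have "AE x in lebesgue. x \<notin> frontier A"
      using negligible_convex_frontier[OF Ac] negligible_iff_null_sets AE_not_in by blast
    then have ae: "AE x in lebesgue_on S. x \<notin> frontier A"
      using S by (auto simp: AE_restrict_space_iff elim: AE_mp)
    show "(G \<circ> X) \<longlonglongrightarrow> G 0"
      unfolding G_def o_def
    proof (rule integral_dominated_convergence[where w="\<lambda>x. norm (g x \<bullet> v)"])
      show "integrable (lebesgue_on S) (\<lambda>x. norm (g x \<bullet> v))" using gv by simp
      show "AE x in lebesgue_on S. (\<lambda>n. (g x \<bullet> v) * indicator A (x - X n *\<^sub>R v)) \<longlonglongrightarrow> (g x \<bullet> v) * indicator A (x - 0 *\<^sub>R v)"
        using ae
      proof eventually_elim
        case (elim x)
        show ?case
          using indicator_translate_tendsto[OF Ao elim X] by (intro tendsto_mult tendsto_const) simp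
      qed
      show "AE x in lebesgue_on S. norm ((g x \<bullet> v) * indicator A (x - X n *\<^sub>R v)) \<le> norm (g x \<bullet> v)" for n
        by (auto simp: indicator_def)
    qed (auto intro!: borel_measurable_times borel_measurable_integrable[OF gv] Am Am0)
  qed
  have quot: "\<bar>P h - h * G 0\<bar> \<le> h * \<epsilon>"
    if h: "0 \<le> h" and G: "\<And>s. 0 \<le> s \<Longrightarrow> s \<le> h \<Longrightarrow> \<bar>G s - G 0\<bar> \<le> \<epsilon>" for h \<epsilon>
  proof -
    define m where "m = 1 + measure lebesgue S"
    have m: "0 < m" by (simp add: m_def add_pos_nonneg)
    \<comment> \<open>The summand \<open>\<eta> * m\<close> stems from replacing \<open>f\<close> by
      the test function and has no factor \<open>h\<close>. Division by \<open>h\<close> at this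
      point would spoil the estimate, so \<eta> tends to zero first.\<close>
    have approx: "\<bar>P h - h * G 0\<bar> \<le> h * \<epsilon> + \<eta> * (m * (1 + h * norm v))" if \<eta>: "0 < \<eta>" for \<eta>
    proof -
      obtain \<psi> w where \<psi>: "\<psi> \<in> test_functions S" and w: "is_weak_gradient S (\<lambda>x. f x - \<psi> x) w"
        and n: "L2_norm S (\<lambda>x. f x - \<psi> x) < \<eta>" "L2_norm S w < \<eta>"
        and L: "(\<lambda>x. f x - \<psi> x) \<in> L2 S" "w \<in> L2 S"
        by (rule H1_0_approx[OF S f \<eta>])
      note T = test_functionsD[OF \<psi>]
      obtain C where C: "compact C" "C \<subseteq> S" "\<And>x. x \<notin> C \<Longrightarrow> \<psi> x = 0" "\<And>x i. x \<notin> C \<Longrightarrow> partial i \<psi> x = 0"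
        "\<And>x v. x \<notin> C \<Longrightarrow> dirder \<psi> v x = 0"
        using test_function_support[OF \<psi>] by blast
      have fi: "integrable (lebesgue_on S) f" by (rule integrable_L2[OF S fL])
      have di: "integrable (lebesgue_on S) (\<lambda>x. f x - \<psi> x)" by (rule integrable_L2[OF S L(1)])
      have \<psi>i: "integrable (lebesgue_on S) \<psi>"
        using Bochner_Integration.integrable_diff[OF fi di] by simp
      have wv: "integrable (lebesgue_on S) (\<lambda>x. w x \<bullet> v)" using integrable_L2[OF S L(2)] by simp
      define \<Gamma> where "\<Gamma> s = (LINT x|lebesgue_on S. dirder \<psi> v x * indicator A (x - s *\<^sub>R v))" for s
      have \<Gamma>_G: "\<bar>\<Gamma> s - G s\<bar> \<le> \<eta> * m * norm v" for s
      proof -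
        \<comment> \<open>A translate of a polyhedron is a polyhedron with shifted offsets, so the
          comparison of weak gradients applies to it as well.\<close>
        define B where "B = {x. \<forall>i\<in>I. 0 < p i \<bullet> x + (b i - s * (p i \<bullet> v))}"
        have B: "(indicator A (x - s *\<^sub>R v) :: real) = indicator B x" for x
          by (simp add: A B_def indicator_def inner_diff_right algebra_simps)
        have "\<Gamma> s = G s - (LINT x|lebesgue_on S. (w x \<bullet> v) * indicator A (x - s *\<^sub>R v))"
          unfolding \<Gamma>_def G_def B
          by (rule weak_gradient_polyhedron[OF S \<psi> fL g w I B_def])
        then have "\<bar>\<Gamma> s - G s\<bar> = norm (LINT x|lebesgue_on S. (w x \<bullet> v) * indicator A (x - s *\<^sub>R v))"
          by simp
        also have "\<dots> \<le> (LINT x|lebesgue_on S. norm (w x) * norm v)"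
        proof (rule Bochner_Integration.integral_norm_bound_integral)
          show "integrable (lebesgue_on S) (\<lambda>x. (w x \<bullet> v) * indicator A (x - s *\<^sub>R v))"
            by (rule integrable_times_bounded[OF wv Am, where B=1]) (simp add: indicator_def)
          show "integrable (lebesgue_on S) (\<lambda>x. norm (w x) * norm v)"
            using integrable_L2[OF S L(2)] by simp
          show "norm ((w x \<bullet> v) * indicator A (x - s *\<^sub>R v)) \<le> norm (w x) * norm v" for x
            using Cauchy_Schwarz_ineq2[of "w x" v] by (auto simp: indicator_def)
        qed
        also have "\<dots> = (LINT x|lebesgue_on S. norm (w x)) * norm v" by simp
        also have "\<dots> \<le> \<eta> * m * norm v"
          unfolding m_def by (intro mult_right_mono L1_bound_L2[OF S] L n) simp
        finally show ?thesis .
      qed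
      have tr: "(LINT x|lborel. indicator A x * dirder \<psi> v (x + s *\<^sub>R v)) = \<Gamma> s" for s
        unfolding \<Gamma>_def
        by (rule translate_indicator_integral[OF S continuous_dirder[OF T(1)] C(1,2,5) Ab])
      have Cv: "dirder \<psi> v x = 0" if "x \<notin> C" for x using C(5) that by simp
      have \<Gamma>i: "integrable lborel (\<lambda>s. indicator {0..h} s * \<Gamma> s)"
        using increment_integrable[OF T(1) C(1) Cv Ab h] unfolding tr .
      have inc: "(LINT x|lborel. indicator A x * (\<psi> (x + h *\<^sub>R v) - \<psi> x)) = (LINT s|lborel. indicator {0..h} s * \<Gamma> s)"
        using increment_eq[OF T(1) C(1) Cv Ab h] unfolding tr .
      have P\<psi>: "(LINT x|lebesgue_on S. \<psi> x * (indicator A (x - h *\<^sub>R v) - indicator A x)) = (LINT s|lborel. indicator {0..h} s * \<Gamma> s)"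
      proof -
        have \<psi>b: "\<psi> \<in> borel_measurable borel" using T(7) by (rule borel_measurable_continuous_onI)
        have \<psi>l: "integrable lborel \<psi>" by (rule integrable_compact_support[OF C(1) T(7) C(3)])
        have \<psi>h: "integrable lborel (\<lambda>x. \<psi> (x + h *\<^sub>R v))"
        proof -
          have "integrable (distr lborel borel ((+) (h *\<^sub>R v))) \<psi>" using \<psi>l by (simp add: lborel_distr_plus)
          then show ?thesis using \<psi>b by (subst (asm) integrable_distr_eq) (auto simp: add.commute)
        qed
        have Ai: "integrable lborel (\<lambda>x. indicator A x * k x)" if "integrable lborel k" for k :: "real ^ 'n \<Rightarrow> real"
          using integrable_times_bounded[OF that, of "indicator A" 1] by (simp add: mult.commute indicator_def)
        have "(LINT x|lebesgue_on S. \<psi> x * (indicator A (x - h *\<^sub>R v) - indicator A x))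
            = (LINT x|lebesgue_on S. \<psi> x * indicator A (x - h *\<^sub>R v)) - (LINT x|lebesgue_on S. \<psi> x * indicator A (x - 0))"
          unfolding right_diff_distrib diff_zero
          by (intro Bochner_Integration.integral_diff integrable_times_bounded[where B=1] \<psi>i Am Am0) (auto simp: indicator_def)
        also have "\<dots> = (LINT x|lborel. indicator A x * \<psi> (x + h *\<^sub>R v)) - (LINT x|lborel. indicator A x * \<psi> (x + 0))"
          using translate_indicator_integral[OF S T(7) C(1,2,3) Ab] by presburger
        also have "\<dots> = (LINT x|lborel. indicator A x * (\<psi> (x + h *\<^sub>R v) - \<psi> x))"
          unfolding right_diff_distrib add_0_right
          by (intro Bochner_Integration.integral_diff[symmetric] Ai \<psi>h \<psi>l)
        finally show ?thesis using inc by simp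
      qed
      have b1: "\<bar>(LINT s|lborel. indicator {0..h} s * \<Gamma> s) - h * G 0\<bar> \<le> h * (\<epsilon> + \<eta> * m * norm v)"
      proof -
        have ci: "integrable lborel (\<lambda>s. indicator {0..h} s * c)" for c :: real
          using h by (intro integrable_mult_left) simp
        have cv: "(LINT s|lborel. indicator {0..h} s * c) = h * c" for c :: real
          using h by simp
        have "(LINT s|lborel. indicator {0..h} s * \<Gamma> s) - h * G 0
            = (LINT s|lborel. indicator {0..h} s * \<Gamma> s - indicator {0..h} s * G 0)"
          using \<Gamma>i ci h by (simp add: cv)
        also have "\<bar>\<dots>\<bar> \<le> (LINT s|lborel. indicator {0..h} s * (\<epsilon> + \<eta> * m * norm v))"
          unfolding real_norm_def[symmetric]
        proof (rule Bochner_Integration.integral_norm_bound_integral)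
          show "integrable lborel (\<lambda>s. indicator {0..h} s * \<Gamma> s - indicator {0..h} s * G 0)" using \<Gamma>i ci by simp
          show "norm (indicator {0..h} s * \<Gamma> s - indicator {0..h} s * G 0) \<le> indicator {0..h} s * (\<epsilon> + \<eta> * m * norm v)" for s
            using \<Gamma>_G[of s] G[of s] by (auto simp: indicator_def)
        qed (rule ci)
        finally show ?thesis unfolding cv .
      qed
      have b2: "\<bar>P h - (LINT s|lborel. indicator {0..h} s * \<Gamma> s)\<bar> \<le> \<eta> * m"
      proof -
        let ?k = "\<lambda>x. indicator A (x - h *\<^sub>R v) - indicator A x :: real"
        have km: "?k \<in> borel_measurable (lebesgue_on S)" using Am[of "h *\<^sub>R v"] Am0 by (rule borel_measurable_diff)
        have k1: "\<bar>?k x\<bar> \<le> 1" for x by (auto simp: indicator_def)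
        have "P h - (LINT s|lborel. indicator {0..h} s * \<Gamma> s) = (LINT x|lebesgue_on S. (f x - \<psi> x) * ?k x)"
          unfolding P\<psi>[symmetric] P_def
          by (subst Bochner_Integration.integral_diff[symmetric])
            (auto intro!: integrable_times_bounded[where B=1] fi \<psi>i km k1 simp: left_diff_distrib)
        also have "\<bar>\<dots>\<bar> \<le> (LINT x|lebesgue_on S. norm (f x - \<psi> x))"
          unfolding real_norm_def[symmetric]
        proof (rule Bochner_Integration.integral_norm_bound_integral)
          show "integrable (lebesgue_on S) (\<lambda>x. (f x - \<psi> x) * ?k x)"
            by (rule integrable_times_bounded[OF di km k1])
          show "integrable (lebesgue_on S) (\<lambda>x. norm (f x - \<psi> x))" using di by simp
          show "norm ((f x - \<psi> x) * ?k x) \<le> norm (f x - \<psi> x)" for x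
            using mult_left_mono[OF k1[of x], of "\<bar>f x - \<psi> x\<bar>"] by (simp add: abs_mult)
        qed
        also have "\<dots> \<le> \<eta> * m" unfolding m_def by (rule L1_bound_L2[OF S L(1) n(1)])
        finally show ?thesis .
      qed
      have "\<bar>P h - h * G 0\<bar> \<le> h * (\<epsilon> + \<eta> * m * norm v) + \<eta> * m" using b1 b2 by linarith
      then show ?thesis by (simp add: algebra_simps)
    qed
    define c where "c = m * (1 + h * norm v)"
    have c: "0 < c" using m h by (simp add: c_def add_pos_nonneg)
    show ?thesis
    proof (rule field_le_epsilon)
      fix e :: real assume "0 < e"
      then show "\<bar>P h - h * G 0\<bar> \<le> h * \<epsilon> + e"
        using approx[of "e / c"] c by (simp add: c_def[symmetric])
    qed
  qed
  have "((\<lambda>h. P h / h) \<longlongrightarrow> G 0) (at_right 0)"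
  proof (rule tendstoI)
    fix e :: real assume e: "0 < e"
    from tendstoD[OF G_cont, of "e / 2"] e
    have "\<forall>\<^sub>F s in at_right 0. \<bar>G s - G 0\<bar> < e / 2" by (simp add: dist_real_def)
    then obtain d where d: "0 < d" "\<And>s. 0 < s \<Longrightarrow> s < d \<Longrightarrow> \<bar>G s - G 0\<bar> < e / 2"
      unfolding eventually_at_right_field by auto
    have "dist (P h / h) (G 0) < e" if h: "0 < h" "h < d" for h
    proof -
      have "\<bar>P h - h * G 0\<bar> \<le> h * (e / 2)"
      proof (rule quot)
        show "\<bar>G s - G 0\<bar> \<le> e / 2" if "0 \<le> s" "s \<le> h" for s
          using d(2)[of s] that h e by (cases "s = 0") auto
      qed (use h in simp)
      moreover have "P h / h - G 0 = (P h - h * G 0) / h" using h by (simp add: field_simps)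
      ultimately have "\<bar>P h / h - G 0\<bar> \<le> e / 2" using h by (simp add: abs_divide pos_divide_le_eq mult.commute)
      then show ?thesis using e by (simp add: dist_real_def)
    qed
    then show "\<forall>\<^sub>F h in at_right 0. dist (P h / h) (G 0) < e"
      unfolding eventually_at_right_field using d(1) by blast
  qed
  then show ?thesis by (simp add: P_def G_def g_def)
qed

section \<open>Prisms over facets\<close>

lemma compact_prism: "compact e \<Longrightarrow> compact (prism e u)"
proof -
  assume e: "compact e"
  have "prism e u = (\<lambda>(y, t). y + t *\<^sub>R u) ` (e \<times> {0..1})"
  proof (intro equalityI subsetI)
    fix x assume "x \<in> prism e u"
    then obtain y t where "x = y + t *\<^sub>R u" "y \<in> e" "t \<in> {0..1}" unfolding prism_def by blast
    then show "x \<in> (\<lambda>(y, t). y + t *\<^sub>R u) ` (e \<times> {0..1})"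
      by (intro image_eqI[of _ _ "(y, t)"]) auto
  next
    fix x assume "x \<in> (\<lambda>(y, t). y + t *\<^sub>R u) ` (e \<times> {0..1})"
    then obtain y t where "x = y + t *\<^sub>R u" "y \<in> e" "t \<in> {0..1}" by (auto simp del: atLeastAtMost_iff)
    then show "x \<in> prism e u" unfolding prism_def by blast
  qed
  also have "compact \<dots>"
    unfolding case_prod_unfold
    by (intro compact_continuous_image compact_Times e compact_Icc continuous_intros)
  finally show ?thesis .
qed

lemma mem_prism_scaled:
  assumes "0 < h"
  shows "x \<in> prism e (h *\<^sub>R v) \<longleftrightarrow> (\<exists>t\<in>{0..h}. x - t *\<^sub>R v \<in> e)"
proof
  assume "x \<in> prism e (h *\<^sub>R v)"
  then obtain y t where yt: "x = y + t *\<^sub>R h *\<^sub>R v" "y \<in> e" "0 \<le> t" "t \<le> 1" by (auto simp: prism_def)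
  then show "\<exists>t\<in>{0..h}. x - t *\<^sub>R v \<in> e"
    using assms by (intro bexI[of _ "t * h"]) (auto simp: mult_left_le_one_le)
next
  assume "\<exists>t\<in>{0..h}. x - t *\<^sub>R v \<in> e"
  then obtain t where t: "0 \<le> t" "t \<le> h" "x - t *\<^sub>R v \<in> e" by auto
  then have "x = (x - t *\<^sub>R v) + (t / h) *\<^sub>R h *\<^sub>R v" "0 \<le> t / h" "t / h \<le> 1"
    using assms by auto
  with t(3) show "x \<in> prism e (h *\<^sub>R v)"
    unfolding prism_def by (intro CollectI exI[of _ "x - t *\<^sub>R v"] exI[of _ "t / h"]) auto
qed

text \<open>The map fixes the hyperplane of \<open>e\<close> pointwise and its linear part sends
  \<open>n\<close> to \<open>u\<close>, hence it takes the fibres of one prism to those of the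
  other.\<close>

lemma prism_rank_one:
  assumes e: "\<And>y. y \<in> e \<Longrightarrow> n \<bullet> y + \<beta> = 0" and n: "norm n = 1" and u: "n \<bullet> u \<noteq> 0"
  shows "x + (n \<bullet> x + \<beta>) *\<^sub>R (u - n) \<in> prism e u \<longleftrightarrow> x \<in> prism e n"
proof -
  have nn: "n \<bullet> n = 1" using n by (simp add: norm_eq_1)
  show ?thesis
  proof
    assume "x \<in> prism e n"
    then obtain y t where yt: "x = y + t *\<^sub>R n" "y \<in> e" "t \<in> {0..1}" by (auto simp: prism_def)
    have "n \<bullet> x + \<beta> = t" using e[OF yt(2)] nn by (simp add: yt(1) inner_add_right)
    then have "x + (n \<bullet> x + \<beta>) *\<^sub>R (u - n) = y + t *\<^sub>R u" by (simp add: yt(1) algebra_simps)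
    with yt(2,3) show "x + (n \<bullet> x + \<beta>) *\<^sub>R (u - n) \<in> prism e u" unfolding prism_def by blast
  next
    assume "x + (n \<bullet> x + \<beta>) *\<^sub>R (u - n) \<in> prism e u"
    then obtain y t where yt: "x + (n \<bullet> x + \<beta>) *\<^sub>R (u - n) = y + t *\<^sub>R u" "y \<in> e" "t \<in> {0..1}"
      by (auto simp: prism_def)
    have "n \<bullet> (x + (n \<bullet> x + \<beta>) *\<^sub>R (u - n)) + \<beta> = (n \<bullet> x + \<beta>) * (n \<bullet> u)"
      using nn by (simp add: inner_add_right inner_diff_right algebra_simps)
    moreover have "n \<bullet> (y + t *\<^sub>R u) + \<beta> = t * (n \<bullet> u)"
      using e[OF yt(2)] by (simp add: inner_add_right)
    ultimately have t: "n \<bullet> x + \<beta> = t" using yt(1) u by simp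
    then have "x = y + t *\<^sub>R n" using yt(1) by (simp add: algebra_simps)
    with yt(2,3) show "x \<in> prism e n" unfolding prism_def by blast
  qed
qed

text \<open>The Jacobian \<open>1 + n \<bullet> (u - n)\<close> equals \<open>n \<bullet> u\<close>
  because \<open>n\<close> is a unit vector: the volume of a prism is base area times
  height.\<close>

lemma prism_integral_transform:
  fixes f :: "real ^ 'n \<Rightarrow> real"
  assumes e: "compact e" "\<And>y. y \<in> e \<Longrightarrow> n \<bullet> y + \<beta> = 0" and n: "norm n = 1" and u: "n \<bullet> u \<noteq> 0"
    and f [measurable]: "f \<in> borel_measurable borel"
  shows "(LINT x|lborel. indicator (prism e u) x * f x)
    = \<bar>n \<bullet> u\<bar> * (LINT x|lborel. indicator (prism e n) x * f (x + (n \<bullet> x + \<beta>) *\<^sub>R (u - n)))"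
proof -
  have c: "1 + n \<bullet> (u - n) = n \<bullet> u" using n by (simp add: inner_diff_right norm_eq_1)
  have [measurable]: "prism e u \<in> sets borel" using compact_prism[OF e(1)] by (rule borel_compact)
  have "(LINT x|lborel. indicator (prism e u) x * f x) = \<bar>1 + n \<bullet> (u - n)\<bar> *
      (LINT x|lborel. indicator (prism e u) (x + (n \<bullet> x + \<beta>) *\<^sub>R (u - n)) * f (x + (n \<bullet> x + \<beta>) *\<^sub>R (u - n)))"
    by (rule integral_rank_one_affine) (use c u in auto)
  also have "(\<lambda>x. indicator (prism e u) (x + (n \<bullet> x + \<beta>) *\<^sub>R (u - n))) = (indicator (prism e n) :: _ \<Rightarrow> real)"
    using prism_rank_one[OF e(2) n u] by (auto simp: indicator_def fun_eq_iff)
  finally show ?thesis unfolding c by (simp add: fun_eq_iff)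
qed

text \<open>For \<open>u = h *\<^sub>R v\<close> the Jacobian has a factor \<open>h\<close> that
  cancels the division. What remains is an integral over the fixed unit prism of \<open>f\<close> at
  the foot point displaced by a multiple of \<open>h *\<^sub>R v\<close>, to which dominated
  convergence applies.\<close>

lemma flux_limit:
  fixes f k :: "real ^ 'n \<Rightarrow> real"
  assumes e: "compact e" "\<And>y. y \<in> e \<Longrightarrow> n \<bullet> y + \<beta> = 0" and n: "norm n = 1" and v: "n \<bullet> v \<noteq> 0"
    and f: "f \<in> borel_measurable borel" "\<And>x. \<bar>f x\<bar> \<le> B"
    and k: "(\<lambda>x. indicator (prism e n) x * k x) \<in> borel_measurable borel"
    and lim: "AE x in lborel. x \<in> prism e n \<longrightarrow>
      ((\<lambda>h. f (x - (n \<bullet> x + \<beta>) *\<^sub>R n + ((n \<bullet> x + \<beta>) * h) *\<^sub>R v)) \<longlongrightarrow> k x) (at_right 0)"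
  shows "((\<lambda>h. (LINT x|lborel. indicator (prism e (h *\<^sub>R v)) x * f x) / h)
    \<longlongrightarrow> \<bar>n \<bullet> v\<bar> * (LINT x|lborel. indicator (prism e n) x * k x)) (at_right 0)"
proof -
  note [measurable] = f(1)
  have cp: "compact (prism e n)" by (rule compact_prism[OF e(1)])
  then have [measurable]: "prism e n \<in> sets borel" by (rule borel_compact)
  define Q where "Q h = (LINT x|lborel. indicator (prism e n) x * f (x + (n \<bullet> x + \<beta>) *\<^sub>R (h *\<^sub>R v - n)))" for h
  have arg: "x + (n \<bullet> x + \<beta>) *\<^sub>R (h *\<^sub>R v - n) = x - (n \<bullet> x + \<beta>) *\<^sub>R n + ((n \<bullet> x + \<beta>) * h) *\<^sub>R v" for x h
    by (simp add: algebra_simps)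
  have "(Q \<longlongrightarrow> (LINT x|lborel. indicator (prism e n) x * k x)) (at_right 0)"
    unfolding tendsto_at_iff_sequentially
  proof (intro allI impI)
    fix X :: "nat \<Rightarrow> real" assume X0: "\<forall>i. X i \<in> {0<..} - {0}" and X: "X \<longlonglongrightarrow> 0"
    have fl: "filterlim X (at_right 0) sequentially"
      using X0 X by (intro tendsto_imp_filterlim_at_right) auto
    show "(Q \<circ> X) \<longlonglongrightarrow> (LINT x|lborel. indicator (prism e n) x * k x)"
      unfolding o_def Q_def
    proof (rule integral_dominated_convergence[where w="\<lambda>x. indicator (prism e n) x * B"])
      show "integrable lborel (\<lambda>x. indicator (prism e n) x * B)"
        using emeasure_compact_finite[OF cp] by (intro integrable_mult_left) simp
      show "AE x in lborel. (\<lambda>i. indicator (prism e n) x * f (x + (n \<bullet> x + \<beta>) *\<^sub>R (X i *\<^sub>R v - n)))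
          \<longlonglongrightarrow> indicator (prism e n) x * k x"
        using lim
      proof eventually_elim
        case (elim x)
        show ?case
        proof (cases "x \<in> prism e n")
          case True
          then show ?thesis
            unfolding arg using elim filterlim_compose[OF _ fl] by (intro tendsto_mult tendsto_const) blast
        qed simp
      qed
      show "AE x in lborel. norm (indicator (prism e n) x * f (x + (n \<bullet> x + \<beta>) *\<^sub>R (X i *\<^sub>R v - n)))
          \<le> indicator (prism e n) x * B" for i
        using f(2) by (auto simp: indicator_def)
      show "(\<lambda>x. indicator (prism e n) x * k x) \<in> borel_measurable lborel" using k by simp
      show "(\<lambda>x. indicator (prism e n) x * f (x + (n \<bullet> x + \<beta>) *\<^sub>R (X i *\<^sub>R v - n))) \<in> borel_measurable lborel" for i
        by measurable
    qed
  qed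
  then have "((\<lambda>h. \<bar>n \<bullet> v\<bar> * Q h) \<longlongrightarrow> \<bar>n \<bullet> v\<bar> * (LINT x|lborel. indicator (prism e n) x * k x)) (at_right 0)"
    by (intro tendsto_mult tendsto_const)
  moreover have "\<forall>\<^sub>F h in at_right 0. \<bar>n \<bullet> v\<bar> * Q h = (LINT x|lborel. indicator (prism e (h *\<^sub>R v)) x * f x) / h"
    unfolding eventually_at_right_field
  proof (intro exI[of _ 1] conjI allI impI)
    fix h :: real assume h: "0 < h"
    have "(LINT x|lborel. indicator (prism e (h *\<^sub>R v)) x * f x) = \<bar>n \<bullet> (h *\<^sub>R v)\<bar> * Q h"
      unfolding Q_def by (rule prism_integral_transform[OF e n _ f(1)]) (use v h in auto)
    then show "\<bar>n \<bullet> v\<bar> * Q h = (LINT x|lborel. indicator (prism e (h *\<^sub>R v)) x * f x) / h"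
      using h by (simp add: abs_mult)
  qed simp
  ultimately show ?thesis by (rule Lim_transform_eventually)
qed

lemma closest_point_prism:
  assumes e: "\<And>y. y \<in> e \<Longrightarrow> n \<bullet> y + \<beta> = 0" and n: "norm n = 1" and x: "x \<in> prism e n"
  shows "closest_point (affine hull e) x = x - (n \<bullet> x + \<beta>) *\<^sub>R n" "x - (n \<bullet> x + \<beta>) *\<^sub>R n \<in> e"
    "0 \<le> n \<bullet> x + \<beta>"
proof -
  have nn: "n \<bullet> n = 1" using n by (simp add: norm_eq_1)
  obtain y t where yt: "x = y + t *\<^sub>R n" "y \<in> e" "0 \<le> t" using x by (auto simp: prism_def)
  have t: "n \<bullet> x + \<beta> = t" using e[OF yt(2)] nn by (simp add: yt(1) inner_add_right)
  then have y: "x - (n \<bullet> x + \<beta>) *\<^sub>R n = y" by (simp add: yt(1))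
  show "x - (n \<bullet> x + \<beta>) *\<^sub>R n \<in> e" "0 \<le> n \<bullet> x + \<beta>" using y t yt by simp_all
  have "affine hull e \<subseteq> {z. n \<bullet> z = - \<beta>}"
    by (rule hull_minimal) (use e in \<open>auto simp: affine_hyperplane dest!: e\<close>)
  then have hyp: "n \<bullet> z = - \<beta>" if "z \<in> affine hull e" for z using that by auto
  have "y = closest_point (affine hull e) x"
  proof (rule closest_point_unique)
    show "convex (affine hull e)" by (simp add: affine_imp_convex)
    show "y \<in> affine hull e" using yt(2) by (rule hull_inc)
    show "\<forall>z\<in>affine hull e. dist x y \<le> dist x z"
    proof
      fix z assume z: "z \<in> affine hull e"
      have "n \<bullet> (y - z) = 0" using e[OF yt(2)] hyp[OF z] by (simp add: inner_diff_right)
      \<comment> \<open>The height \<open>t\<close> is the component of \<open>x - z\<close> along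
        \<open>n\<close>, so no point \<open>z\<close> of the hyperplane is nearer than the foot
        \<open>y\<close>.\<close>
      then have "t = n \<bullet> (x - z)" using nn by (simp add: yt(1) inner_add_right inner_diff_right)
      also have "\<dots> \<le> norm n * norm (x - z)" by (rule norm_cauchy_schwarz)
      finally show "dist x y \<le> dist x z" using n yt(3) by (simp add: yt(1) dist_norm)
    qed
  qed simp
  then show "closest_point (affine hull e) x = x - (n \<bullet> x + \<beta>) *\<^sub>R n" using y by simp
qed

text \<open>On the prism the projection is the affine map that subtracts the height along
  \<open>n\<close>, so a face integral becomes a Lebesgue integral that can be compared with those
  over tilted prisms.\<close>

lemma face_integral_lborel:
  assumes e: "compact e" "\<And>y. y \<in> e \<Longrightarrow> n \<bullet> y + \<beta> = 0" and n: "norm n = 1" and g: "continuous_on e g"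
  shows "(\<lambda>x. indicator (prism e n) x * g (x - (n \<bullet> x + \<beta>) *\<^sub>R n)) \<in> borel_measurable borel"
    and "integrable lborel (\<lambda>x. indicator (prism e n) x * g (x - (n \<bullet> x + \<beta>) *\<^sub>R n))"
    and "face_integral e n g = (LINT x|lborel. indicator (prism e n) x * g (x - (n \<bullet> x + \<beta>) *\<^sub>R n))"
    and "integrable (lebesgue_on (prism e n)) (\<lambda>x. g (closest_point (affine hull e) x))"
proof -
  let ?p = "\<lambda>x. x - (n \<bullet> x + \<beta>) *\<^sub>R n"
  have cp: "compact (prism e n)" by (rule compact_prism[OF e(1)])
  have pb: "prism e n \<in> sets borel" using cp by (rule borel_compact)
  have "continuous_on (prism e n) (\<lambda>x. g (?p x))"
    using closest_point_prism(2)[OF e(2) n]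
    by (intro continuous_on_compose2[OF g] continuous_intros) auto
  from borel_integrable_compact[OF cp this]
  show i: "integrable lborel (\<lambda>x. indicator (prism e n) x * g (?p x))" by simp
  then show m: "(\<lambda>x. indicator (prism e n) x * g (?p x)) \<in> borel_measurable borel"
    using borel_measurable_integrable by force
  have eq: "(\<lambda>x. indicator (prism e n) x * g (closest_point (affine hull e) x)) = (\<lambda>x. indicator (prism e n) x * g (?p x))"
    using closest_point_prism(1)[OF e(2) n] by (auto simp: fun_eq_iff indicator_def)
  show "face_integral e n g = (LINT x|lborel. indicator (prism e n) x * g (?p x))"
    unfolding face_integral_def using m lebesgue_on_lborel(1)[OF pb, of "\<lambda>x. g (closest_point (affine hull e) x)"] by (simp add: eq)
  show "integrable (lebesgue_on (prism e n)) (\<lambda>x. g (closest_point (affine hull e) x))"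
    using i m lebesgue_on_lborel(2)[OF pb, of "\<lambda>x. g (closest_point (affine hull e) x)"] by (simp add: eq)
qed

context full_simplex
begin

text \<open>A line in direction \<open>j - i\<close> enters \<open>K\<close> through the facet opposite \<open>j\<close> and leaves it through the facet opposite \<open>i\<close>.\<close>

lemma sweep_indicator:
  assumes ij: "i \<in> C" "j \<in> C" "i \<noteq> j" and h: "0 < h"
    and x: "bary C i x \<noteq> 0" "bary C i x \<noteq> - h" "bary C j x \<noteq> 0" "bary C j x \<noteq> h" "\<And>c. c \<in> C \<Longrightarrow> bary C c x \<noteq> 0"
  shows "(indicator (interior K) (x - h *\<^sub>R (j - i)) - indicator (interior K) x :: real)
    = indicator (prism (facet i) (h *\<^sub>R (j - i))) x - indicator (prism (facet j) (h *\<^sub>R (j - i))) x"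
proof -
  define a where "a = bary C i x"
  define b where "b = bary C j x"
  define Q where "Q \<longleftrightarrow> (\<forall>c\<in>C - {i, j}. 0 < bary C c x)"
  \<comment> \<open>Off the excluded hyperplanes strict and weak inequalities agree, which makes the
    open simplex comparable with the closed prisms.\<close>
  have Q': "Q \<longleftrightarrow> (\<forall>c\<in>C - {i, j}. 0 \<le> bary C c x)"
    unfolding Q_def using x(5) by (auto simp: order_less_le)
  have sh: "bary C c (x - t *\<^sub>R (j - i)) = bary C c x - t * (of_bool (j = c) - of_bool (i = c))" if "c \<in> C" for c t
    using bary_add[of c x "-t" "j - i"] bgrad_edge[OF that ij(1,2)] by simp
  have split: "(\<forall>c\<in>C. P c) \<longleftrightarrow> P i \<and> P j \<and> (\<forall>c\<in>C - {i, j}. P c)" for P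
    using ij by auto
  have shi: "bary C i (x - t *\<^sub>R (j - i)) = a + t" and shj: "bary C j (x - t *\<^sub>R (j - i)) = b - t"
    and sho: "c \<in> C - {i, j} \<Longrightarrow> bary C c (x - t *\<^sub>R (j - i)) = bary C c x" for t c
    using ij by (auto simp: sh a_def b_def)
  have o1: "(\<forall>c\<in>C - {i, j}. 0 < bary C c (x - t *\<^sub>R (j - i))) \<longleftrightarrow> Q" for t
    unfolding Q_def by (intro ball_cong refl) (simp only: sho)
  have o2: "(\<forall>c\<in>C - {i, j}. 0 \<le> bary C c (x - t *\<^sub>R (j - i))) \<longleftrightarrow> Q" for t
    unfolding Q' by (intro ball_cong refl) (simp only: sho)
  have 1: "x - h *\<^sub>R (j - i) \<in> interior K \<longleftrightarrow> 0 < a + h \<and> 0 < b - h \<and> Q"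
    unfolding interior_K mem_Collect_eq split[of "\<lambda>c. 0 < bary C c (x - h *\<^sub>R (j - i))"] o1 shi shj ..
  have 2: "x \<in> interior K \<longleftrightarrow> 0 < a \<and> 0 < b \<and> Q"
    unfolding interior_K mem_Collect_eq split[of "\<lambda>c. 0 < bary C c x"] Q_def a_def b_def ..
  have mK: "x - t *\<^sub>R (j - i) \<in> K \<longleftrightarrow> 0 \<le> a + t \<and> 0 \<le> b - t \<and> Q" for t
    unfolding mem_K split[of "\<lambda>c. 0 \<le> bary C c (x - t *\<^sub>R (j - i))"] o2 shi shj ..
  have 3: "x \<in> prism (facet i) (h *\<^sub>R (j - i)) \<longleftrightarrow> - h \<le> a \<and> a \<le> 0 \<and> 0 \<le> a + b \<and> Q"
    unfolding mem_prism_scaled[OF h] mem_facet[OF ij(1)] mK shi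
    by (auto intro!: bexI[of _ "- a"])
  have 4: "x \<in> prism (facet j) (h *\<^sub>R (j - i)) \<longleftrightarrow> 0 \<le> b \<and> b \<le> h \<and> 0 \<le> a + b \<and> Q"
    unfolding mem_prism_scaled[OF h] mem_facet[OF ij(2)] mK shj
    by (auto intro!: bexI[of _ b])
  \<comment> \<open>Inequalities between \<open>a\<close>, \<open>b\<close> and \<open>h\<close>
    remain. A point of both prisms lies on a line whose chord in \<open>K\<close> has parameter
    length at most \<open>h\<close>; the two prisms cancel there, and neither the point nor its
    shift is in the interior.\<close>
  show ?thesis
    unfolding indicator_def 1 2 3 4 using x(1-4) h unfolding a_def[symmetric] b_def[symmetric]
    by (cases Q) auto
qed

lemma sweep_indicator_AE:
  assumes ij: "i \<in> C" "j \<in> C" "i \<noteq> j" and h: "0 < h"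
  shows "AE x in lborel. (indicator (interior K) (x - h *\<^sub>R (j - i)) - indicator (interior K) x :: real)
    = indicator (prism (facet i) (h *\<^sub>R (j - i))) x - indicator (prism (facet j) (h *\<^sub>R (j - i))) x"
proof -
  have ae: "AE x in lborel. bary C c x \<noteq> r" if "c \<in> C" for c r
  proof -
    have "AE x in lebesgue. x \<notin> {x. bary C c x = r}"
      using negligible_bary[OF that] negligible_iff_null_sets AE_not_in by blast
    then show ?thesis by (simp add: AE_completion_iff)
  qed
  have "AE x in lborel. \<forall>c\<in>C. bary C c x \<noteq> 0"
    using ae by (simp add: AE_finite_all)
  with ae[OF ij(1), of 0] ae[OF ij(1), of "- h"] ae[OF ij(2), of 0] ae[OF ij(2), of h]
  show ?thesis
    by eventually_elim (rule sweep_indicator[OF ij h]; blast)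
qed

end

section \<open>The divergence theorem on a cell\<close>

context full_simplex
begin

text \<open>The coordinate of \<open>c\<close> grows towards \<open>c\<close>, away from the
  opposite facet, so its gradient points into the simplex and the sign is reversed.\<close>

definition outer_normal :: "real ^ 'n \<Rightarrow> real ^ 'n" where
  "outer_normal c = - (1 / norm (bgrad C c)) *\<^sub>R bgrad C c"

text \<open>A mesh normal is fixed per face without reference to a cell, so it is known only up to
  its sign.\<close>

lemma facet_normal_cases:
  assumes c: "c \<in> C" and n: "norm n = 1" and perp: "\<And>x y. x \<in> facet c \<Longrightarrow> y \<in> facet c \<Longrightarrow> n \<bullet> (x - y) = 0"
  shows "n = outer_normal c \<or> n = - outer_normal c"
proof -
  let ?w = "bgrad C c"
  have w: "norm ?w \<noteq> 0" using bgrad_nz[OF c] by simp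
  obtain r where r: "n = r *\<^sub>R ?w" using facet_normal[OF c perp] by blast
  then have "\<bar>r\<bar> * norm ?w = 1" using n by simp
  then have "\<bar>r\<bar> = 1 / norm ?w" using w by (simp add: field_simps)
  then have "r = 1 / norm ?w \<or> r = - (1 / norm ?w)" by linarith
  then show ?thesis by (auto simp: r outer_normal_def)
qed

lemma abs_normal_inner:
  assumes "n = outer_normal c \<or> n = - outer_normal c"
  shows "\<bar>n \<bullet> v\<bar> = \<bar>outer_normal c \<bullet> v\<bar>"
  using assms by auto

lemma outer_normal_edge:
  assumes "c \<in> C" "i \<in> C" "j \<in> C"
  shows "outer_normal c \<bullet> (j - i) = (of_bool (i = c) - of_bool (j = c)) / norm (bgrad C c)"
proof -
  have "outer_normal c \<bullet> (j - i) = (- (bgrad C c \<bullet> (j - i))) / norm (bgrad C c)"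
    by (simp add: outer_normal_def)
  also have "- (bgrad C c \<bullet> (j - i)) = of_bool (i = c) - of_bool (j = c)"
    unfolding bgrad_edge[OF assms] by (rule minus_diff_eq)
  finally show ?thesis .
qed

lemma outer_normal_pos_iff: "c \<in> C \<Longrightarrow> 0 < outer_normal c \<bullet> v \<longleftrightarrow> bgrad C c \<bullet> v < 0"
  using bgrad_nz[of c] by (simp add: outer_normal_def divide_less_0_iff)

text \<open>For almost every point of the prism the foot on the hyperplane avoids the other facets,
  so limits have to be computed at relatively interior points of the facet only.\<close>

lemma facet_generic_AE:
  assumes c: "c \<in> C" and card2: "2 \<le> CARD('n)" and n: "n = outer_normal c \<or> n = - outer_normal c"
  shows "AE x in lborel. n \<bullet> x + \<beta> \<noteq> 0 \<and> (\<forall>a\<in>C - {c}. bary C a (x - (n \<bullet> x + \<beta>) *\<^sub>R n) \<noteq> 0)"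
proof -
  have ae: "AE x in lborel. w \<bullet> x \<noteq> r" if "w \<noteq> 0" for w :: "real ^ 'n" and r
  proof -
    have "AE x in lebesgue. x \<notin> {x. w \<bullet> x = r}"
      using negligible_hyperplane[of w r] that negligible_iff_null_sets AE_not_in by blast
    then show ?thesis by (simp add: AE_completion_iff)
  qed
  have n0: "n \<noteq> 0" using n bgrad_nz[OF c] by (auto simp: outer_normal_def)
  have "AE x in lborel. n \<bullet> x \<noteq> - \<beta>" by (rule ae[OF n0])
  moreover have "AE x in lborel. bary C a (x - (n \<bullet> x + \<beta>) *\<^sub>R n) \<noteq> 0" if a: "a \<in> C - {c}" for a
  proof -
    let ?w = "bgrad C a - (bgrad C a \<bullet> n) *\<^sub>R n"
    have "?w \<noteq> 0"
    proof
      assume "?w = 0"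
      then have w: "bgrad C a = (bgrad C a \<bullet> n) *\<^sub>R n" by simp
      have "card (C - {a, c}) > 0"
        using card_C card2 a c by (subst card_Diff_subset) auto
      \<comment> \<open>Dimension at least two supplies a third vertex \<open>d\<close>. The edge
        from \<open>a\<close> to \<open>d\<close> lies in the facet opposite \<open>c\<close>, hence
        is orthogonal to \<open>n\<close>, while the coordinate of \<open>a\<close> drops from 1 to
        0 along it.\<close>
      then obtain d where d: "d \<in> C" "d \<noteq> a" "d \<noteq> c" by (metis DiffE card_gt_0_iff ex_in_conv insertCI)
      have "outer_normal c \<bullet> (d - a) = 0"
        using outer_normal_edge[OF c, of a d] a d by simp
      then have "n \<bullet> (d - a) = 0" using n by auto
      then have "bgrad C a \<bullet> (d - a) = 0" by (subst w) simp
      moreover have "bgrad C a \<bullet> (d - a) = - 1" using bgrad_edge[of a a d] a d by simp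
      ultimately show False by simp
    qed
    have "bary C a (x - (n \<bullet> x + \<beta>) *\<^sub>R n) = ?w \<bullet> x + (snd (bary_pair C a) - \<beta> * (bgrad C a \<bullet> n))" for x
      by (simp add: bary_def inner_diff_left inner_diff_right inner_add_right algebra_simps)
    then have "(bary C a (x - (n \<bullet> x + \<beta>) *\<^sub>R n) \<noteq> 0) = (?w \<bullet> x \<noteq> - (snd (bary_pair C a) - \<beta> * (bgrad C a \<bullet> n)))" for x
      by (simp add: eq_neg_iff_add_eq_0 del: minus_diff_eq)
    with ae[OF \<open>?w \<noteq> 0\<close>, of "- (snd (bary_pair C a) - \<beta> * (bgrad C a \<bullet> n))"] show ?thesis by simp
  qed
  then have "AE x in lborel. \<forall>a\<in>C - {c}. bary C a (x - (n \<bullet> x + \<beta>) *\<^sub>R n) \<noteq> 0"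
    by (intro AE_finite_allI) auto
  ultimately show ?thesis by eventually_elim auto
qed

definition open_facet :: "real ^ 'n \<Rightarrow> (real ^ 'n) set" where
  "open_facet c = {y. bary C c y = 0 \<and> (\<forall>a\<in>C - {c}. 0 < bary C a y)}"

lemma facet_offset:
  assumes c: "c \<in> C" and perp: "\<And>x y. x \<in> facet c \<Longrightarrow> y \<in> facet c \<Longrightarrow> n \<bullet> (x - y) = 0"
  obtains \<beta> where "\<And>y. y \<in> facet c \<Longrightarrow> n \<bullet> y + \<beta> = 0"
proof -
  obtain a where "a \<in> C - {c}" using other_vertex[OF c] by blast
  then have a: "a \<in> facet c" by (rule hull_inc)
  show ?thesis
  proof
    show "n \<bullet> y + - (n \<bullet> a) = 0" if "y \<in> facet c" for y
      using perp[OF that a] by (simp add: inner_diff_right)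
  qed
qed

lemma compact_facet: "compact (facet c)"
  by (simp add: finite_imp_compact compact_convex_hull)

lemma facet_subset_K: "facet c \<subseteq> K"
  by (rule hull_mono) auto

text \<open>\<open>ins\<close> separates the two kinds of facets. At an interior one the relatively
  interior points are continuity points of \<open>f\<close>, and the limit is the flux. At a
  boundary one \<open>v\<close> points outwards, so the swept points leave \<open>S\<close> at once
  and \<open>f\<close> extended by zero vanishes on them.\<close>

lemma facet_flux_limit:
  fixes f :: "real ^ 'n \<Rightarrow> real"
  assumes card2: "2 \<le> CARD('n)" and S: "open S" "bounded S" and f: "continuous_on (closure S) f"
    and KS: "K \<subseteq> closure S" and c: "c \<in> C" and n: "norm n = 1"
    and perp: "\<And>x y. x \<in> facet c \<Longrightarrow> y \<in> facet c \<Longrightarrow> n \<bullet> (x - y) = 0"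
    and v: "outer_normal c \<bullet> v \<noteq> 0"
    and side: "(ins \<and> open_facet c \<subseteq> S) \<or>
      (\<not> ins \<and> 0 < outer_normal c \<bullet> v \<and> (\<forall>y\<in>open_facet c. \<exists>\<epsilon>>0. \<forall>x\<in>ball y \<epsilon>. bary C c x < 0 \<longrightarrow> x \<notin> S))"
  shows "((\<lambda>h. (LINT x|lborel. indicator (prism (facet c) (h *\<^sub>R v)) x * (indicator S x * f x)) / h)
    \<longlongrightarrow> (if ins then \<bar>outer_normal c \<bullet> v\<bar> * face_integral (facet c) n f else 0)) (at_right 0)"
proof -
  let ?f = "\<lambda>x. indicator S x * f x"
  have nc: "n = outer_normal c \<or> n = - outer_normal c" by (rule facet_normal_cases[OF c n perp])
  \<comment> \<open>Only the absolute value enters, so it is immaterial whether the given normal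
    points into or out of the simplex.\<close>
  have nv: "\<bar>n \<bullet> v\<bar> = \<bar>outer_normal c \<bullet> v\<bar>" by (rule abs_normal_inner[OF nc])
  then have nv0: "n \<bullet> v \<noteq> 0" using v by auto
  obtain \<beta> where \<beta>: "\<And>y. y \<in> facet c \<Longrightarrow> n \<bullet> y + \<beta> = 0" using facet_offset[OF c perp] by blast
  let ?p = "\<lambda>x. x - (n \<bullet> x + \<beta>) *\<^sub>R n"
  let ?k = "\<lambda>x. if ins then f (?p x) else 0"
  have fc: "continuous_on (facet c) f"
    using facet_subset_K KS by (intro continuous_on_subset[OF f]) auto
  note FI = face_integral_lborel[OF compact_facet \<beta> n fc]
  have cS: "compact (closure S)" using S(2) by simp
  obtain B where B: "\<And>x. x \<in> closure S \<Longrightarrow> \<bar>f x\<bar> \<le> B"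
    using compact_imp_bounded[OF compact_continuous_image[OF f cS]] by (auto simp: bounded_iff)
  have fb: "?f \<in> borel_measurable borel"
    using borel_measurable_continuous_on_indicator[of S f] S(1) f closure_subset
    by (auto intro: continuous_on_subset)
  have fB: "\<bar>?f x\<bar> \<le> max B 0" for x
    using B[of x] closure_subset[of S] by (auto simp: indicator_def)
  have "((\<lambda>h. (LINT x|lborel. indicator (prism (facet c) (h *\<^sub>R v)) x * ?f x) / h)
    \<longlongrightarrow> \<bar>n \<bullet> v\<bar> * (LINT x|lborel. indicator (prism (facet c) n) x * ?k x)) (at_right 0)"
  proof (rule flux_limit[OF compact_facet \<beta> n nv0 fb fB])
    show "(\<lambda>x. indicator (prism (facet c) n) x * ?k x) \<in> borel_measurable borel"
      using FI(1) by (cases ins) auto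
    show "AE x in lborel. x \<in> prism (facet c) n \<longrightarrow>
      ((\<lambda>h. ?f (x - (n \<bullet> x + \<beta>) *\<^sub>R n + ((n \<bullet> x + \<beta>) * h) *\<^sub>R v)) \<longlongrightarrow> ?k x) (at_right 0)"
      using facet_generic_AE[OF c card2 nc, of \<beta>]
    proof eventually_elim
      case (elim x)
      show ?case
      proof
        assume x: "x \<in> prism (facet c) n"
        define t where "t = n \<bullet> x + \<beta>"
        define y where "y = x - t *\<^sub>R n"
        have t: "0 < t" using elim closest_point_prism(3)[OF \<beta> n x] by (simp add: t_def)
        have yf: "y \<in> facet c" using closest_point_prism(2)[OF \<beta> n x] by (simp add: y_def t_def)
        have yo: "y \<in> open_facet c"
          using elim yf by (auto simp: open_facet_def mem_facet[OF c] mem_K y_def t_def order_less_le)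
        have lim: "((\<lambda>h. y + (t * h) *\<^sub>R v) \<longlongrightarrow> y) (at_right 0)"
        proof -
          have "((\<lambda>h. y + (t * h) *\<^sub>R v) \<longlongrightarrow> y + (t * 0) *\<^sub>R v) (at_right 0)"
            by (intro tendsto_intros)
          then show ?thesis by simp
        qed
        have "((\<lambda>h. ?f (y + (t * h) *\<^sub>R v)) \<longlongrightarrow> (if ins then f y else 0)) (at_right 0)"
        proof (cases ins)
          case True
          then have yS: "y \<in> S" using side yo by blast
          have "\<forall>\<^sub>F h in at_right 0. y + (t * h) *\<^sub>R v \<in> S"
            by (rule topological_tendstoD[OF lim S(1) yS])
          moreover have "isCont f y"
            using f yS S(1) continuous_on_subset[OF f closure_subset] continuous_on_eq_continuous_at by blast
          then have "((\<lambda>h. f (y + (t * h) *\<^sub>R v)) \<longlongrightarrow> f y) (at_right 0)"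
            by (rule isCont_tendsto_compose[OF _ lim])
          ultimately show ?thesis
            using True by (auto elim!: Lim_transform_eventually eventually_mono)
        next
          case False
          then have out: "0 < outer_normal c \<bullet> v" using side by blast
          obtain \<epsilon> where \<epsilon>: "0 < \<epsilon>" "\<And>z. z \<in> ball y \<epsilon> \<Longrightarrow> bary C c z < 0 \<Longrightarrow> z \<notin> S"
            using False side yo by blast
          have "\<forall>\<^sub>F h in at_right 0. y + (t * h) *\<^sub>R v \<in> ball y \<epsilon>"
            by (rule topological_tendstoD[OF lim]) (use \<epsilon> in auto)
          moreover have "\<forall>\<^sub>F h in at_right (0::real). 0 < h" by (simp add: eventually_at_right_less)
          ultimately have "\<forall>\<^sub>F h in at_right 0. ?f (y + (t * h) *\<^sub>R v) = 0"
          proof eventually_elim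
            case (elim h)
            have "bary C c (y + (t * h) *\<^sub>R v) = (t * h) * (bgrad C c \<bullet> v)"
              using yo unfolding bary_add open_facet_def by simp
            also have "\<dots> < 0"
              using t elim out outer_normal_pos_iff[OF c] by (intro mult_pos_neg) auto
            finally show ?case using \<epsilon>(2)[OF elim(1)] by simp
          qed
          then show ?thesis using False by (simp add: tendsto_eventually)
        qed
        then show "((\<lambda>h. ?f (x - (n \<bullet> x + \<beta>) *\<^sub>R n + ((n \<bullet> x + \<beta>) * h) *\<^sub>R v)) \<longlongrightarrow> ?k x) (at_right 0)"
          by (simp only: y_def t_def)
      qed
    qed
  qed
  also have "(LINT x|lborel. indicator (prism (facet c) n) x * ?k x) = (if ins then face_integral (facet c) n f else 0)"
    using FI(3) by simp
  finally show ?thesis by (cases ins) (simp_all add: nv)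
qed

text \<open>Two evaluations of one right derivative are equated: by the weak gradient, and by the
  prisms over the facets opposite \<open>i\<close> and \<open>j\<close>. The other facets are
  parallel to the edge and contribute zero.\<close>

lemma directional_flux_edge:
  fixes f :: "real ^ 'n \<Rightarrow> real"
  assumes card2: "2 \<le> CARD('n)" and S: "open S" "bounded S" and f: "continuous_on (closure S) f" "f \<in> H1_0 S"
    and KS: "K \<subseteq> closure S" and J: "J \<subseteq> C"
    and n: "\<And>c. c \<in> J \<Longrightarrow> norm (n c) = 1"
    and perp: "\<And>c x y. c \<in> J \<Longrightarrow> x \<in> facet c \<Longrightarrow> y \<in> facet c \<Longrightarrow> n c \<bullet> (x - y) = 0"
    and inner: "\<And>c. c \<in> J \<Longrightarrow> open_facet c \<subseteq> S"
    and outer: "\<And>c y. c \<in> C - J \<Longrightarrow> y \<in> open_facet c \<Longrightarrow> \<exists>\<epsilon>>0. \<forall>x\<in>ball y \<epsilon>. bary C c x < 0 \<longrightarrow> x \<notin> S"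
    and j: "j \<in> J" and i: "i \<in> C"
  shows "(LINT x|lebesgue_on S. (grad S f x \<bullet> (j - i)) * indicator (interior K) x)
    = (\<Sum>c\<in>J. (outer_normal c \<bullet> (j - i)) * face_integral (facet c) (n c) f)"
proof (cases "i = j")
  case True
  then show ?thesis by simp
next
  case False
  let ?v = "j - i"
  let ?f = "\<lambda>x. indicator S x * f x"
  let ?A = "interior K"
  have jC: "j \<in> C" using j J by blast
  have finJ: "finite J" using J finite_subset by blast
  have oi: "outer_normal i \<bullet> ?v > 0" and oj: "outer_normal j \<bullet> ?v < 0"
    using outer_normal_edge[OF i i jC] outer_normal_edge[OF jC i jC] False bgrad_nz[OF i] bgrad_nz[OF jC] by auto
  have oo: "outer_normal c \<bullet> ?v = 0" if "c \<in> C" "c \<noteq> i" "c \<noteq> j" for c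
    using outer_normal_edge[OF that(1) i jC] that by simp
  \<comment> \<open>\<open>n\<close> is described on \<open>J\<close> only. At other facets the
    outer normal takes its place in \<open>facet_flux_limit\<close>, where for
    \<open>ins = False\<close> the limit is zero in any case.\<close>
  have unit: "norm (outer_normal c) = 1" if "c \<in> C" for c
    using bgrad_nz[OF that] by (simp add: outer_normal_def)
  have onperp: "outer_normal c \<bullet> (x - y) = 0" if "c \<in> C" "x \<in> facet c" "y \<in> facet c" for c x y
    using that bary_sub[of c x y] by (simp add: outer_normal_def mem_facet)
  have Lj: "((\<lambda>h. (LINT x|lborel. indicator (prism (facet j) (h *\<^sub>R ?v)) x * ?f x) / h)
      \<longlongrightarrow> \<bar>outer_normal j \<bullet> ?v\<bar> * face_integral (facet j) (n j) f) (at_right 0)"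
    using facet_flux_limit[OF card2 S f(1) KS jC n[OF j] perp[OF j], where ins=True and v="?v"] oj inner[OF j] by simp
  have Li: "((\<lambda>h. (LINT x|lborel. indicator (prism (facet i) (h *\<^sub>R ?v)) x * ?f x) / h)
      \<longlongrightarrow> (if i \<in> J then (outer_normal i \<bullet> ?v) * face_integral (facet i) (n i) f else 0)) (at_right 0)"
  proof (cases "i \<in> J")
    case True
    then show ?thesis
      using facet_flux_limit[OF card2 S f(1) KS i n[OF True] perp[OF True], where ins=True and v="?v"] oi inner[OF True] by simp
  next
    case False
    then show ?thesis
      using facet_flux_limit[OF card2 S f(1) KS i unit[OF i] onperp[OF i], where ins=False and v="?v"] oi outer[of i] i by simp
  qed
  have A: "?A = {x. \<forall>c\<in>C. 0 < bgrad C c \<bullet> x + snd (bary_pair C c)}"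
    unfolding interior_K by (simp add: bary_def)
  have Ab [measurable]: "?A \<in> sets borel" by simp
  have fb [measurable]: "?f \<in> borel_measurable borel"
    using borel_measurable_continuous_on_indicator[of S f] S(1) f closure_subset
    by (auto intro: continuous_on_subset)
  have fi: "integrable lborel ?f"
  proof -
    have "integrable (lebesgue_on S) f" using f(2) by (intro integrable_L2[OF S]) (simp add: H1_0_def H1_def)
    then show ?thesis using lebesgue_on_lborel(2)[of S f] S(1) fb by simp
  qed
  have eq: "(LINT x|lebesgue_on S. f x * (indicator ?A (x - h *\<^sub>R ?v) - indicator ?A x))
      = (LINT x|lborel. indicator (prism (facet i) (h *\<^sub>R ?v)) x * ?f x)
        - (LINT x|lborel. indicator (prism (facet j) (h *\<^sub>R ?v)) x * ?f x)" if h: "0 < h" for h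
  proof -
    have [measurable]: "prism (facet c) u \<in> sets borel" for c u
      using compact_prism[OF compact_facet] by (rule borel_compact)
    have pi: "integrable lborel (\<lambda>x. indicator (prism (facet c) u) x * ?f x)" for c u
      using integrable_times_bounded[OF fi, of "indicator (prism (facet c) u)" 1] by (simp add: mult.commute indicator_def)
    have "(LINT x|lebesgue_on S. f x * (indicator ?A (x - h *\<^sub>R ?v) - indicator ?A x))
        = (LINT x|lborel. indicator S x * (f x * (indicator ?A (x - h *\<^sub>R ?v) - indicator ?A x)))"
    proof (rule lebesgue_on_lborel(1))
      have "(\<lambda>x. ?f x * (indicator ?A (x - h *\<^sub>R ?v) - indicator ?A x)) \<in> borel_measurable borel" by measurable
      then show "(\<lambda>x. indicator S x * (f x * (indicator ?A (x - h *\<^sub>R ?v) - indicator ?A x))) \<in> borel_measurable borel"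
        by (simp add: mult.assoc)
    qed (use S in simp)
    also have "\<dots> = (LINT x|lborel. ?f x * (indicator ?A (x - h *\<^sub>R ?v) - indicator ?A x))"
      by (simp add: mult.assoc)
    also have "\<dots> = (LINT x|lborel. ?f x * (indicator (prism (facet i) (h *\<^sub>R ?v)) x - indicator (prism (facet j) (h *\<^sub>R ?v)) x))"
    proof (rule integral_cong_AE)
      show "AE x in lborel. ?f x * (indicator ?A (x - h *\<^sub>R ?v) - indicator ?A x)
          = ?f x * (indicator (prism (facet i) (h *\<^sub>R ?v)) x - indicator (prism (facet j) (h *\<^sub>R ?v)) x)"
        using sweep_indicator_AE[OF i jC False h] by eventually_elim (simp only:)
    qed measurable
    also have "\<dots> = (LINT x|lborel. indicator (prism (facet i) (h *\<^sub>R ?v)) x * ?f x - indicator (prism (facet j) (h *\<^sub>R ?v)) x * ?f x)"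
      by (rule Bochner_Integration.integral_cong) (auto simp: algebra_simps)
    also have "\<dots> = (LINT x|lborel. indicator (prism (facet i) (h *\<^sub>R ?v)) x * ?f x)
        - (LINT x|lborel. indicator (prism (facet j) (h *\<^sub>R ?v)) x * ?f x)"
      by (rule Bochner_Integration.integral_diff[OF pi pi])
    finally show ?thesis .
  qed
  have "((\<lambda>h. (LINT x|lebesgue_on S. f x * (indicator ?A (x - h *\<^sub>R ?v) - indicator ?A x)) / h)
      \<longlongrightarrow> (if i \<in> J then (outer_normal i \<bullet> ?v) * face_integral (facet i) (n i) f else 0)
        - \<bar>outer_normal j \<bullet> ?v\<bar> * face_integral (facet j) (n j) f) (at_right 0)"
  proof (rule Lim_transform_eventually[OF tendsto_diff[OF Li Lj]])
    have "\<forall>\<^sub>F h in at_right (0::real). 0 < h" by (simp add: eventually_at_right_less)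
    then show "\<forall>\<^sub>F h in at_right 0. (LINT x|lborel. indicator (prism (facet i) (h *\<^sub>R ?v)) x * ?f x) / h
        - (LINT x|lborel. indicator (prism (facet j) (h *\<^sub>R ?v)) x * ?f x) / h
        = (LINT x|lebesgue_on S. f x * (indicator ?A (x - h *\<^sub>R ?v) - indicator ?A x)) / h"
      by eventually_elim (simp add: eq diff_divide_distrib)
  qed
  \<comment> \<open>The edge enters through the facet opposite \<open>j\<close>, so the inner
    product with the outer normal there is negative and minus its absolute value is the signed
    flux.\<close>
  from tendsto_unique[OF _ H1_0_difference_quotient[OF S f(2) finite_C A, of ?v] this]
  have "(LINT x|lebesgue_on S. (grad S f x \<bullet> ?v) * indicator ?A x)
      = (if i \<in> J then (outer_normal i \<bullet> ?v) * face_integral (facet i) (n i) f else 0)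
        + (outer_normal j \<bullet> ?v) * face_integral (facet j) (n j) f"
    using oj by simp
  also have "\<dots> = (\<Sum>c\<in>J. (outer_normal c \<bullet> ?v) * face_integral (facet c) (n c) f)"
  proof -
    have "(\<Sum>c\<in>J. (outer_normal c \<bullet> ?v) * face_integral (facet c) (n c) f)
        = (\<Sum>c\<in>J \<inter> {i, j}. (outer_normal c \<bullet> ?v) * face_integral (facet c) (n c) f)"
      using J oo finJ by (intro sum.mono_neutral_right) auto
    also have "J \<inter> {i, j} = (if i \<in> J then {i, j} else {j})" using j by auto
    finally show ?thesis using False by simp
  qed
  finally show ?thesis .
qed

text \<open>The gradients of the barycentric coordinates sum to zero, so \<open>j\<close> drops out,
  and \<open>v\<close> is the sum of the vertices weighted by \<open>bgrad C i \<bullet> v\<close>.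
  The edges ending at one vertex therefore span the space.\<close>

lemma edge_expansion: "(\<Sum>i\<in>C. (- (bgrad C i \<bullet> v)) *\<^sub>R (j - i)) = v"
proof -
  have b: "bgrad C i \<bullet> v = bary C i v - bary C i 0" for i using bary_sub[of i v 0] by simp
  have s: "(\<Sum>i\<in>C. bgrad C i \<bullet> v) = 0" unfolding b sum_subtractf by (simp add: bary_rep)
  have "(\<Sum>i\<in>C. (bgrad C i \<bullet> v) *\<^sub>R i) = v"
    unfolding b scaleR_left_diff_distrib sum_subtractf by (simp add: bary_rep)
  moreover have "(\<Sum>i\<in>C. (- (bgrad C i \<bullet> v)) *\<^sub>R (j - i)) = (\<Sum>i\<in>C. (bgrad C i \<bullet> v) *\<^sub>R i) - (\<Sum>i\<in>C. bgrad C i \<bullet> v) *\<^sub>R j"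
    by (simp add: scaleR_sum_left sum_subtractf[symmetric] scaleR_diff_right algebra_simps)
  ultimately show ?thesis using s by simp
qed

text \<open>The edge identity is linear in the direction, so it extends from the edges ending at one
  \<open>j\<close> to all directions; component \<open>k\<close> in direction
  \<open>axis k 1\<close>, summed over \<open>k\<close>, gives the divergence. The hypothesis
  \<open>J \<noteq> {}\<close> provides \<open>j\<close>.\<close>

theorem divergence_theorem_H1_0:
  fixes u :: "real ^ 'n \<Rightarrow> real ^ 'n"
  assumes card2: "2 \<le> CARD('n)" and S: "open S" "bounded S"
    and u: "continuous_on (closure S) u" "\<And>k. (\<lambda>x. u x $ k) \<in> H1_0 S"
    and KS: "K \<subseteq> closure S" and J: "J \<subseteq> C" "J \<noteq> {}"
    and n: "\<And>c. c \<in> J \<Longrightarrow> norm (n c) = 1"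
    and perp: "\<And>c x y. c \<in> J \<Longrightarrow> x \<in> facet c \<Longrightarrow> y \<in> facet c \<Longrightarrow> n c \<bullet> (x - y) = 0"
    and inner: "\<And>c. c \<in> J \<Longrightarrow> open_facet c \<subseteq> S"
    and outer: "\<And>c y. c \<in> C - J \<Longrightarrow> y \<in> open_facet c \<Longrightarrow> \<exists>\<epsilon>>0. \<forall>x\<in>ball y \<epsilon>. bary C c x < 0 \<longrightarrow> x \<notin> S"
  shows "(LINT x|lebesgue_on S. divergence S u x * indicator (interior K) x)
    = (\<Sum>c\<in>J. face_integral (facet c) (n c) (\<lambda>x. u x \<bullet> outer_normal c))"
proof -
  let ?A = "interior K"
  obtain j where j: "j \<in> J" using J by blast
  have uc: "continuous_on (closure S) (\<lambda>x. u x $ k)" for k using u(1) by (intro continuous_intros)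
  have gL: "grad S (\<lambda>x. u x $ k) \<in> L2 S" for k
  proof -
    have "\<exists>g. is_weak_gradient S (\<lambda>x. u x $ k) g" using u(2)[of k] by (auto simp: H1_0_def H1_def)
    then have "is_weak_gradient S (\<lambda>x. u x $ k) (grad S (\<lambda>x. u x $ k))"
      unfolding grad_def by (rule someI_ex)
    then show ?thesis by (simp add: is_weak_gradient_def)
  qed
  have Am: "indicator ?A \<in> borel_measurable (lebesgue_on S)" by (intro lebesgue_on_borel) simp
  have gi: "integrable (lebesgue_on S) (\<lambda>x. (grad S (\<lambda>x. u x $ k) x \<bullet> v) * indicator ?A x)" for k v
    using integrable_L2[OF S gL] by (intro integrable_times_bounded[OF _ Am, where B=1]) (simp_all add: indicator_def)
  have dir: "(LINT x|lebesgue_on S. (grad S (\<lambda>x. u x $ k) x \<bullet> v) * indicator ?A x)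
      = (\<Sum>c\<in>J. (outer_normal c \<bullet> v) * face_integral (facet c) (n c) (\<lambda>x. u x $ k))" for k v
  proof -
    let ?g = "grad S (\<lambda>x. u x $ k)" and ?F = "\<lambda>c. face_integral (facet c) (n c) (\<lambda>x. u x $ k)"
    define r where "r i = - (bgrad C i \<bullet> v)" for i
    have rv: "(\<Sum>i\<in>C. r i *\<^sub>R (j - i)) = v" using edge_expansion[of v j] by (simp only: r_def)
    have v: "y \<bullet> v = (\<Sum>i\<in>C. r i * (y \<bullet> (j - i)))" for y
    proof -
      have "y \<bullet> (\<Sum>i\<in>C. r i *\<^sub>R (j - i)) = (\<Sum>i\<in>C. r i * (y \<bullet> (j - i)))"
        by (simp only: inner_sum_right inner_scaleR_right)
      then show ?thesis by (simp only: rv)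
    qed
    have "(\<lambda>x. (?g x \<bullet> v) * indicator ?A x) = (\<lambda>x. \<Sum>i\<in>C. r i * ((?g x \<bullet> (j - i)) * indicator ?A x))"
      unfolding v[of "?g _"] by (simp only: sum_distrib_right mult.assoc)
    then have "(LINT x|lebesgue_on S. (?g x \<bullet> v) * indicator ?A x)
        = (\<Sum>i\<in>C. r i * (LINT x|lebesgue_on S. (?g x \<bullet> (j - i)) * indicator ?A x))"
      using gi by simp
    also have "\<dots> = (\<Sum>i\<in>C. r i * (\<Sum>c\<in>J. (outer_normal c \<bullet> (j - i)) * ?F c))"
      by (intro sum.cong refl arg_cong2[where f="(*)"]
          directional_flux_edge[OF card2 S uc u(2) KS J(1) n perp inner outer j])
    also have "\<dots> = (\<Sum>c\<in>J. (\<Sum>i\<in>C. r i * (outer_normal c \<bullet> (j - i))) * ?F c)"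
      by (simp add: sum_distrib_left sum_distrib_right mult.assoc) (rule sum.swap)
    also have "\<dots> = (\<Sum>c\<in>J. (outer_normal c \<bullet> v) * ?F c)"
      by (simp only: v[of "outer_normal _"])
    finally show ?thesis .
  qed
  have dv: "(\<lambda>x. divergence S u x * indicator ?A x)
      = (\<lambda>x. \<Sum>k\<in>UNIV. (grad S (\<lambda>x. u x $ k) x \<bullet> axis k 1) * indicator ?A x)"
    by (simp only: divergence_def jacobian_def trace_def inner_axis sum_distrib_right vec_lambda_beta inner_real_def mult_1_right)
  have "(LINT x|lebesgue_on S. divergence S u x * indicator ?A x)
      = (\<Sum>k\<in>UNIV. \<Sum>c\<in>J. (outer_normal c \<bullet> axis k 1) * face_integral (facet c) (n c) (\<lambda>x. u x $ k))"
    unfolding dv by (simp only: Bochner_Integration.integral_sum[OF gi] dir)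
  also have "\<dots> = (\<Sum>c\<in>J. \<Sum>k\<in>UNIV. (outer_normal c \<bullet> axis k 1) * face_integral (facet c) (n c) (\<lambda>x. u x $ k))"
    by (rule sum.swap)
  also have "\<dots> = (\<Sum>c\<in>J. face_integral (facet c) (n c) (\<lambda>x. u x \<bullet> outer_normal c))"
  proof (intro sum.cong refl)
    fix c assume c: "c \<in> J"
    then have cC: "c \<in> C" using J by blast
    obtain \<beta> where \<beta>: "\<And>y. y \<in> facet c \<Longrightarrow> n c \<bullet> y + \<beta> = 0" using facet_offset[OF cC perp[OF c]] by blast
    have cf: "continuous_on (facet c) (\<lambda>x. u x $ k)" for k
      using facet_subset_K KS by (intro continuous_on_subset[OF uc]) auto
    have int: "integrable (lebesgue_on (prism (facet c) (n c))) (\<lambda>x. u (closest_point (affine hull facet c) x) $ k)" for k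
      by (rule face_integral_lborel(4)[OF compact_facet \<beta> n[OF c] cf])
    have "face_integral (facet c) (n c) (\<lambda>x. u x \<bullet> outer_normal c)
        = (LINT x|lebesgue_on (prism (facet c) (n c)). (\<Sum>k\<in>UNIV. outer_normal c $ k * u (closest_point (affine hull facet c) x) $ k))"
      by (simp add: face_integral_def inner_vec_def mult.commute)
    also have "\<dots> = (\<Sum>k\<in>UNIV. outer_normal c $ k * face_integral (facet c) (n c) (\<lambda>x. u x $ k))"
      using int by (simp add: face_integral_def)
    finally show "(\<Sum>k\<in>UNIV. (outer_normal c \<bullet> axis k 1) * face_integral (facet c) (n c) (\<lambda>x. u x $ k))
        = face_integral (facet c) (n c) (\<lambda>x. u x \<bullet> outer_normal c)"
      by (simp add: inner_axis)
  qed
  finally show ?thesis .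
qed

end

section \<open>Simplicial meshes\<close>

lemma (in full_simplex) bary_pos_near:
  assumes "A \<subseteq> C" "\<And>a. a \<in> A \<Longrightarrow> 0 < bary C a y"
  obtains \<epsilon> where "0 < \<epsilon>" "\<And>x a. x \<in> ball y \<epsilon> \<Longrightarrow> a \<in> A \<Longrightarrow> 0 < bary C a x"
proof -
  have "{x. \<forall>a\<in>A. 0 < bary C a x} = (\<Inter>a\<in>A. {x. 0 < bary C a x})" by auto
  also have "open \<dots>"
    using finite_subset[OF assms(1) finite_C]
    by (intro open_INT ballI open_Collect_less continuous_intros)
  finally have "open {x. \<forall>a\<in>A. 0 < bary C a x}" .
  moreover have "y \<in> {x. \<forall>a\<in>A. 0 < bary C a x}" using assms(2) by simp
  ultimately obtain \<epsilon> where "0 < \<epsilon>" "ball y \<epsilon> \<subseteq> {x. \<forall>a\<in>A. 0 < bary C a x}"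
    unfolding open_contains_ball by blast
  then show ?thesis using that by blast
qed

lemma (in full_simplex) open_facet_ne: "c \<in> C \<Longrightarrow> open_facet c \<noteq> {}"
proof -
  assume c: "c \<in> C"
  obtain z where z: "z \<in> interior K" using interior_ne by blast
  obtain y0 where y0: "y0 \<in> C" "y0 \<noteq> c" using other_vertex[OF c] by blast
  have zp: "0 < bary C a z" if "a \<in> C" for a using z that interior_K by simp
  \<comment> \<open>Shifts the whole weight of \<open>c\<close> onto \<open>y0\<close> and keeps all
    other coordinates.\<close>
  define y where "y = z + (- bary C c z) *\<^sub>R (c - y0)"
  have yb: "bary C a y = bary C a z - bary C c z * (of_bool (c = a) - of_bool (y0 = a))" if "a \<in> C" for a
    using bary_add[of a z "- bary C c z" "c - y0"] bgrad_edge[OF that y0(1) c] by (simp add: y_def)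
  have "bary C c y = 0" using yb[OF c] y0(2) by simp
  moreover have "0 < bary C a y" if "a \<in> C - {c}" for a
    using yb[of a] zp[of a] zp[OF c] that by (cases "a = y0") auto
  ultimately have "y \<in> open_facet c" by (simp add: open_facet_def)
  then show ?thesis by blast
qed

section \<open>Cells, their common facets and their neighbours\<close>

lemma full_simplex_vertices:
  fixes K :: "(real ^ 'n) set"
  assumes "int CARD('n) simplex K"
  shows "full_simplex (vertices K)" "convex hull (vertices K) = K"
proof -
  obtain C where C: "\<not> affine_dependent C" "int (card C) = int CARD('n) + 1" "K = convex hull C"
    using assms by (auto simp: simplex_def)
  have "vertices K = C"
    unfolding vertices_def C(3) by (simp add: extreme_point_of_convex_hull_affine_independent[OF C(1)])
  then show "full_simplex (vertices K)" "convex hull (vertices K) = K"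
    using C by (auto simp: full_simplex_def)
qed

locale simplicial_domain =
  fixes \<Omega> :: "(real ^ 'n) set" and T :: "(real ^ 'n) set set"
  assumes open_\<Omega>: "open \<Omega>" and bounded_\<Omega>: "bounded \<Omega>" and regular_\<Omega>: "interior (closure \<Omega>) = \<Omega>"
    and mesh: "simplicial_mesh \<Omega> T"
begin

lemma finite_T: "finite T"
  and union_T: "\<Union>T = closure \<Omega>"
  using mesh by (auto simp: simplicial_mesh_def triangulation_def)

lemma simplexT: "K \<in> T \<Longrightarrow> full_simplex (vertices K)"
  and hullT: "K \<in> T \<Longrightarrow> convex hull (vertices K) = K"
proof -
  assume "K \<in> T"
  then have "int CARD('n) simplex K" using mesh by (simp add: simplicial_mesh_def)
  then show "full_simplex (vertices K)" "convex hull (vertices K) = K" by (rule full_simplex_vertices)+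
qed

lemma face_Int: "K \<in> T \<Longrightarrow> L \<in> T \<Longrightarrow> K \<inter> L face_of K"
  and face_Int': "K \<in> T \<Longrightarrow> L \<in> T \<Longrightarrow> K \<inter> L face_of L"
  using mesh by (auto simp: simplicial_mesh_def triangulation_def) (metis Int_commute)

lemma interior_T_ne: "K \<in> T \<Longrightarrow> interior K \<noteq> {}"
  using full_simplex.interior_ne[OF simplexT] hullT by simp

lemma compact_T: "K \<in> T \<Longrightarrow> compact K"
  using full_simplex.compact_K[OF simplexT] hullT by simp

lemma T_subset: "K \<in> T \<Longrightarrow> K \<subseteq> closure \<Omega>"
  using union_T by blast

lemma interior_T_subset: "K \<in> T \<Longrightarrow> interior K \<subseteq> \<Omega>"
  using interior_mono[OF T_subset] regular_\<Omega> by blast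

text \<open>A face that meets the relative interior is the whole simplex; here the face is
  \<open>K \<inter> L\<close>.\<close>

lemma subset_T_eq:
  assumes "K \<in> T" "L \<in> T" "x \<in> interior K" "x \<in> L"
  shows "K \<subseteq> L"
proof -
  have "interior K \<subseteq> rel_interior K" by (rule interior_subset_rel_interior)
  then have "(K \<inter> L) \<inter> rel_interior K \<noteq> {}" using assms interior_subset by blast
  then have "K \<subseteq> K \<inter> L" using subset_of_face_of[OF face_Int[OF assms(1,2)], of K] by simp
  then show ?thesis by blast
qed

lemma interior_disjoint:
  assumes "K \<in> T" "L \<in> T" "x \<in> interior K" "x \<in> L"
  shows "K = L"
proof -
  have KL: "K \<subseteq> L" by (rule subset_T_eq[OF assms])
  then have "x \<in> interior L" using assms(3) interior_mono by blast
  then have "L \<subseteq> K" using subset_T_eq[OF assms(2,1)] assms(3) interior_subset by blast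
  with KL show ?thesis by blast
qed

text \<open>Membership in \<open>interior_faces\<close> says that the set is the common facet of
  some pair of cells, not necessarily of \<open>K\<close> and \<open>L\<close>. The dimension of the
  set decides, because \<open>K \<inter> L\<close> is a face of \<open>K\<close> anyway.\<close>

lemma interior_face_facet:
  assumes K: "K \<in> T" and L: "L \<in> T" and e: "K \<inter> L \<in> interior_faces T"
  shows "K \<inter> L facet_of K"
proof -
  have dim: "aff_dim M = int CARD('n)" if "M \<in> T" for M
    using interior_T_ne[OF that] aff_dim_nonempty_interior[of M] by simp
  obtain K' L' where KL': "K \<inter> L = K' \<inter> L'" "K' \<in> T" "K' \<inter> L' facet_of K'"
    using e by (auto simp: interior_faces_def)
  then have "K \<inter> L \<noteq> {}" "aff_dim (K \<inter> L) = int CARD('n) - 1"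
    using dim[of K'] by (auto simp: facet_of_def)
  then show ?thesis
    using face_Int[OF K L] dim K by (auto simp: facet_of_def)
qed

text \<open>The coordinates of the two vertices opposite the common facet are proportional. A
  positive factor would yield common interior points of both cells, so the factor is negative: the
  outer normals are opposite, and the points just beyond the facet belong to
  \<open>L\<close>.\<close>

lemma neighbour_side:
  assumes K: "K \<in> T" and L: "L \<in> T" and KL: "K \<noteq> L"
    and c: "c \<in> vertices K" and e: "K \<inter> L = convex hull (vertices K - {c})"
  obtains d where "d \<in> vertices L" "K \<inter> L = convex hull (vertices L - {d})"
    "full_simplex.outer_normal (vertices L) d = - full_simplex.outer_normal (vertices K) c"
    "\<And>y. y \<in> full_simplex.open_facet (vertices K) c \<Longrightarrow>
      y \<in> \<Omega> \<and> (\<exists>\<epsilon>>0. \<forall>x\<in>ball y \<epsilon>. bary (vertices K) c x < 0 \<longrightarrow> x \<in> interior L)"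
proof -
  interpret K: full_simplex "vertices K" by (rule simplexT[OF K])
  interpret L: full_simplex "vertices L" by (rule simplexT[OF L])
  let ?C = "vertices K" and ?D = "vertices L"
  note hK = hullT[OF K] and hL = hullT[OF L]
  have "K \<inter> L facet_of convex hull ?C" unfolding K.facet_of_K using c e by blast
  then have "K \<inter> L \<noteq> {}" "aff_dim (K \<inter> L) = aff_dim K - 1" by (auto simp: facet_of_def hK)
  moreover have "aff_dim K = aff_dim L"
    using interior_T_ne[OF K] interior_T_ne[OF L] aff_dim_nonempty_interior[of K] aff_dim_nonempty_interior[of L] by simp
  ultimately have "K \<inter> L facet_of convex hull ?D"
    using face_Int'[OF K L] by (simp add: facet_of_def hL)
  then obtain d where d: "d \<in> ?D" "K \<inter> L = convex hull (?D - {d})" unfolding L.facet_of_K by blast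
  have same: "?C - {c} = ?D - {d}"
  proof -
    have "\<not> affine_dependent (?C - {c})" "\<not> affine_dependent (?D - {d})"
      using K.indep L.indep affine_dependent_subset by (metis Diff_subset)+
    then have "x \<in> ?C - {c} \<longleftrightarrow> x \<in> ?D - {d}" for x
      using extreme_point_of_convex_hull_affine_independent[of "?C - {c}" x]
        extreme_point_of_convex_hull_affine_independent[of "?D - {d}" x] e d(2) by simp
    then show ?thesis by blast
  qed
  \<comment> \<open>On the hyperplane of the facet both coordinate systems express a point by the
    same affine combination of the common vertices.\<close>
  have coord: "bary ?D a y = bary ?C a y" if y: "bary ?C c y = 0" and a: "a \<in> ?D - {d}" for a y
  proof -
    define w where "w a = (if a = d then 0 else bary ?C a y)" for a
    have "sum w ?D = (\<Sum>a\<in>?D - {d}. bary ?C a y)" "(\<Sum>a\<in>?D. w a *\<^sub>R a) = (\<Sum>a\<in>?D - {d}. bary ?C a y *\<^sub>R a)"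
      using d(1) by (auto simp: w_def sum.remove[of ?D d] intro!: sum.cong)
    then have "sum w ?D = 1" "(\<Sum>a\<in>?D. w a *\<^sub>R a) = y"
      using K.bary_rep[of y] y c by (simp_all add: same[symmetric] sum.remove[of ?C c])
    then have "bary ?D a y = w a" using L.bary_combination[of w a] a by simp
    then show ?thesis using a by (simp add: w_def)
  qed
  have "bgrad ?D d \<bullet> (x - y) = 0" if "x \<in> K.facet c" "y \<in> K.facet c" for x y
    using that L.mem_facet[OF d(1), of x] L.mem_facet[OF d(1), of y] L.bary_sub[of d x y] e d(2) by simp
  then obtain \<alpha> where \<alpha>: "bgrad ?D d = \<alpha> *\<^sub>R bgrad ?C c" using K.facet_normal[OF c] by blast
  have \<alpha>0: "\<alpha> \<noteq> 0" using \<alpha> L.bgrad_nz[OF d(1)] by auto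
  obtain y0 where "y0 \<in> ?C - {c}" using K.other_vertex[OF c] by blast
  then have "y0 \<in> K.facet c" by (rule hull_inc)
  then have y0: "bary ?C c y0 = 0" "bary ?D d y0 = 0"
    using K.mem_facet[OF c] L.mem_facet[OF d(1)] e d(2) by auto
  have rel: "bary ?D d x = \<alpha> * bary ?C c x" for x
    using K.bary_sub[of c x y0] L.bary_sub[of d x y0] y0 \<alpha> by simp
  have neg: "\<alpha> < 0"
  proof (rule ccontr)
    assume "\<not> \<alpha> < 0"
    then have \<alpha>p: "0 < \<alpha>" using \<alpha>0 by simp
    obtain y where "y \<in> K.open_facet c" using K.open_facet_ne[OF c] by blast
    then have yc: "bary ?C c y = 0" and ya: "\<And>a. a \<in> ?C - {c} \<Longrightarrow> 0 < bary ?C a y"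
      by (auto simp: K.open_facet_def)
    obtain \<epsilon> where \<epsilon>: "0 < \<epsilon>" "\<And>x a. x \<in> ball y \<epsilon> \<Longrightarrow> a \<in> ?C - {c} \<Longrightarrow> 0 < bary ?C a x"
      using K.bary_pos_near[of "?C - {c}" y] ya by blast
    obtain \<delta> where \<delta>: "0 < \<delta>" "\<And>x a. x \<in> ball y \<delta> \<Longrightarrow> a \<in> ?D - {d} \<Longrightarrow> 0 < bary ?D a x"
      using L.bary_pos_near[of "?D - {d}" y] coord[OF yc] ya same by (metis Diff_subset)
    define t where "t = min \<epsilon> \<delta> / (2 * norm (bgrad ?C c))"
    have w0: "0 < norm (bgrad ?C c)" using K.bgrad_nz[OF c] by simp
    have t: "0 < t" using \<epsilon>(1) \<delta>(1) w0 by (simp add: t_def)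
    define x where "x = y + t *\<^sub>R bgrad ?C c"
    have "dist y x = min \<epsilon> \<delta> / 2" using w0 \<epsilon>(1) \<delta>(1) by (simp add: x_def dist_norm t_def)
    then have xb: "x \<in> ball y \<epsilon>" "x \<in> ball y \<delta>" using \<epsilon>(1) \<delta>(1) by auto
    have xc: "0 < bary ?C c x" unfolding x_def K.bary_add yc using t K.bgrad_nz[OF c] by simp
    then have "0 < bary ?D d x" using rel \<alpha>p by simp
    then have "0 < bary ?D a x" if "a \<in> ?D" for a using \<delta>(2)[OF xb(2), of a] that by (cases "a = d") auto
    then have "x \<in> interior L" using L.interior_K hL by auto
    moreover have "0 < bary ?C a x" if "a \<in> ?C" for a using \<epsilon>(2)[OF xb(1), of a] xc that by (cases "a = c") auto
    then have "x \<in> interior K" using K.interior_K hK by auto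
    ultimately show False using interior_disjoint[OF K L, of x] interior_subset KL by blast
  qed
  have normal: "L.outer_normal d = - K.outer_normal c"
    unfolding L.outer_normal_def K.outer_normal_def \<alpha> using neg by (simp add: divide_simps)
  have loc: "y \<in> \<Omega> \<and> (\<exists>\<epsilon>>0. \<forall>x\<in>ball y \<epsilon>. bary ?C c x < 0 \<longrightarrow> x \<in> interior L)" if y: "y \<in> K.open_facet c" for y
  proof -
    have yc: "bary ?C c y = 0" and ya: "\<And>a. a \<in> ?C - {c} \<Longrightarrow> 0 < bary ?C a y"
      using y by (auto simp: K.open_facet_def)
    obtain \<epsilon> where \<epsilon>: "0 < \<epsilon>" "\<And>x a. x \<in> ball y \<epsilon> \<Longrightarrow> a \<in> ?C - {c} \<Longrightarrow> 0 < bary ?C a x"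
      using K.bary_pos_near[of "?C - {c}" y] ya by blast
    obtain \<delta> where \<delta>: "0 < \<delta>" "\<And>x a. x \<in> ball y \<delta> \<Longrightarrow> a \<in> ?D - {d} \<Longrightarrow> 0 < bary ?D a x"
      using L.bary_pos_near[of "?D - {d}" y] coord[OF yc] ya same by (metis Diff_subset)
    have inL: "x \<in> interior L" if "x \<in> ball y \<delta>" "bary ?C c x < 0" for x
    proof -
      have "0 < bary ?D a x" if "a \<in> ?D" for a
        using \<delta>(2)[OF \<open>x \<in> ball y \<delta>\<close>, of a] rel[of x] mult_neg_neg[OF neg \<open>bary ?C c x < 0\<close>] that
        by (cases "a = d") auto
      then show ?thesis using L.interior_K hL by auto
    qed
    have inU: "x \<in> closure \<Omega>" if x: "x \<in> ball y (min \<epsilon> \<delta>)" for x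
    proof (cases "bary ?C c x < 0")
      case True
      then have "x \<in> L" using inL[of x] x interior_subset by auto
      then show ?thesis using T_subset[OF L] by blast
    next
      case False
      have xb: "x \<in> ball y \<epsilon>" using x by simp
      have "0 \<le> bary ?C a x" if "a \<in> ?C" for a
        using \<epsilon>(2)[OF xb, of a] False that by (cases "a = c") auto
      then have "x \<in> K" using K.mem_K[of x] hK by simp
      then show ?thesis using T_subset[OF K] by blast
    qed
    \<comment> \<open>A whole ball around \<open>y\<close> is covered by \<open>K\<close> and
      \<open>L\<close>; regularity of the domain turns interior points of its closure into points of
      \<Omega>.\<close>
    have "y \<in> interior (closure \<Omega>)"
      unfolding mem_interior using inU \<epsilon>(1) \<delta>(1) by (intro exI[of _ "min \<epsilon> \<delta>"]) auto
    then show ?thesis using regular_\<Omega> \<delta>(1) inL by auto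
  qed
  show ?thesis by (rule that[OF d normal loc])
qed

text \<open>A different cell through \<open>y\<close> would meet \<open>K\<close> in a face that
  contains the facet opposite \<open>c\<close>, hence in this facet or in \<open>K\<close> itself,
  and both are excluded. The finitely many other cells are closed, so a ball around \<open>y\<close>
  avoids them, and points with a negative coordinate are not in \<open>K\<close>.\<close>

lemma boundary_side:
  assumes K: "K \<in> T" and c: "c \<in> vertices K"
    and bd: "\<And>L. L \<in> T \<Longrightarrow> L \<noteq> K \<Longrightarrow> K \<inter> L \<noteq> convex hull (vertices K - {c})"
    and y: "y \<in> full_simplex.open_facet (vertices K) c"
  shows "\<exists>\<epsilon>>0. \<forall>x\<in>ball y \<epsilon>. bary (vertices K) c x < 0 \<longrightarrow> x \<notin> \<Omega>"
proof -
  interpret K: full_simplex "vertices K" by (rule simplexT[OF K])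
  let ?C = "vertices K"
  note hK = hullT[OF K]
  have ya: "\<And>a. a \<in> ?C - {c} \<Longrightarrow> 0 < bary ?C a y"
    using y by (auto simp: K.open_facet_def)
  have "0 \<le> bary ?C a y" if "a \<in> ?C" for a
    using y ya[of a] that by (cases "a = c") (auto simp: K.open_facet_def intro: less_imp_le)
  then have yK: "y \<in> K" using K.mem_K[of y] hK by simp
  have notL: "y \<notin> L" if L: "L \<in> T" "L \<noteq> K" for L
  proof
    assume yL: "y \<in> L"
    obtain D where D: "D \<subseteq> ?C" "K \<inter> L = convex hull D"
      using face_Int[OF K L(1)] K.face_of_K hK by auto
    have "?C - {c} \<subseteq> D"
    proof
      fix a assume a: "a \<in> ?C - {c}"
      show "a \<in> D"
      proof (rule ccontr)
        assume "a \<notin> D"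
        then have "convex hull D \<subseteq> K.facet a" using D(1) by (intro hull_mono) auto
        then have "y \<in> K.facet a" using yK yL D(2) by blast
        then show False using K.mem_facet[of a y] ya[OF a] a by auto
      qed
    qed
    then have "D = ?C - {c} \<or> D = ?C" using D(1) by blast
    moreover have "D \<noteq> ?C"
    proof
      assume "D = ?C"
      then have "K \<subseteq> L" using D(2) hK by auto
      then show False
        using interior_T_ne[OF K] interior_disjoint[OF K L(1)] interior_subset[of K] L(2) by blast
    qed
    ultimately show False using bd[OF L] D(2) by blast
  qed
  have "closed (\<Union>(T - {K}))"
    using finite_T compact_T by (intro closed_Union) (auto intro: compact_imp_closed)
  then have "open (- \<Union>(T - {K}))" by (rule open_Compl)
  moreover have "y \<in> - \<Union>(T - {K})" using notL by auto
  ultimately obtain \<epsilon> where \<epsilon>: "0 < \<epsilon>" "ball y \<epsilon> \<subseteq> - \<Union>(T - {K})"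
    unfolding open_contains_ball by blast
  have "x \<notin> \<Omega>" if "x \<in> ball y \<epsilon>" "bary ?C c x < 0" for x
  proof
    assume "x \<in> \<Omega>"
    then have "x \<in> \<Union>T" using closure_subset union_T by auto
    then have "x \<in> K" using \<epsilon>(2) that(1) by blast
    then have "0 \<le> bary ?C c x" using K.mem_K[of x] hK c by simp
    then show False using that(2) by simp
  qed
  then show ?thesis using \<epsilon>(1) by blast
qed

definition inner_vertices :: "(real ^ 'n) set \<Rightarrow> (real ^ 'n) set" where
  "inner_vertices K = {c \<in> vertices K. \<exists>L\<in>T. L \<noteq> K \<and> K \<inter> L = convex hull (vertices K - {c})}"

definition neighbour :: "(real ^ 'n) set \<Rightarrow> real ^ 'n \<Rightarrow> (real ^ 'n) set" where
  "neighbour K c = (SOME L. L \<in> T \<and> L \<noteq> K \<and> K \<inter> L = convex hull (vertices K - {c}))"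

lemma neighbour:
  assumes "c \<in> inner_vertices K"
  shows "neighbour K c \<in> T" "neighbour K c \<noteq> K" "K \<inter> neighbour K c = convex hull (vertices K - {c})"
    "c \<in> vertices K"
proof -
  have "\<exists>L. L \<in> T \<and> L \<noteq> K \<and> K \<inter> L = convex hull (vertices K - {c})"
    using assms by (auto simp: inner_vertices_def)
  from someI_ex[OF this]
  show "neighbour K c \<in> T" "neighbour K c \<noteq> K" "K \<inter> neighbour K c = convex hull (vertices K - {c})"
    by (simp_all add: neighbour_def)
  show "c \<in> vertices K" using assms by (simp add: inner_vertices_def)
qed

text \<open>Two cells attached to \<open>K\<close> at the same facet would share the points just
  beyond it.\<close>

lemma neighbour_unique:
  assumes K: "K \<in> T" and L: "L \<in> T" "L \<noteq> K" and c: "c \<in> vertices K" and e: "K \<inter> L = convex hull (vertices K - {c})"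
  shows "c \<in> inner_vertices K" "neighbour K c = L"
proof -
  interpret K: full_simplex "vertices K" by (rule simplexT[OF K])
  show ci: "c \<in> inner_vertices K" using assms by (auto simp: inner_vertices_def)
  note N = neighbour[OF ci]
  obtain y where y: "y \<in> K.open_facet c" using K.open_facet_ne[OF c] by blast
  obtain \<epsilon> where \<epsilon>: "0 < \<epsilon>" "\<forall>x\<in>ball y \<epsilon>. bary (vertices K) c x < 0 \<longrightarrow> x \<in> interior L"
    using neighbour_side[OF K L(1) L(2)[symmetric] c e] y by metis
  obtain \<delta> where \<delta>: "0 < \<delta>" "\<forall>x\<in>ball y \<delta>. bary (vertices K) c x < 0 \<longrightarrow> x \<in> interior (neighbour K c)"
    using neighbour_side[OF K N(1) N(2)[symmetric] c N(3)] y by metis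
  define t where "t = min \<epsilon> \<delta> / (2 * norm (bgrad (vertices K) c))"
  have w0: "0 < norm (bgrad (vertices K) c)" using K.bgrad_nz[OF c] by simp
  have t: "0 < t" using \<epsilon>(1) \<delta>(1) w0 by (simp add: t_def)
  define x where "x = y + (- t) *\<^sub>R bgrad (vertices K) c"
  have "dist y x = min \<epsilon> \<delta> / 2" using w0 \<epsilon>(1) \<delta>(1) by (simp add: x_def dist_norm t_def)
  then have xb: "x \<in> ball y \<epsilon>" "x \<in> ball y \<delta>" using \<epsilon>(1) \<delta>(1) by auto
  have "bary (vertices K) c y = 0" using y by (simp add: K.open_facet_def)
  then have "bary (vertices K) c x < 0" unfolding x_def K.bary_add using t K.bgrad_nz[OF c] by simp
  then have "x \<in> interior L" "x \<in> interior (neighbour K c)" using \<epsilon>(2) \<delta>(2) xb by auto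
  then show "neighbour K c = L"
    using interior_disjoint[OF N(1) L(1), of x] interior_subset by blast
qed

end

section \<open>Signs of the upwind forms\<close>

text \<open>Turns the orientation condition of \<open>oriented_faces\<close> into a choice of sign.
  The vertex \<open>c\<close> itself shows that the reversed normal violates it.\<close>

lemma (in full_simplex) outward_iff:
  assumes c: "c \<in> C" and n: "n = outer_normal c \<or> n = - outer_normal c"
  shows "(\<forall>x\<in>K. \<forall>y\<in>facet c. n \<bullet> (x - y) \<le> 0) \<longleftrightarrow> n = outer_normal c"
proof -
  have o: "outer_normal c \<bullet> (x - y) = - (bary C c x / norm (bgrad C c))" if "y \<in> facet c" for x y
    using that bary_sub[of c x y] by (simp add: outer_normal_def mem_facet[OF c])
  have w: "0 < norm (bgrad C c)" using bgrad_nz[OF c] by simp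
  show ?thesis
  proof
    assume "n = outer_normal c"
    then show "\<forall>x\<in>K. \<forall>y\<in>facet c. n \<bullet> (x - y) \<le> 0"
      using w by (auto simp: o mem_K c)
  next
    assume *: "\<forall>x\<in>K. \<forall>y\<in>facet c. n \<bullet> (x - y) \<le> 0"
    show "n = outer_normal c"
    proof (rule ccontr)
      assume "n \<noteq> outer_normal c"
      then have n': "n = - outer_normal c" using n by blast
      obtain y where "y \<in> C - {c}" using other_vertex[OF c] by blast
      then have y: "y \<in> facet c" by (rule hull_inc)
      have "c \<in> K" using c by (rule hull_inc)
      then have "n \<bullet> (c - y) \<le> 0" using * y by blast
      then show False using o[OF y, of c] w c by (simp add: n' bary_vertex)
    qed
  qed
qed

context simplicial_domain
begin

lemma vertices_finite: "K \<in> T \<Longrightarrow> finite (vertices K)"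
  using full_simplex.finite_C[OF simplexT] .

text \<open>A simplex is the closure of its interior, so each of its points is a limit point of the
  interior and the limit in \<open>cell_trace\<close> is unique.\<close>

lemma cell_trace_const:
  assumes K: "K \<in> T" and v: "\<And>x. x \<in> interior K \<Longrightarrow> v x = r" and x: "x \<in> K"
  shows "cell_trace K v x = r"
proof -
  have "closure (interior K) = K"
    using full_simplex.closure_interior_K[OF simplexT[OF K]] hullT[OF K] by simp
  then have "x islimpt interior K"
  proof (cases "x \<in> interior K")
    case True
    then show ?thesis by (intro interior_limit_point) simp
  next
    case False
    then show ?thesis using x \<open>closure (interior K) = K\<close> by (auto simp: closure_def)
  qed
  then have nt: "\<not> trivial_limit (at x within interior K)" by (simp add: trivial_limit_within)
  have "(v \<longlongrightarrow> r) (at x within interior K)"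
    by (rule tendsto_eventually) (auto simp: eventually_at_filter v)
  then show ?thesis unfolding cell_trace_def by (rule tendsto_Lim[OF nt])
qed

lemma indicator_P0: "K \<in> T \<Longrightarrow> indicator (interior K) \<in> P0_disc T"
  unfolding P0_disc_def
proof (intro CollectI ballI)
  fix L assume K: "K \<in> T" and L: "L \<in> T"
  have "indicator (interior K) x = (of_bool (L = K) :: real)" if "x \<in> interior L" for x
    using that interior_disjoint[OF K L, of x] interior_disjoint[OF L K, of x] interior_subset by (auto simp: indicator_def)
  then show "\<exists>c. \<forall>x\<in>interior L. indicator (interior K) x = (c::real)" by blast
qed

lemma jump_indicator:
  assumes K: "K \<in> T" and A: "A \<in> T" and B: "B \<in> T" and x: "x \<in> A \<inter> B"
  shows "jump A B (indicator (interior K)) x = of_bool (A = K) - of_bool (B = K)"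
proof -
  have "cell_trace L (indicator (interior K)) x = of_bool (L = K)" if L: "L \<in> T" "x \<in> L" for L
  proof (rule cell_trace_const[OF L(1) _ L(2)])
    fix y assume "y \<in> interior L"
    then show "indicator (interior K) y = (of_bool (L = K) :: real)"
      using interior_disjoint[OF K L(1), of y] interior_disjoint[OF L(1) K, of y] interior_subset by (auto simp: indicator_def)
  qed
  then show ?thesis using assms by (simp add: jump_def)
qed

section \<open>Oriented faces around a cell and the fluxes through them\<close>

context
  fixes n :: "(real ^ 'n) set \<Rightarrow> real ^ 'n"
  assumes n: "unit_normals T n"
begin

lemma finite_oriented: "finite (oriented_faces T n)"
  by (rule finite_subset[of _ "T \<times> T"]) (auto simp: oriented_faces_def finite_T)

lemma orientedD:
  assumes "(A, B) \<in> oriented_faces T n"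
  shows "A \<in> T" "B \<in> T" "A \<noteq> B" "A \<inter> B \<in> interior_faces T"
  using assms by (auto simp: oriented_faces_def)

lemma facet_interior_face:
  assumes K: "K \<in> T" and c: "c \<in> inner_vertices K"
  shows "convex hull (vertices K - {c}) \<in> interior_faces T"
proof -
  note N = neighbour[OF c]
  have "convex hull (vertices K - {c}) facet_of convex hull (vertices K)"
    using full_simplex.facet_of_K[OF simplexT[OF K]] N(4) by blast
  then have 1: "K \<inter> neighbour K c facet_of K" using hullT[OF K] N(3) by simp
  have "aff_dim K = aff_dim (neighbour K c)"
    using interior_T_ne[OF K] interior_T_ne[OF N(1)] aff_dim_nonempty_interior[of K]
      aff_dim_nonempty_interior[of "neighbour K c"] by simp
  then have 2: "K \<inter> neighbour K c facet_of neighbour K c"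
    using 1 face_Int'[OF K N(1)] by (simp add: facet_of_def)
  show ?thesis
    unfolding interior_faces_def N(3)[symmetric] using 1 2 K N(1,2) by blast
qed

lemma face_data:
  assumes e: "e \<in> interior_faces T"
  obtains \<beta> where "compact e" "\<And>y. y \<in> e \<Longrightarrow> n e \<bullet> y + \<beta> = 0" "norm (n e) = 1"
proof -
  obtain K L where KL: "e = K \<inter> L" "K \<in> T" "L \<in> T" "e facet_of K"
    using e by (auto simp: interior_faces_def)
  have "compact e" using KL(1) compact_T[OF KL(2)] compact_T[OF KL(3)] by (simp add: compact_Int)
  obtain y0 where "y0 \<in> e" using KL(4) by (auto simp: facet_of_def)
  have "n e \<bullet> (y - y0) = 0" if "y \<in> e" for y
    using n e that \<open>y0 \<in> e\<close> by (simp add: unit_normals_def)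
  then have "n e \<bullet> y + - (n e \<bullet> y0) = 0" if "y \<in> e" for y using that by (simp add: inner_diff_right)
  moreover have "norm (n e) = 1" using n e by (simp add: unit_normals_def)
  ultimately show ?thesis using that \<open>compact e\<close> by blast
qed

lemma face_integral_cong:
  assumes e: "e \<in> interior_faces T" and fg: "\<And>x. x \<in> e \<Longrightarrow> f x = g x"
  shows "face_integral e (n e) f = face_integral e (n e) g"
proof -
  obtain \<beta> where d: "compact e" "\<And>y. y \<in> e \<Longrightarrow> n e \<bullet> y + \<beta> = 0" "norm (n e) = 1" using face_data[OF e] by blast
  show ?thesis
    unfolding face_integral_def
    by (rule Bochner_Integration.integral_cong)
      (use closest_point_prism(1,2)[OF d(2,3)] fg in \<open>auto\<close>)
qed

text \<open>A non-integrable integrand has integral 0 by convention, so the sign alone decides. This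
  handles the diffusive fluxes, which contain the unspecified jumps of
  \<open>Pi0 \<Omega> T \<mu>\<close>.\<close>

lemma face_integral_nonneg:
  assumes e: "e \<in> interior_faces T" and f: "\<And>x. x \<in> e \<Longrightarrow> 0 \<le> f x"
  shows "0 \<le> face_integral e (n e) f"
proof -
  obtain \<beta> where d: "compact e" "\<And>y. y \<in> e \<Longrightarrow> n e \<bullet> y + \<beta> = 0" "norm (n e) = 1" using face_data[OF e] by blast
  show ?thesis
    unfolding face_integral_def
    by (rule Bochner_Integration.integral_nonneg)
      (use closest_point_prism(1,2)[OF d(2,3)] f in \<open>auto\<close>)
qed

text \<open>Continuity gives integrability, without which the convention for non-integrable
  functions could break the comparison.\<close>

lemma face_integral_mono:
  assumes e: "e \<in> interior_faces T" and f: "continuous_on e f" "continuous_on e g" "\<And>x. x \<in> e \<Longrightarrow> f x \<le> g x"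
  shows "face_integral e (n e) f \<le> face_integral e (n e) g"
proof -
  obtain \<beta> where d: "compact e" "\<And>y. y \<in> e \<Longrightarrow> n e \<bullet> y + \<beta> = 0" "norm (n e) = 1" using face_data[OF e] by blast
  show ?thesis
    unfolding face_integral_def
    by (rule integral_mono[OF face_integral_lborel(4)[OF d f(1)] face_integral_lborel(4)[OF d f(2)]])
      (use closest_point_prism(1,2)[OF d(2,3)] f(3) in \<open>auto\<close>)
qed

lemma face_integral_cmult: "face_integral e \<nu> (\<lambda>x. r * f x) = r * face_integral e \<nu> f"
  by (simp add: face_integral_def)

text \<open>The pair under which the facet opposite \<open>c\<close> is listed in
  \<open>oriented_faces\<close>: \<open>K\<close> comes first exactly when the fixed normal is
  exterior to it.\<close>

definition orient :: "(real ^ 'n) set \<Rightarrow> real ^ 'n \<Rightarrow> (real ^ 'n) set \<times> (real ^ 'n) set" where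
  "orient K c = (if n (convex hull (vertices K - {c})) = full_simplex.outer_normal (vertices K) c
     then (K, neighbour K c) else (neighbour K c, K))"

lemma normal_cases:
  assumes K: "K \<in> T" and c: "c \<in> inner_vertices K"
  defines "e \<equiv> convex hull (vertices K - {c})"
  shows "n e = full_simplex.outer_normal (vertices K) c \<or> n e = - full_simplex.outer_normal (vertices K) c"
proof -
  interpret K: full_simplex "vertices K" by (rule simplexT[OF K])
  have e: "e \<in> interior_faces T" unfolding e_def by (rule facet_interior_face[OF K c])
  show ?thesis
  proof (rule K.facet_normal_cases)
    show "c \<in> vertices K" by (rule neighbour(4)[OF c])
    show "norm (n e) = 1" using n e by (simp add: unit_normals_def)
    show "n e \<bullet> (x - y) = 0" if "x \<in> convex hull (vertices K - {c})" "y \<in> convex hull (vertices K - {c})" for x y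
      using n e that by (simp add: unit_normals_def e_def)
  qed
qed

lemma oriented_iff:
  assumes K: "K \<in> T" and c: "c \<in> inner_vertices K"
  defines "e \<equiv> convex hull (vertices K - {c})"
  shows "(K, neighbour K c) \<in> oriented_faces T n \<longleftrightarrow> n e = full_simplex.outer_normal (vertices K) c"
    and "(neighbour K c, K) \<in> oriented_faces T n \<longleftrightarrow> n e = - full_simplex.outer_normal (vertices K) c"
proof -
  note N = neighbour[OF c]
  let ?L = "neighbour K c"
  interpret K: full_simplex "vertices K" by (rule simplexT[OF K])
  interpret L: full_simplex "vertices ?L" by (rule simplexT[OF N(1)])
  have e: "e \<in> interior_faces T" unfolding e_def by (rule facet_interior_face[OF K c])
  have eK: "K \<inter> ?L = e" using N(3) by (simp add: e_def)
  have nc: "n e = K.outer_normal c \<or> n e = - K.outer_normal c" unfolding e_def by (rule normal_cases[OF K c])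
  have "(K, ?L) \<in> oriented_faces T n \<longleftrightarrow> (\<forall>x\<in>K. \<forall>y\<in>e. n e \<bullet> (x - y) \<le> 0)"
    using K N(1,2) e eK by (auto simp: oriented_faces_def)
  also have "\<dots> \<longleftrightarrow> n e = K.outer_normal c"
    using K.outward_iff[OF N(4) nc] hullT[OF K] by (simp add: e_def)
  finally show "(K, ?L) \<in> oriented_faces T n \<longleftrightarrow> n e = K.outer_normal c" .
  obtain d where d: "d \<in> vertices ?L" "K \<inter> ?L = convex hull (vertices ?L - {d})"
    "L.outer_normal d = - K.outer_normal c"
    using neighbour_side[OF K N(1) N(2)[symmetric] N(4) N(3)] by metis
  have "(?L, K) \<in> oriented_faces T n \<longleftrightarrow> (\<forall>x\<in>?L. \<forall>y\<in>e. n e \<bullet> (x - y) \<le> 0)"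
    using K N(1,2) e eK by (auto simp: oriented_faces_def Int_commute)
  also have "\<dots> \<longleftrightarrow> n e = L.outer_normal d"
    using L.outward_iff[OF d(1), of "n e"] hullT[OF N(1)] nc d(2,3) eK by auto
  finally show "(?L, K) \<in> oriented_faces T n \<longleftrightarrow> n e = - K.outer_normal c" unfolding d(3) .
qed

lemma outer_normal_nz:
  assumes "K \<in> T" "c \<in> vertices K"
  shows "full_simplex.outer_normal (vertices K) c \<noteq> 0"
proof -
  interpret K: full_simplex "vertices K" by (rule simplexT[OF assms(1)])
  show ?thesis using K.bgrad_nz[OF assms(2)] by (simp add: K.outer_normal_def)
qed

text \<open>Each interior facet of \<open>K\<close> is listed exactly once, so a sum over the
  oriented faces at \<open>K\<close> becomes a sum over \<open>inner_vertices K\<close>. The pair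
  determines the facet, and the facet its opposite vertex.\<close>

lemma oriented_around:
  assumes K: "K \<in> T"
  shows "{p \<in> oriented_faces T n. fst p = K \<or> snd p = K} = orient K ` inner_vertices K"
    and "inj_on (orient K) (inner_vertices K)"
proof -
  interpret K: full_simplex "vertices K" by (rule simplexT[OF K])
  show "inj_on (orient K) (inner_vertices K)"
  proof (rule inj_onI)
    fix c d assume c: "c \<in> inner_vertices K" and d: "d \<in> inner_vertices K" and eq: "orient K c = orient K d"
    then have "fst (orient K c) \<inter> snd (orient K c) = fst (orient K d) \<inter> snd (orient K d)" by simp
    then have "K \<inter> neighbour K c = K \<inter> neighbour K d" by (auto simp: orient_def split: if_splits)
    then show "c = d" using K.facet_inj neighbour(3,4)[OF c] neighbour(3,4)[OF d] by simp
  qed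
  have mem: "orient K c \<in> oriented_faces T n" if "c \<in> inner_vertices K" for c
    using oriented_iff[OF K that] normal_cases[OF K that] by (auto simp: orient_def)
  have key: "c \<in> inner_vertices K \<and> L = neighbour K c \<and> K \<inter> L = convex hull (vertices K - {c})"
    if "L \<in> T" "L \<noteq> K" "K \<inter> L \<in> interior_faces T" "c \<in> vertices K" "K \<inter> L = convex hull (vertices K - {c})" for L c
    using neighbour_unique[OF K that(1,2,4,5)] that(5) by simp
  have ex: "\<exists>c\<in>inner_vertices K. L = neighbour K c" if "L \<in> T" "L \<noteq> K" "K \<inter> L \<in> interior_faces T" for L
  proof -
    have "K \<inter> L facet_of convex hull (vertices K)" using interior_face_facet[OF K that(1,3)] hullT[OF K] by simp
    then show ?thesis unfolding K.facet_of_K using key[OF that] by blast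
  qed
  show "{p \<in> oriented_faces T n. fst p = K \<or> snd p = K} = orient K ` inner_vertices K"
  proof (intro equalityI subsetI)
    fix p assume p: "p \<in> {p \<in> oriented_faces T n. fst p = K \<or> snd p = K}"
    obtain A B where AB: "p = (A, B)" by (cases p)
    have o: "(A, B) \<in> oriented_faces T n" using p AB by simp
    note D = orientedD[OF o]
    from p AB consider "A = K" | "B = K" by auto
    then show "p \<in> orient K ` inner_vertices K"
    proof cases
      case 1
      then obtain c where c: "c \<in> inner_vertices K" "B = neighbour K c" using ex[of B] D by auto
      then have "p = orient K c" using oriented_iff(1)[OF K c(1)] o 1 AB by (simp add: orient_def)
      then show ?thesis using c by blast
    next
      case 2
      then obtain c where c: "c \<in> inner_vertices K" "A = neighbour K c" using ex[of A] D by (auto simp: Int_commute)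
      have "n (convex hull (vertices K - {c})) = - K.outer_normal c"
        using oriented_iff(2)[OF K c(1)] o 2 c(2) by simp
      moreover have "- K.outer_normal c \<noteq> K.outer_normal c"
      proof
        assume "- K.outer_normal c = K.outer_normal c"
        then have "2 *\<^sub>R K.outer_normal c = 0" by (metis scaleR_2 add.left_inverse)
        then show False using outer_normal_nz[OF K neighbour(4)[OF c(1)]] by simp
      qed
      ultimately have "p = orient K c" using 2 AB c(2) by (simp add: orient_def)
      then show ?thesis using c by blast
    qed
  next
    fix p assume "p \<in> orient K ` inner_vertices K"
    then obtain c where c: "c \<in> inner_vertices K" "p = orient K c" by blast
    have "fst (orient K c) = K \<or> snd (orient K c) = K" by (simp add: orient_def)
    then show "p \<in> {p \<in> oriented_faces T n. fst p = K \<or> snd p = K}"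
      using mem[OF c(1)] c(2) by simp
  qed
qed

text \<open>The factor is 1 or -1 according to whether the fixed normal of the face is the outer
  normal of \<open>K\<close> or its negative, so the sum is the outward flux through the interior
  facets.\<close>

lemma cell_flux:
  fixes u :: "real ^ 'n \<Rightarrow> real ^ 'n"
  assumes card2: "2 \<le> CARD('n)" and K: "K \<in> T"
    and u: "continuous_on (closure \<Omega>) u" "\<And>k. (\<lambda>x. u x $ k) \<in> H1_0 \<Omega>"
    and div0: "(LINT x|lebesgue_on \<Omega>. divergence \<Omega> u x * indicator (interior K) x) = 0"
  shows "(\<Sum>(A, B)\<in>oriented_faces T n. (of_bool (A = K) - of_bool (B = K)) *
    face_integral (A \<inter> B) (n (A \<inter> B)) (\<lambda>x. u x \<bullet> n (A \<inter> B))) = 0"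
proof -
  interpret K: full_simplex "vertices K" by (rule simplexT[OF K])
  let ?J = "inner_vertices K"
  let ?t = "\<lambda>(A, B). (of_bool (A = K) - of_bool (B = K)) *
    face_integral (A \<inter> B) (n (A \<inter> B)) (\<lambda>x. u x \<bullet> n (A \<inter> B))"
  have "sum ?t (oriented_faces T n) = sum ?t {p \<in> oriented_faces T n. fst p = K \<or> snd p = K}"
    by (rule sum.mono_neutral_right[OF finite_oriented]) (simp_all add: case_prod_unfold subset_eq)
  also have "\<dots> = (\<Sum>c\<in>?J. ?t (orient K c))"
    unfolding oriented_around(1)[OF K] by (simp only: sum.reindex[OF oriented_around(2)[OF K]] o_def)
  also have "\<dots> = (\<Sum>c\<in>?J. face_integral (K.facet c) (n (K.facet c)) (\<lambda>x. u x \<bullet> K.outer_normal c))"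
  proof (intro sum.cong refl)
    fix c assume c: "c \<in> ?J"
    note N = neighbour[OF c]
    show "?t (orient K c) = face_integral (K.facet c) (n (K.facet c)) (\<lambda>x. u x \<bullet> K.outer_normal c)"
    proof (cases "n (K.facet c) = K.outer_normal c")
      case True
      then show ?thesis using N by (simp add: orient_def)
    next
      case False
      then have "n (K.facet c) = - K.outer_normal c" using normal_cases[OF K c] by blast
      moreover have "face_integral (K.facet c) \<nu> (\<lambda>x. - (u x \<bullet> K.outer_normal c))
          = - face_integral (K.facet c) \<nu> (\<lambda>x. u x \<bullet> K.outer_normal c)" for \<nu>
        by (simp add: face_integral_def)
      ultimately show ?thesis using False N by (simp add: orient_def Int_commute)
    qed
  qed
  also have "\<dots> = 0"
  \<comment> \<open>Without interior facets the sum is empty; otherwise the divergence theorem has a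
    vertex to start from.\<close>
  proof (cases "?J = {}")
    case False
    have "(LINT x|lebesgue_on \<Omega>. divergence \<Omega> u x * indicator (interior K.K) x)
        = (\<Sum>c\<in>?J. face_integral (K.facet c) (n (K.facet c)) (\<lambda>x. u x \<bullet> K.outer_normal c))"
    proof (rule K.divergence_theorem_H1_0[OF card2 open_\<Omega> bounded_\<Omega> u])
      show "K.K \<subseteq> closure \<Omega>" using hullT[OF K] T_subset[OF K] by simp
      show "?J \<subseteq> vertices K" by (auto simp: inner_vertices_def)
      show "norm (n (K.facet c)) = 1" if "c \<in> ?J" for c
        using facet_interior_face[OF K that] n by (simp add: unit_normals_def)
      show "n (K.facet c) \<bullet> (x - y) = 0" if "c \<in> ?J" "x \<in> K.facet c" "y \<in> K.facet c" for c x y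
        using facet_interior_face[OF K that(1)] n that(2,3) by (simp add: unit_normals_def)
      show "K.open_facet c \<subseteq> \<Omega>" if "c \<in> ?J" for c
        using neighbour_side[OF K neighbour(1)[OF that] neighbour(2)[OF that, symmetric] neighbour(4)[OF that] neighbour(3)[OF that]]
        by (metis subsetI)
      show "\<exists>\<epsilon>>0. \<forall>x\<in>ball y \<epsilon>. bary (vertices K) c x < 0 \<longrightarrow> x \<notin> \<Omega>"
        if "c \<in> vertices K - ?J" "y \<in> K.open_facet c" for c y
      proof (rule boundary_side[OF K _ _ that(2)])
        show "c \<in> vertices K" using that(1) by simp
        show "K \<inter> L \<noteq> K.facet c" if "L \<in> T" "L \<noteq> K" for L
          using \<open>c \<in> vertices K - ?J\<close> that by (auto simp: inner_vertices_def)
      qed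
    qed (use False in simp)
    then show ?thesis using div0 hullT[OF K] by simp
  qed simp
  finally show ?thesis .
qed

text \<open>Subtracting \<open>val K\<close> times the vanishing total flux leaves only the inflow
  into \<open>K\<close>, weighted with differences between \<open>val K\<close> and the neighbouring
  values. The factor \<sigma> treats maximum and minimum at once.\<close>

lemma a_upw_sign:
  fixes u :: "real ^ 'n \<Rightarrow> real ^ 'n"
  assumes card2: "2 \<le> CARD('n)" and K: "K \<in> T"
    and u: "continuous_on (closure \<Omega>) u" "\<And>k. (\<lambda>x. u x $ k) \<in> H1_0 \<Omega>"
    and div0: "(LINT x|lebesgue_on \<Omega>. divergence \<Omega> u x * indicator (interior K) x) = 0"
    and val: "\<And>L x. L \<in> T \<Longrightarrow> x \<in> interior L \<Longrightarrow> \<phi> x = val L"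
    and ext: "\<And>L. L \<in> T \<Longrightarrow> \<sigma> * val L \<le> \<sigma> * val K"
  shows "0 \<le> \<sigma> * a_upw T n u \<phi> (indicator (interior K))"
proof -
  let ?s = "\<lambda>A B. of_bool (A = K) - of_bool (B = K) :: real"
  have "0 = \<sigma> * val K * (\<Sum>(A, B)\<in>oriented_faces T n. ?s A B *
      face_integral (A \<inter> B) (n (A \<inter> B)) (\<lambda>x. u x \<bullet> n (A \<inter> B)))"
    using cell_flux[OF card2 K u div0] by simp
  also have "\<dots> = (\<Sum>(A, B)\<in>oriented_faces T n. face_integral (A \<inter> B) (n (A \<inter> B)) (\<lambda>x. \<sigma> * val K * (?s A B * (u x \<bullet> n (A \<inter> B)))))"
    unfolding sum_distrib_left case_prod_unfold face_integral_cmult ..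
  also have "\<dots> \<le> (\<Sum>(A, B)\<in>oriented_faces T n. face_integral (A \<inter> B) (n (A \<inter> B))
      (\<lambda>x. \<sigma> * ((pos_part (u x \<bullet> n (A \<inter> B)) * cell_trace A \<phi> x
              - neg_part (u x \<bullet> n (A \<inter> B)) * cell_trace B \<phi> x) * jump A B (indicator (interior K)) x)))"
  proof (rule sum_mono, clarify)
    fix A B assume "(A, B) \<in> oriented_faces T n"
    note D = orientedD[OF this]
    let ?e = "A \<inter> B"
    have uc: "continuous_on ?e u"
      using T_subset[OF D(1)] by (intro continuous_on_subset[OF u(1)]) auto
    have "face_integral ?e (n ?e) (\<lambda>x. \<sigma> * val K * (?s A B * (u x \<bullet> n ?e)))
        \<le> face_integral ?e (n ?e) (\<lambda>x. \<sigma> * ((pos_part (u x \<bullet> n ?e) * val A - neg_part (u x \<bullet> n ?e) * val B) * ?s A B))"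
    proof (rule face_integral_mono[OF D(4)])
      show "continuous_on ?e (\<lambda>x. \<sigma> * val K * (?s A B * (u x \<bullet> n ?e)))" by (intro continuous_intros uc)
      show "continuous_on ?e (\<lambda>x. \<sigma> * ((pos_part (u x \<bullet> n ?e) * val A - neg_part (u x \<bullet> n ?e) * val B) * ?s A B))"
        unfolding pos_part_def neg_part_def by (intro continuous_intros uc)
      fix x assume "x \<in> ?e"
      define w where "w = u x \<bullet> n ?e"
      have w: "w = pos_part w - neg_part w" "0 \<le> pos_part w" "0 \<le> neg_part w"
        by (auto simp: pos_part_def neg_part_def)
      have "\<sigma> * val K * (?s A B * w) \<le> \<sigma> * ((pos_part w * val A - neg_part w * val B) * ?s A B)"
      proof -
        \<comment> \<open>If \<open>K\<close> is the first cell, the outflow terms on both sides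
          coincide and the inflow is carried by \<open>neg_part\<close>; if it is the second, by
          \<open>pos_part\<close>.\<close>
        consider "A = K" "B \<noteq> K" | "A \<noteq> K" "B = K" | "A \<noteq> K" "B \<noteq> K" using D(3) by blast
        then show ?thesis
        proof cases
          case 1
          have "neg_part w * (\<sigma> * val B) \<le> neg_part w * (\<sigma> * val K)"
            by (rule mult_left_mono[OF ext[OF D(2)] w(3)])
          then show ?thesis using 1 by (subst w(1)) (simp add: algebra_simps)
        next
          case 2
          have "pos_part w * (\<sigma> * val A) \<le> pos_part w * (\<sigma> * val K)"
            by (rule mult_left_mono[OF ext[OF D(1)] w(2)])
          then show ?thesis using 2 by (subst w(1)) (simp add: algebra_simps)
        qed simp
      qed
      then show "\<sigma> * val K * (?s A B * (u x \<bullet> n ?e)) \<le> \<sigma> * ((pos_part (u x \<bullet> n ?e) * val A - neg_part (u x \<bullet> n ?e) * val B) * ?s A B)"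
        by (simp only: w_def)
    qed
    also have "\<dots> = face_integral ?e (n ?e) (\<lambda>x. \<sigma> * ((pos_part (u x \<bullet> n ?e) * cell_trace A \<phi> x
              - neg_part (u x \<bullet> n ?e) * cell_trace B \<phi> x) * jump A B (indicator (interior K)) x))"
    proof (rule face_integral_cong[OF D(4)])
      fix x assume x: "x \<in> ?e"
      have "cell_trace A \<phi> x = val A" "cell_trace B \<phi> x = val B"
        using cell_trace_const[OF D(1) val[OF D(1)]] cell_trace_const[OF D(2) val[OF D(2)]] x by auto
      then show "\<sigma> * ((pos_part (u x \<bullet> n ?e) * val A - neg_part (u x \<bullet> n ?e) * val B) * ?s A B)
        = \<sigma> * ((pos_part (u x \<bullet> n ?e) * cell_trace A \<phi> x
              - neg_part (u x \<bullet> n ?e) * cell_trace B \<phi> x) * jump A B (indicator (interior K)) x)"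
        by (simp only: jump_indicator[OF K D(1,2) x])
    qed
    finally show "face_integral ?e (n ?e) (\<lambda>x. \<sigma> * val K * (?s A B * (u x \<bullet> n ?e)))
        \<le> face_integral ?e (n ?e) (\<lambda>x. \<sigma> * ((pos_part (u x \<bullet> n ?e) * cell_trace A \<phi> x
              - neg_part (u x \<bullet> n ?e) * cell_trace B \<phi> x) * jump A B (indicator (interior K)) x))" .
  qed
  also have "\<dots> = \<sigma> * a_upw T n u \<phi> (indicator (interior K))"
    unfolding a_upw_def sum_distrib_left case_prod_unfold face_integral_cmult ..
  finally show ?thesis .
qed

text \<open>In the first case of \<open>crit\<close> the mobility of every flux into
  \<open>K\<close> has positive part zero, in the second that of every flux out of \<open>K\<close>.
  The surviving fluxes, tested with the indicator of \<open>K\<close>, have weakly the sign of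
  \<sigma>.\<close>

lemma b_upw_sign:
  assumes K: "K \<in> T" and val: "\<And>L x. L \<in> T \<Longrightarrow> x \<in> interior L \<Longrightarrow> \<phi> x = val L"
    and crit: "(\<sigma> = 1 \<and> (\<forall>z. mob_up z + mob_down (val K) \<le> 0)) \<or> (\<sigma> = - 1 \<and> (\<forall>z. mob_up (val K) + mob_down z \<le> 0))"
  shows "0 \<le> \<sigma> * b_upw \<Omega> T n \<mu> \<phi> (indicator (interior K))"
proof -
  let ?g = "\<lambda>A B x. (pos_part (jump A B (Pi0 \<Omega> T \<mu>) x) * pos_part (mob_up (cell_trace A \<phi> x) + mob_down (cell_trace B \<phi> x))
                - neg_part (jump A B (Pi0 \<Omega> T \<mu>) x) * pos_part (mob_up (cell_trace B \<phi> x) + mob_down (cell_trace A \<phi> x)))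
               * jump A B (indicator (interior K)) x"
  have pp: "0 \<le> pos_part z" "0 \<le> neg_part z" for z by (auto simp: pos_part_def neg_part_def)
  have p0: "pos_part z = 0" if "z \<le> 0" for z using that by (simp add: pos_part_def)
  have "0 \<le> (\<Sum>(A, B)\<in>oriented_faces T n. 1 / dist (barycenter A) (barycenter B) * face_integral (A \<inter> B) (n (A \<inter> B)) (\<lambda>x. \<sigma> * ?g A B x))"
  proof (rule sum_nonneg, clarify)
    fix A B assume "(A, B) \<in> oriented_faces T n"
    note D = orientedD[OF this]
    have "0 \<le> face_integral (A \<inter> B) (n (A \<inter> B)) (\<lambda>x. \<sigma> * ?g A B x)"
    proof (rule face_integral_nonneg[OF D(4)])
      fix x assume x: "x \<in> A \<inter> B"
      have tr: "cell_trace A \<phi> x = val A" "cell_trace B \<phi> x = val B"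
        using cell_trace_const[OF D(1) val[OF D(1)]] cell_trace_const[OF D(2) val[OF D(2)]] x by auto
      define P where "P = pos_part (jump A B (Pi0 \<Omega> T \<mu>) x)"
      define N where "N = neg_part (jump A B (Pi0 \<Omega> T \<mu>) x)"
      have PN: "0 \<le> P" "0 \<le> N" by (simp_all add: P_def N_def pp)
      consider "A = K" "B \<noteq> K" | "A \<noteq> K" "B = K" | "A \<noteq> K" "B \<noteq> K" using D(3) by blast
      then have "0 \<le> \<sigma> * ((P * pos_part (mob_up (val A) + mob_down (val B)) - N * pos_part (mob_up (val B) + mob_down (val A)))
          * (of_bool (A = K) - of_bool (B = K)))"
        using crit by cases (auto simp: p0 pp PN)
      then show "0 \<le> \<sigma> * ?g A B x"
        by (simp only: tr jump_indicator[OF K D(1,2) x] P_def N_def)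
    qed
    then show "0 \<le> 1 / dist (barycenter A) (barycenter B) * face_integral (A \<inter> B) (n (A \<inter> B)) (\<lambda>x. \<sigma> * ?g A B x)"
      by simp
  qed
  also have "\<dots> = \<sigma> * b_upw \<Omega> T n \<mu> \<phi> (indicator (interior K))"
    unfolding b_upw_def sum_distrib_left case_prod_unfold face_integral_cmult by (simp add: ac_simps)
  finally show ?thesis .
qed

end

end

section \<open>The lumped projection\<close>

text \<open>All coordinates have the same integral by symmetry, and they sum to one, so each gets an
  equal share of the volume.\<close>

lemma (in full_simplex) integral_bary:
  assumes c: "c \<in> C"
  shows "(LINT x|lborel. indicator (interior K) x * bary C c x) = measure lebesgue K / real (CARD('n) + 1)"
proof -
  have ik [measurable]: "interior K \<in> sets borel" by simp
  have fin: "emeasure lborel (interior K) < \<infinity>"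
    using compact_K by (intro emeasure_bounded_finite) (auto intro: bounded_subset[OF compact_imp_bounded interior_subset])
  have int: "integrable lborel (\<lambda>x. indicator (interior K) x * bary C a x)" if a: "a \<in> C" for a
  proof (rule integrableI_bounded_set[where A="interior K" and B=1])
    show "AE x in lborel. x \<in> interior K \<longrightarrow> norm (indicator (interior K) x * bary C a x) \<le> 1"
      using bary_le_1[OF _ a] a interior_subset[of K] by (intro AE_I2) (force simp: interior_K)
  qed (use fin in auto)
  \<comment> \<open>the affine map exchanging two vertices preserves the simplex and the volume\<close>
  have swap: "(LINT x|lborel. indicator (interior K) x * bary C i x) = (LINT x|lborel. indicator (interior K) x * bary C j x)"
    if ij: "i \<in> C" "j \<in> C" "i \<noteq> j" for i j
  proof -
    let ?b = "snd (bary_pair C i) - snd (bary_pair C j)"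
    let ?T = "\<lambda>x. x + ((bgrad C i - bgrad C j) \<bullet> x + ?b) *\<^sub>R (j - i)"
    have w: "1 + (bgrad C i - bgrad C j) \<bullet> (j - i) = - 1"
      using bgrad_edge[OF ij(1,1,2)] bgrad_edge[OF ij(2,1,2)] ij(3) by (simp add: inner_diff_left)
    have coef: "(bgrad C i - bgrad C j) \<bullet> x + ?b = bary C i x - bary C j x" for x
      by (simp add: bary_def inner_diff_left)
    have T: "bary C a (?T x) = bary C a x + (bary C i x - bary C j x) * (of_bool (j = a) - of_bool (i = a))" if "a \<in> C" for a x
      unfolding bary_add coef bgrad_edge[OF that ij(1,2)] ..
    have ti: "bary C i (?T x) = bary C j x" and tj: "bary C j (?T x) = bary C i x" for x
      unfolding T[OF ij(1)] T[OF ij(2)] using ij(3) by simp_all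
    have mem: "?T x \<in> interior K \<longleftrightarrow> x \<in> interior K" for x
    proof -
      have s: "(\<forall>a\<in>C. Q a) \<longleftrightarrow> Q i \<and> Q j \<and> (\<forall>a\<in>C - {i, j}. Q a)" for Q using ij by auto
      have o: "(\<forall>a\<in>C - {i, j}. 0 < bary C a (?T x)) \<longleftrightarrow> (\<forall>a\<in>C - {i, j}. 0 < bary C a x)"
      proof (intro ball_cong refl)
        fix a assume "a \<in> C - {i, j}"
        then have "a \<in> C" "j \<noteq> a" "i \<noteq> a" by auto
        then show "(0 < bary C a (?T x)) = (0 < bary C a x)" using T[of a x] by simp
      qed
      have "(\<forall>a\<in>C. 0 < bary C a (?T x)) \<longleftrightarrow> 0 < bary C j x \<and> 0 < bary C i x \<and> (\<forall>a\<in>C - {i, j}. 0 < bary C a x)"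
        unfolding s[of "\<lambda>a. 0 < bary C a (?T x)"] o ti tj ..
      also have "\<dots> \<longleftrightarrow> (\<forall>a\<in>C. 0 < bary C a x)"
        unfolding s[of "\<lambda>a. 0 < bary C a x"] by blast
      finally show ?thesis unfolding interior_K mem_Collect_eq .
    qed
    have "(LINT x|lborel. indicator (interior K) x * bary C i x)
        = \<bar>1 + (bgrad C i - bgrad C j) \<bullet> (j - i)\<bar> * (LINT x|lborel. indicator (interior K) (?T x) * bary C i (?T x))"
    proof (rule integral_rank_one_affine)
      show "1 + (bgrad C i - bgrad C j) \<bullet> (j - i) \<noteq> 0" unfolding w by simp
      show "(\<lambda>x. indicator (interior K) x * bary C i x) \<in> borel_measurable borel" by measurable
    qed
    also have "(\<lambda>x. indicator (interior K) (?T x) * bary C i (?T x)) = (\<lambda>x. indicator (interior K) x * bary C j x)"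
      unfolding ti indicator_def mem ..
    finally show ?thesis unfolding w by simp
  qed
  have same: "(LINT x|lborel. indicator (interior K) x * bary C a x) = (LINT x|lborel. indicator (interior K) x * bary C c x)"
    if "a \<in> C" for a
    by (cases "a = c") (simp only:, rule swap[OF that c])
  have "real (CARD('n) + 1) * (LINT x|lborel. indicator (interior K) x * bary C c x)
      = (\<Sum>a\<in>C. (LINT x|lborel. indicator (interior K) x * bary C a x))"
  proof -
    have "(\<Sum>a\<in>C. (LINT x|lborel. indicator (interior K) x * bary C a x))
        = (\<Sum>a\<in>C. (LINT x|lborel. indicator (interior K) x * bary C c x))"
      by (intro sum.cong refl same)
    then show ?thesis using card_C by simp
  qed
  also have "\<dots> = (LINT x|lborel. (\<Sum>a\<in>C. indicator (interior K) x * bary C a x))"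
    by (rule Bochner_Integration.integral_sum[symmetric]) (rule int)
  also have "(\<lambda>x. \<Sum>a\<in>C. indicator (interior K) x * bary C a x) = (indicator (interior K) :: _ \<Rightarrow> real)"
    unfolding sum_distrib_left[symmetric] bary_rep(1) by simp
  also have "(LINT x|lborel. indicator (interior K) x) = measure lebesgue (interior K)"
    by simp
  also have "\<dots> = measure lebesgue K"
    using compact_K by (intro measure_interior negligible_convex_frontier) (auto simp: compact_imp_bounded)
  finally show "(LINT x|lborel. indicator (interior K) x * bary C c x) = measure lebesgue K / real (CARD('n) + 1)"
    by (simp add: field_simps)
qed

context simplicial_domain
begin

lemma cell_measure_pos: "K \<in> T \<Longrightarrow> 0 < measure lebesgue (interior K)"
proof -
  assume K: "K \<in> T"
  have "interior K \<in> lmeasurable"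
    using compact_T[OF K] by (intro lmeasurable_open) (auto intro: bounded_subset[OF compact_imp_bounded interior_subset])
  moreover have "\<not> negligible (interior K)"
    using interior_T_ne[OF K] by (simp add: open_not_negligible)
  ultimately show ?thesis using negligible_iff_measure0 zero_less_measure_iff by blast
qed

lemma cell_measure: "K \<in> T \<Longrightarrow> measure lebesgue (interior K) = measure lebesgue K"
proof -
  assume K: "K \<in> T"
  have "convex K" using hullT[OF K] by (metis convex_convex_hull)
  then show ?thesis
    using compact_T[OF K] by (intro measure_interior negligible_convex_frontier) (auto simp: compact_imp_bounded)
qed

lemma ae_cells: "AE x in lebesgue_on \<Omega>. \<exists>K\<in>T. x \<in> interior K"
proof -
  have "negligible (\<Union>K\<in>T. K - interior K)"
  proof (intro negligible_Union)
    show "finite ((\<lambda>K. K - interior K) ` T)" using finite_T by simp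
    show "negligible S" if "S \<in> (\<lambda>K. K - interior K) ` T" for S
      using that full_simplex.negligible_frontier_K[OF simplexT] hullT by auto
  qed
  then have "AE x in lebesgue. x \<notin> (\<Union>K\<in>T. K - interior K)"
    using negligible_iff_null_sets AE_not_in by blast
  then have "AE x in lebesgue. x \<in> \<Omega> \<longrightarrow> (\<exists>K\<in>T. x \<in> interior K)"
  proof eventually_elim
    case (elim x)
    show ?case
    proof
      assume "x \<in> \<Omega>"
      then have "x \<in> \<Union>T" using union_T closure_subset by blast
      then show "\<exists>K\<in>T. x \<in> interior K" using elim by blast
    qed
  qed
  then show ?thesis using open_\<Omega> by (simp add: AE_restrict_space_iff)
qed

context
  fixes \<phi> :: "real ^ 'n \<Rightarrow> real" and val
  assumes val: "\<And>L x. L \<in> T \<Longrightarrow> x \<in> interior L \<Longrightarrow> \<phi> x = val L"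
begin

lemma phi_ae: "AE x in lebesgue_on \<Omega>. \<phi> x = (\<Sum>K\<in>T. val K * indicator (interior K) x)"
  using ae_cells
proof eventually_elim
  case (elim x)
  then obtain K where K: "K \<in> T" "x \<in> interior K" by blast
  have "(\<Sum>L\<in>T. val L * indicator (interior L) x) = (\<Sum>L\<in>T. if L = K then val L else 0)"
    by (intro sum.cong refl) (use K interior_disjoint[OF K(1)] interior_subset in \<open>auto simp: indicator_def\<close>)
  then show ?case using K val[OF K] finite_T by simp
qed

text \<open>Values on the skeleton are arbitrary, so \<phi> agrees with a step function only almost
  everywhere; completeness of Lebesgue measure makes it measurable.\<close>

lemma phi_measurable: "\<phi> \<in> borel_measurable (lebesgue_on \<Omega>)"
proof -
  have "(\<lambda>x. indicator \<Omega> x *\<^sub>R \<phi> x) \<in> borel_measurable lebesgue"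
  proof (rule borel_measurable_AE)
    let ?h = "\<lambda>x. indicator \<Omega> x *\<^sub>R (\<Sum>K\<in>T. val K * indicator (interior K) x)"
    have "?h \<in> borel_measurable borel"
      using open_\<Omega> by (intro borel_measurable_scaleR borel_measurable_indicator borel_measurable_sum borel_measurable_times) auto
    then show "?h \<in> borel_measurable lebesgue" by (simp add: measurable_completion)
    have "AE x in lebesgue. x \<in> \<Omega> \<longrightarrow> \<phi> x = (\<Sum>K\<in>T. val K * indicator (interior K) x)"
      using phi_ae open_\<Omega> by (simp add: AE_restrict_space_iff)
    then show "AE x in lebesgue. ?h x = indicator \<Omega> x *\<^sub>R \<phi> x"
      by eventually_elim (simp add: indicator_def)
  qed
  then show ?thesis
    using open_\<Omega> by (simp add: borel_measurable_restrict_space_iff)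
qed

lemma integral_phi:
  assumes g: "continuous_on (closure \<Omega>) g"
  shows "(LINT x|lebesgue_on \<Omega>. \<phi> x * g x) = (\<Sum>K\<in>T. val K * (LINT x|lborel. indicator (interior K) x * g x))"
    and "integrable (lebesgue_on \<Omega>) (\<lambda>x. \<phi> x * g x)"
proof -
  let ?\<phi>' = "\<lambda>x. \<Sum>K\<in>T. val K * indicator (interior K) x"
  have gb: "(\<lambda>x. indicator \<Omega> x * g x) \<in> borel_measurable borel"
    using borel_measurable_continuous_on_indicator[of \<Omega> g] open_\<Omega> continuous_on_subset[OF g closure_subset] by simp
  have gm: "g \<in> borel_measurable (lebesgue_on \<Omega>)"
  proof -
    have "(\<lambda>x. indicator \<Omega> x * g x) \<in> borel_measurable lebesgue"
      using gb by (intro measurable_completion) (simp only: measurable_lborel2)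
    then show ?thesis using open_\<Omega> by (simp add: borel_measurable_restrict_space_iff)
  qed
  obtain B where B: "\<And>x. x \<in> closure \<Omega> \<Longrightarrow> \<bar>g x\<bar> \<le> B"
    using compact_imp_bounded[OF compact_continuous_image[OF g]] bounded_\<Omega> by (auto simp: bounded_iff)
  have cell: "(\<lambda>x. indicator \<Omega> x * (indicator (interior K) x * g x)) = (\<lambda>x. indicator (interior K) x * g x)" if "K \<in> T" for K
    using interior_T_subset[OF that] by (auto simp: indicator_def fun_eq_iff)
  have cellb: "(\<lambda>x. indicator (interior K) x * g x) \<in> borel_measurable borel" if "K \<in> T" for K
  proof -
    have "(\<lambda>x. indicator (interior K) x * (indicator \<Omega> x * g x)) \<in> borel_measurable borel"
      by (rule borel_measurable_times[OF borel_measurable_indicator gb]) simp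
    then show ?thesis using cell[OF that] by (simp add: ac_simps)
  qed
  have celli: "integrable lborel (\<lambda>x. indicator (interior K) x * g x)" if K: "K \<in> T" for K
  proof (rule integrableI_bounded_set[where A="interior K" and B=B])
    show "emeasure lborel (interior K) < \<infinity>"
      using compact_T[OF K] by (intro emeasure_bounded_finite) (auto intro: bounded_subset[OF compact_imp_bounded interior_subset])
    show "AE x in lborel. x \<in> interior K \<longrightarrow> norm (indicator (interior K) x * g x) \<le> B"
      using B interior_T_subset[OF K] closure_subset[of \<Omega>] by (auto intro!: AE_I2)
  qed (use cellb[OF K] in auto)
  have L: "(LINT x|lebesgue_on \<Omega>. indicator (interior K) x * g x) = (LINT x|lborel. indicator (interior K) x * g x)"
    "integrable (lebesgue_on \<Omega>) (\<lambda>x. indicator (interior K) x * g x)" if "K \<in> T" for K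
    using lebesgue_on_lborel[of \<Omega> "\<lambda>x. indicator (interior K) x * g x"] open_\<Omega> cell[OF that] cellb[OF that] celli[OF that] by simp_all
  have eq: "(\<lambda>x. ?\<phi>' x * g x) = (\<lambda>x. \<Sum>K\<in>T. val K * (indicator (interior K) x * g x))"
    by (simp add: sum_distrib_right mult.assoc)
  have int': "integrable (lebesgue_on \<Omega>) (\<lambda>x. ?\<phi>' x * g x)"
    unfolding eq by (intro Bochner_Integration.integrable_sum integrable_mult_right L)
  have ae: "AE x in lebesgue_on \<Omega>. \<phi> x * g x = ?\<phi>' x * g x"
    using phi_ae by eventually_elim simp
  have m: "(\<lambda>x. \<phi> x * g x) \<in> borel_measurable (lebesgue_on \<Omega>)" by (intro borel_measurable_times phi_measurable gm)
  show "integrable (lebesgue_on \<Omega>) (\<lambda>x. \<phi> x * g x)"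
    using integrable_cong_AE[OF m borel_measurable_integrable[OF int'] ae] int' by simp
  have "(LINT x|lebesgue_on \<Omega>. \<phi> x * g x) = (LINT x|lebesgue_on \<Omega>. ?\<phi>' x * g x)"
    by (rule integral_cong_AE[OF m borel_measurable_integrable[OF int'] ae])
  also have "\<dots> = (\<Sum>K\<in>T. LINT x|lebesgue_on \<Omega>. val K * (indicator (interior K) x * g x))"
    unfolding eq by (rule Bochner_Integration.integral_sum) (intro integrable_mult_right L)
  also have "\<dots> = (\<Sum>K\<in>T. val K * (LINT x|lborel. indicator (interior K) x * g x))"
    by (intro sum.cong refl) (simp add: L)
  finally show "(LINT x|lebesgue_on \<Omega>. \<phi> x * g x) = (\<Sum>K\<in>T. val K * (LINT x|lborel. indicator (interior K) x * g x))" .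
qed

end

section \<open>Hat functions and the nodal form of the lumped product\<close>

definition local_hat :: "(real ^ 'n) set \<Rightarrow> real ^ 'n \<Rightarrow> real ^ 'n \<Rightarrow> real" where
  "local_hat K z x = (if z \<in> vertices K then bary (vertices K) z x else 0)"

text \<open>The choice of the cell is immaterial by \<open>local_hat_agree\<close> below; outside the mesh the value is junk.\<close>

definition hat :: "real ^ 'n \<Rightarrow> real ^ 'n \<Rightarrow> real" where
  "hat z x = local_hat (SOME K. K \<in> T \<and> x \<in> K) z x"

text \<open>The right side mentions only the weights on the face and not the cell, which is why
  cells that share a face give the same values on it.\<close>

lemma local_hat_face:
  assumes K: "K \<in> T" and D: "D \<subseteq> vertices K" and u: "sum u D = 1"
  shows "local_hat K z (\<Sum>a\<in>D. u a *\<^sub>R a) = (if z \<in> D then u z else 0)"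
proof -
  interpret K: full_simplex "vertices K" by (rule simplexT[OF K])
  define w where "w a = (if a \<in> D then u a else 0)" for a
  have "sum w (vertices K) = sum u D" "(\<Sum>a\<in>vertices K. w a *\<^sub>R a) = (\<Sum>a\<in>D. u a *\<^sub>R a)"
    using D by (auto simp: w_def intro!: sum.mono_neutral_cong_right)
  then show ?thesis
    using K.bary_combination[of w z] u D by (auto simp: local_hat_def w_def)
qed

text \<open>The vertices of the common face are its extreme points, hence the same for both cells;
  on this face both functions read off the weight of \<open>z\<close>.\<close>

lemma local_hat_agree:
  assumes K: "K \<in> T" and L: "L \<in> T" and x: "x \<in> K" "x \<in> L"
  shows "local_hat K z x = local_hat L z x"
proof -
  interpret K: full_simplex "vertices K" by (rule simplexT[OF K])
  interpret L: full_simplex "vertices L" by (rule simplexT[OF L])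
  obtain D where D: "D \<subseteq> vertices K" "K \<inter> L = convex hull D"
    using face_Int[OF K L] K.face_of_K hullT[OF K] by auto
  obtain E where E: "E \<subseteq> vertices L" "K \<inter> L = convex hull E"
    using face_Int'[OF K L] L.face_of_K hullT[OF L] by auto
  have "\<not> affine_dependent D" "\<not> affine_dependent E"
    using K.indep L.indep affine_dependent_subset D(1) E(1) by blast+
  then have "a \<in> D \<longleftrightarrow> a \<in> E" for a
    using extreme_point_of_convex_hull_affine_independent[of D a]
      extreme_point_of_convex_hull_affine_independent[of E a] D(2) E(2) by simp
  then have "D = E" by blast
  have "finite D" using D(1) finite_subset[OF _ K.finite_C] by blast
  then obtain u where u: "sum u D = 1" "(\<Sum>a\<in>D. u a *\<^sub>R a) = x"
    using x D(2) by (auto simp: convex_hull_finite)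
  show ?thesis
    using local_hat_face[OF K D(1) u(1)] local_hat_face[OF L _ u(1)] E(1) \<open>D = E\<close> u(2) by simp
qed

lemma hat_on: "K \<in> T \<Longrightarrow> x \<in> K \<Longrightarrow> hat z x = local_hat K z x"
proof -
  assume K: "K \<in> T" "x \<in> K"
  then have "\<exists>K. K \<in> T \<and> x \<in> K" by blast
  from someI_ex[OF this] K show ?thesis
    unfolding hat_def by (intro local_hat_agree) auto
qed

lemma local_hat_affine: "local_hat K z x = (if z \<in> vertices K then bgrad (vertices K) z else 0) \<bullet> x
    + (if z \<in> vertices K then snd (bary_pair (vertices K) z) else 0)"
  by (simp add: local_hat_def bary_def)

lemma hat_P1: "hat z \<in> P1_cont T"
proof -
  have "continuous_on (\<Union>K\<in>T. K) (hat z)"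
  proof (rule continuous_on_closed_Union[OF finite_T])
    fix K assume K: "K \<in> T"
    show "closed K" using compact_T[OF K] by (rule compact_imp_closed)
    have "continuous_on K (local_hat K z)" unfolding local_hat_affine by (intro continuous_intros)
    then show "continuous_on K (hat z)" using hat_on[OF K] by (simp cong: continuous_on_cong)
  qed
  moreover have "\<exists>a b. \<forall>x\<in>K. hat z x = a \<bullet> x + b" if "K \<in> T" for K
  proof (intro exI ballI)
    fix x assume "x \<in> K"
    then show "hat z x = (if z \<in> vertices K then bgrad (vertices K) z else 0) \<bullet> x
        + (if z \<in> vertices K then snd (bary_pair (vertices K) z) else 0)"
      using hat_on[OF that] local_hat_affine by simp
  qed
  ultimately show ?thesis by (simp add: P1_cont_def)
qed

lemma hat_continuous: "continuous_on (closure \<Omega>) (hat z)"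
  using hat_P1[of z] union_T by (simp add: P1_cont_def)

definition nodes :: "(real ^ 'n) set" where
  "nodes = (\<Union>K\<in>T. vertices K)"

lemma finite_nodes: "finite nodes"
  using finite_T vertices_finite by (simp add: nodes_def)

lemma vertex_in: "K \<in> T \<Longrightarrow> a \<in> vertices K \<Longrightarrow> a \<in> K"
  using hull_inc[of a "vertices K" convex] hullT by simp

lemma hat_vertex: "K \<in> T \<Longrightarrow> a \<in> vertices K \<Longrightarrow> hat z a = of_bool (a = z)"
  using hat_on[OF _ vertex_in] full_simplex.bary_vertex[OF simplexT] by (simp add: local_hat_def) blast

lemma P1_cell_expansion:
  assumes v: "v \<in> P1_cont T" and K: "K \<in> T" and x: "x \<in> K"
  shows "v x = (\<Sum>a\<in>vertices K. bary (vertices K) a x * v a)"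
proof -
  interpret K: full_simplex "vertices K" by (rule simplexT[OF K])
  obtain p b where pb: "\<And>x. x \<in> K \<Longrightarrow> v x = p \<bullet> x + b" using v K unfolding P1_cont_def by blast
  have "(\<Sum>a\<in>vertices K. bary (vertices K) a x * v a) = (\<Sum>a\<in>vertices K. bary (vertices K) a x * (p \<bullet> a + b))"
    by (intro sum.cong refl) (simp add: pb vertex_in[OF K])
  also have "\<dots> = p \<bullet> (\<Sum>a\<in>vertices K. bary (vertices K) a x *\<^sub>R a) + (\<Sum>a\<in>vertices K. bary (vertices K) a x) * b"
    by (simp add: inner_sum_right distrib_left sum.distrib sum_distrib_right)
  also have "\<dots> = p \<bullet> x + b" using K.bary_rep[of x] by simp
  finally show ?thesis using pb[OF x] by simp
qed

lemma P1_expansion: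
  assumes v: "v \<in> P1_cont T" and x: "x \<in> closure \<Omega>"
  shows "v x = (\<Sum>z\<in>nodes. v z * hat z x)"
proof -
  obtain K where K: "K \<in> T" "x \<in> K" using x union_T by blast
  have "(\<Sum>z\<in>nodes. v z * hat z x) = (\<Sum>z\<in>vertices K. v z * bary (vertices K) z x)"
    using K finite_nodes by (intro sum.mono_neutral_cong_right) (auto simp: hat_on[OF K] local_hat_def nodes_def)
  then show ?thesis using P1_cell_expansion[OF v K] by (simp add: mult.commute)
qed

text \<open>The diagonal entry of the mass-lumping product at \<open>z\<close>, which is also the
  integral of \<open>hat z\<close> over the mesh.\<close>

definition node_mass :: "real ^ 'n \<Rightarrow> real" where
  "node_mass z = (\<Sum>K\<in>T. if z \<in> vertices K then measure lebesgue K / real (CARD('n) + 1) else 0)"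

lemma node_mass_pos: "z \<in> nodes \<Longrightarrow> 0 < node_mass z"
proof -
  assume "z \<in> nodes"
  then obtain K where K: "K \<in> T" "z \<in> vertices K" by (auto simp: nodes_def)
  show ?thesis
    unfolding node_mass_def
    by (rule sum_pos2[OF finite_T K(1)]) (use K cell_measure_pos cell_measure in auto)
qed

text \<open>The product is diagonal in the node values, so the lumped projection is determined node
  by node.\<close>

lemma lumped_nodes: "lumped_prod T v w = (\<Sum>z\<in>nodes. node_mass z * (v z * w z))"
proof -
  let ?m = "\<lambda>K. measure lebesgue K / real (CARD('n) + 1)"
  have "(\<Sum>z\<in>nodes. node_mass z * (v z * w z)) = (\<Sum>z\<in>nodes. \<Sum>K\<in>T. if z \<in> vertices K then ?m K * (v z * w z) else 0)"
    unfolding node_mass_def sum_distrib_right by (intro sum.cong refl) auto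
  also have "\<dots> = (\<Sum>K\<in>T. \<Sum>z\<in>nodes. if z \<in> vertices K then ?m K * (v z * w z) else 0)"
    by (rule sum.swap)
  also have "\<dots> = (\<Sum>K\<in>T. \<Sum>z\<in>vertices K. ?m K * (v z * w z))"
    by (intro sum.cong refl sum.mono_neutral_cong_right finite_nodes) (auto simp: nodes_def)
  also have "\<dots> = lumped_prod T v w"
    by (simp add: lumped_prod_def sum_distrib_left)
  finally show ?thesis by simp
qed

lemma integral_hat: "K \<in> T \<Longrightarrow>
    (LINT x|lborel. indicator (interior K) x * hat z x) = (if z \<in> vertices K then measure lebesgue K / real (CARD('n) + 1) else 0)"
proof -
  assume K: "K \<in> T"
  interpret K: full_simplex "vertices K" by (rule simplexT[OF K])
  have "(\<lambda>x. indicator (interior K) x * hat z x) = (\<lambda>x. indicator (interior K) x * local_hat K z x)"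
    using hat_on[OF K] interior_subset[of K] by (auto simp: indicator_def fun_eq_iff)
  then show ?thesis
    using K.integral_bary[of z] hullT[OF K] by (simp add: local_hat_def)
qed

lemma P1_combination: "(\<lambda>x. \<Sum>z\<in>nodes. r z * hat z x) \<in> P1_cont T"
  unfolding P1_cont_def
proof (intro CollectI conjI ballI)
  show "continuous_on (\<Union>T) (\<lambda>x. \<Sum>z\<in>nodes. r z * hat z x)"
    unfolding union_T by (intro continuous_intros hat_continuous)
  fix K assume K: "K \<in> T"
  let ?a = "\<lambda>z. if z \<in> vertices K then bgrad (vertices K) z else 0"
  let ?b = "\<lambda>z. if z \<in> vertices K then snd (bary_pair (vertices K) z) else 0"
  have "(\<Sum>z\<in>nodes. r z * hat z x) = (\<Sum>z\<in>nodes. r z *\<^sub>R ?a z) \<bullet> x + (\<Sum>z\<in>nodes. r z * ?b z)" if "x \<in> K" for x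
    unfolding hat_on[OF K that] local_hat_affine by (simp only: inner_sum_left inner_scaleR_left distrib_left sum.distrib)
  then show "\<exists>a b. \<forall>x\<in>K. (\<Sum>z\<in>nodes. r z * hat z x) = a \<bullet> x + b" by blast
qed

text \<open>The weights of the average at a node sum to \<open>node_mass z\<close>, so node values
  inherit the bound; between the nodes the function is a convex combination of them with barycentric
  coordinates as weights.\<close>

lemma Pi1h_bounds:
  assumes val: "\<And>L x. L \<in> T \<Longrightarrow> x \<in> interior L \<Longrightarrow> \<phi> x = val L"
    and bd: "\<And>L. L \<in> T \<Longrightarrow> \<bar>val L\<bar> \<le> 1" and x: "x \<in> closure \<Omega>"
  shows "\<bar>Pi1h \<Omega> T \<phi> x\<bar> \<le> 1"
proof -
  let ?I = "\<lambda>z. LINT x|lebesgue_on \<Omega>. \<phi> x * hat z x"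
  have IP: "?I z = (\<Sum>K\<in>T. val K * (LINT x|lborel. indicator (interior K) x * hat z x))"
    "integrable (lebesgue_on \<Omega>) (\<lambda>x. \<phi> x * hat z x)" for z
    by (rule integral_phi; (rule hat_continuous | rule val; assumption))+
  let ?v = "\<lambda>x. \<Sum>z\<in>nodes. (?I z / node_mass z) * hat z x"
  have node: "(\<Sum>z\<in>nodes. r z * hat z y) = r y" if y: "y \<in> nodes" for r y
  proof -
    obtain K where K: "K \<in> T" "y \<in> vertices K" using y by (auto simp: nodes_def)
    have "(\<Sum>z\<in>nodes. r z * hat z y) = (\<Sum>z\<in>nodes. if z = y then r z else 0)"
      by (intro sum.cong refl) (auto simp: hat_vertex[OF K])
    then show ?thesis using y finite_nodes by simp
  qed
  \<comment> \<open>\<open>Pi1h\<close> is a choice, so a solution of its variational equation has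
    to be exhibited before any property of it can be used.\<close>
  have ex: "\<exists>v. v \<in> P1_cont T \<and> (\<forall>w\<in>P1_cont T. lumped_prod T v w = L2_prod \<Omega> \<phi> w)"
  proof (intro exI[of _ ?v] conjI ballI)
    show "?v \<in> P1_cont T" by (rule P1_combination)
    fix w assume w: "w \<in> P1_cont T"
    have "lumped_prod T ?v w = (\<Sum>z\<in>nodes. w z * ?I z)"
      unfolding lumped_nodes
    proof (intro sum.cong refl)
      fix z assume z: "z \<in> nodes"
      show "node_mass z * (?v z * w z) = w z * ?I z"
        using node_mass_pos[OF z] unfolding node[OF z, of "\<lambda>z. ?I z / node_mass z"] by simp
    qed
    also have "\<dots> = (LINT x|lebesgue_on \<Omega>. (\<Sum>z\<in>nodes. w z * (\<phi> x * hat z x)))"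
      using IP(2) by simp
    also have "\<dots> = (LINT x|lebesgue_on \<Omega>. \<phi> x \<bullet> w x)"
    proof (rule Bochner_Integration.integral_cong[OF refl])
      fix x assume "x \<in> space (lebesgue_on \<Omega>)"
      then have "x \<in> closure \<Omega>" using closure_subset by auto
      then show "(\<Sum>z\<in>nodes. w z * (\<phi> x * hat z x)) = \<phi> x \<bullet> w x"
        by (simp add: P1_expansion[OF w] sum_distrib_left ac_simps)
    qed
    finally show "lumped_prod T ?v w = L2_prod \<Omega> \<phi> w" by (simp add: L2_prod_def)
  qed
  define v where "v = Pi1h \<Omega> T \<phi>"
  have v: "v \<in> P1_cont T" "\<And>w. w \<in> P1_cont T \<Longrightarrow> lumped_prod T v w = L2_prod \<Omega> \<phi> w"
    using someI_ex[OF ex] by (auto simp: v_def Pi1h_def)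
  have vz: "\<bar>v z\<bar> \<le> 1" if z: "z \<in> nodes" for z
  proof -
    have "node_mass z * v z = (\<Sum>y\<in>nodes. node_mass y * (v y * hat z y))"
    proof -
      have "(\<Sum>y\<in>nodes. node_mass y * (v y * hat z y)) = (\<Sum>y\<in>nodes. if y = z then node_mass y * v y else 0)"
        by (intro sum.cong refl) (auto simp: nodes_def hat_vertex)
      then show ?thesis using z finite_nodes by simp
    qed
    also have "\<dots> = (LINT x|lebesgue_on \<Omega>. \<phi> x * hat z x)"
      using v(2)[OF hat_P1[of z]] by (simp add: lumped_nodes L2_prod_def)
    also have "\<dots> = (\<Sum>K\<in>T. val K * (if z \<in> vertices K then measure lebesgue K / real (CARD('n) + 1) else 0))"
      unfolding IP(1) by (intro sum.cong refl) (simp add: integral_hat)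
    finally have "\<bar>node_mass z * v z\<bar> \<le> (\<Sum>K\<in>T. \<bar>val K * (if z \<in> vertices K then measure lebesgue K / real (CARD('n) + 1) else 0)\<bar>)"
      by (simp only: sum_abs)
    also have "\<dots> \<le> node_mass z"
      unfolding node_mass_def
    proof (rule sum_mono)
      fix K assume "K \<in> T"
      then have "\<bar>val K\<bar> * r \<le> r" if "0 \<le> r" for r using mult_right_mono[OF bd that] by simp
      from this[of "if z \<in> vertices K then measure lebesgue K / real (CARD('n) + 1) else 0"]
      show "\<bar>val K * (if z \<in> vertices K then measure lebesgue K / real (CARD('n) + 1) else 0)\<bar>
          \<le> (if z \<in> vertices K then measure lebesgue K / real (CARD('n) + 1) else 0)"
        by (simp add: abs_mult)
    qed
    finally have "node_mass z * \<bar>v z\<bar> \<le> node_mass z * 1" using node_mass_pos[OF z] by (simp add: abs_mult)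
    then show ?thesis using node_mass_pos[OF z] by (simp only: mult_le_cancel_left_pos)
  qed
  obtain K where K: "K \<in> T" "x \<in> K" using x union_T by blast
  interpret K: full_simplex "vertices K" by (rule simplexT[OF K(1)])
  have nn: "0 \<le> bary (vertices K) a x" if "a \<in> vertices K" for a
    using K.mem_K[of x] hullT[OF K(1)] K(2) that by simp
  have "\<bar>v x\<bar> \<le> (\<Sum>a\<in>vertices K. \<bar>bary (vertices K) a x * v a\<bar>)"
    unfolding P1_cell_expansion[OF v(1) K] by (rule sum_abs)
  also have "\<dots> \<le> (\<Sum>a\<in>vertices K. bary (vertices K) a x)"
  proof (rule sum_mono)
    fix a assume a: "a \<in> vertices K"
    then have "\<bar>v a\<bar> \<le> 1" using vz K(1) by (auto simp: nodes_def)
    then show "\<bar>bary (vertices K) a x * v a\<bar> \<le> bary (vertices K) a x"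
      using nn[OF a] by (simp add: abs_mult mult_left_le)
  qed
  also have "\<dots> = 1" by (rule K.bary_rep(1))
  finally show ?thesis by (simp add: v_def)
qed

section \<open>Bounds for the phase\<close>

lemma phase_bounds:
  assumes card2: "2 \<le> CARD('n)" and n: "unit_normals T n" and \<Delta>t: "0 < \<Delta>t"
    and u: "continuous_on (closure \<Omega>) u" "\<And>k. (\<lambda>x. u x $ k) \<in> H1_0 \<Omega>"
    and div0: "\<And>K. K \<in> T \<Longrightarrow> eq_incompressible \<Omega> u (indicator (interior K))"
    and phase: "\<And>K. K \<in> T \<Longrightarrow> eq_phase \<Omega> T n \<Delta>t \<phi>0 u \<phi>1 \<mu> (indicator (interior K))"
    and val0: "\<And>L x. L \<in> T \<Longrightarrow> x \<in> interior L \<Longrightarrow> \<phi>0 x = val0 L"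
    and val1: "\<And>L x. L \<in> T \<Longrightarrow> x \<in> interior L \<Longrightarrow> \<phi>1 x = val1 L"
    and bd0: "\<And>L. L \<in> T \<Longrightarrow> \<bar>val0 L\<bar> \<le> 1" and L: "L \<in> T"
  shows "\<bar>val1 L\<bar> \<le> 1"
proof -
  \<comment> \<open>A maximum is treated with \<open>\<sigma> = 1\<close>, a minimum with
    \<open>\<sigma> = - 1\<close>. Both upwind forms contribute with the sign of \<sigma>, so the
    time increment on \<open>K\<close> has the opposite sign.\<close>
  have step: "\<sigma> * val1 K \<le> \<sigma> * val0 K"
    if K: "K \<in> T" and ext: "\<And>L. L \<in> T \<Longrightarrow> \<sigma> * val1 L \<le> \<sigma> * val1 K"
      and crit: "(\<sigma> = 1 \<and> (\<forall>z. mob_up z + mob_down (val1 K) \<le> 0)) \<or> (\<sigma> = - 1 \<and> (\<forall>z. mob_up (val1 K) + mob_down z \<le> 0))"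
    for K \<sigma>
  proof -
    have d: "(LINT x|lebesgue_on \<Omega>. divergence \<Omega> u x * indicator (interior K) x) = 0"
      using div0[OF K] by (simp add: eq_incompressible_def L2_prod_def)
    have a: "0 \<le> \<sigma> * a_upw T n u \<phi>1 (indicator (interior K))"
      by (rule a_upw_sign[where u=u and val=val1, OF n card2 K u d val1 ext])
    have b: "0 \<le> \<sigma> * b_upw \<Omega> T n \<mu> \<phi>1 (indicator (interior K))"
      by (rule b_upw_sign[where val=val1, OF n K val1 crit])
    have "L2_prod \<Omega> (\<lambda>x. (\<phi>1 x - \<phi>0 x) / \<Delta>t) (indicator (interior K))
        = (LINT x|lebesgue_on \<Omega>. ((val1 K - val0 K) / \<Delta>t) * indicator (interior K) x)"
      unfolding L2_prod_def
      by (rule Bochner_Integration.integral_cong) (auto simp: indicator_def val0[OF K] val1[OF K])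
    also have "\<dots> = (val1 K - val0 K) / \<Delta>t * measure lebesgue (interior K)"
    proof -
      have "(LINT x|lebesgue_on \<Omega>. indicator (interior K) x :: real) = measure (lebesgue_on \<Omega>) (interior K \<inter> \<Omega>)"
        by simp
      also have "interior K \<inter> \<Omega> = interior K" using interior_T_subset[OF K] by blast
      also have "measure (lebesgue_on \<Omega>) (interior K) = measure lebesgue (interior K)"
        using interior_T_subset[OF K] open_\<Omega> by (intro measure_restrict_space) auto
      finally show ?thesis by simp
    qed
    finally have "(val1 K - val0 K) / \<Delta>t * measure lebesgue (interior K)
        + a_upw T n u \<phi>1 (indicator (interior K)) + b_upw \<Omega> T n \<mu> \<phi>1 (indicator (interior K)) = 0"
      using phase[OF K] by (simp add: eq_phase_def)
    then have "\<sigma> * ((val1 K - val0 K) / \<Delta>t * measure lebesgue (interior K)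
        + a_upw T n u \<phi>1 (indicator (interior K)) + b_upw \<Omega> T n \<mu> \<phi>1 (indicator (interior K))) = 0" by simp
    then have "\<sigma> * ((val1 K - val0 K) / \<Delta>t * measure lebesgue (interior K)) \<le> 0"
      using a b by (simp add: distrib_left)
    moreover define r where "r = measure lebesgue (interior K) / \<Delta>t"
    ultimately have "(\<sigma> * (val1 K - val0 K)) * r \<le> 0 * r" by (simp add: ac_simps)
    moreover have "0 < r" using cell_measure_pos[OF K] \<Delta>t by (simp add: r_def)
    ultimately have "\<sigma> * (val1 K - val0 K) \<le> 0" by (rule mult_right_le_imp_le)
    then show ?thesis by (simp add: right_diff_distrib)
  qed
  have Tne: "T \<noteq> {}" using L by blast
  \<comment> \<open>\<open>mob\<close> attains its largest value 1 at 0 and vanishes outside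
    [-1, 1]. Hence the increasing part \<open>mob_up\<close> is at most 1 and the decreasing part
    \<open>mob_down\<close> at most 0.\<close>
  have m1: "mob z \<le> 1" for z by (simp add: mob_def pos_part_def)
  have m0: "mob z = 0" if "1 < \<bar>z\<bar>" for z
  proof -
    have "1 < z\<^sup>2" using that by (simp add: abs_square_less_1[symmetric] abs_square_le_1 not_le[symmetric])
    then show ?thesis by (simp add: mob_def pos_part_def)
  qed
  have m00: "mob 0 = 1" by (simp add: mob_def pos_part_def)
  have up: "mob_up z \<le> 1" for z using m1 by (simp add: mob_up_def m00)
  have down: "mob_down z \<le> 0" for z using m1 by (simp add: mob_down_def m00)
  have "val1 L \<le> 1"
  proof -
    have "Max (val1 ` T) \<in> val1 ` T" using finite_T Tne by (intro Max_in) auto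
    then obtain K where "K \<in> T" "Max (val1 ` T) = val1 K" by blast
    then have K: "K \<in> T" "\<And>L. L \<in> T \<Longrightarrow> val1 L \<le> val1 K" using Max_ge[of "val1 ` T"] finite_T by auto
    have "val1 K \<le> 1"
    proof (rule ccontr)
      assume "\<not> val1 K \<le> 1"
      then have "1 < val1 K" by simp
      \<comment> \<open>Above one the decreasing part has dropped by the full height
        \<open>mob 0\<close>, which \<open>mob_up\<close> never exceeds.\<close>
      then have "mob_down (val1 K) = - 1" using m0[of "val1 K"] by (simp add: mob_down_def m00)
      then have "\<forall>z. mob_up z + mob_down (val1 K) \<le> 0" using up by simp
      then have "val1 K \<le> val0 K" using step[OF K(1), of 1] K(2) by simp
      then show False using bd0[OF K(1)] \<open>1 < val1 K\<close> by linarith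
    qed
    then show ?thesis using K(2)[OF L] by linarith
  qed
  moreover have "- 1 \<le> val1 L"
  proof -
    have "Min (val1 ` T) \<in> val1 ` T" using finite_T Tne by (intro Min_in) auto
    then obtain K where "K \<in> T" "Min (val1 ` T) = val1 K" by blast
    then have K: "K \<in> T" "\<And>L. L \<in> T \<Longrightarrow> val1 K \<le> val1 L" using Min_le[of "val1 ` T"] finite_T by auto
    have "- 1 \<le> val1 K"
    proof (rule ccontr)
      assume "\<not> - 1 \<le> val1 K"
      then have "val1 K < - 1" by simp
      \<comment> \<open>Below minus one the increasing part has not begun to rise, and
        \<open>mob_down\<close> can only lower the sum.\<close>
      then have "mob_up (val1 K) = 0" using m0[of "val1 K"] by (simp add: mob_up_def)
      then have "\<forall>z. mob_up (val1 K) + mob_down z \<le> 0" using down by simp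
      then have "val0 K \<le> val1 K" using step[OF K(1), of "- 1"] K(2) by simp
      then show False using bd0[OF K(1)] \<open>val1 K < - 1\<close> by linarith
    qed
    then show ?thesis using K(2)[OF L] by linarith
  qed
  ultimately show ?thesis by linarith
qed

lemma P0_values:
  assumes "v \<in> P0_disc T"
  obtains val where "\<And>L x. L \<in> T \<Longrightarrow> x \<in> interior L \<Longrightarrow> v x = val L"
proof -
  have "\<forall>L\<in>T. \<exists>c. \<forall>x\<in>interior L. v x = c" using assms by (simp add: P0_disc_def)
  then obtain val where "\<forall>L\<in>T. \<forall>x\<in>interior L. v x = val L" by (auto dest!: bchoice)
  then show ?thesis by (intro that) blast
qed

text \<open>The interior of a cell is not negligible, so a property that holds almost everywhere
  holds at one of its points, where the function has the value of the cell.\<close>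

lemma ae_bound_values:
  assumes val: "\<And>L x. L \<in> T \<Longrightarrow> x \<in> interior L \<Longrightarrow> \<phi> x = val L"
    and ae: "AE x in lebesgue_on \<Omega>. P (\<phi> x)" and K: "K \<in> T"
  shows "P (val K)"
proof (rule ccontr)
  assume "\<not> P (val K)"
  have "AE x in lebesgue. x \<in> \<Omega> \<longrightarrow> P (\<phi> x)" using ae open_\<Omega> by (simp add: AE_restrict_space_iff)
  then have "AE x in lebesgue. x \<notin> interior K"
    by eventually_elim (use val[OF K] \<open>\<not> P (val K)\<close> interior_T_subset[OF K] in auto)
  then have "negligible (interior K)"
    by (simp add: negligible_iff_null_sets completion.null_sets_iff_AE)
  then show False using interior_T_ne[OF K] open_not_negligible[of "interior K"] by simp
qed

end

theorem theorem3p5: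
  fixes \<Omega> :: "(real ^ 'n) set" and T :: "(real ^ 'n) set set"
    and n :: "(real ^ 'n) set \<Rightarrow> real ^ 'n"
    and U :: "(real ^ 'n \<Rightarrow> real ^ 'n) set" and P :: "(real ^ 'n \<Rightarrow> real) set"
    and \<rho>1 \<rho>2 lam \<epsilon> \<Delta>t C \<sigma> \<beta> :: real and \<eta> :: "real \<Rightarrow> real"
    and u0 u1 :: "real ^ 'n \<Rightarrow> real ^ 'n" and \<phi>0 \<mu>0 p1 \<phi>1 \<mu>1 :: "real ^ 'n \<Rightarrow> real"
  assumes "CARD('n) \<in> {2, 3}"
    and "polygonal_domain \<Omega>"
    and "0 < \<rho>1" and "\<rho>1 < \<rho>2" and "0 < lam" and "0 < \<epsilon>" and "0 < \<Delta>t"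
    and "continuous_on {-1..1} \<eta>" and "0 < C" and "\<forall>s\<in>{-1..1}. C \<le> \<eta> s"
    and "simplicial_mesh \<Omega> T" and "shape_regular \<sigma> T" and "barycenters_orthogonal T"
    and "unit_normals T n"
    and "velocity_space \<Omega> U" and "pressure_space \<Omega> T P" and "inf_sup_compatible \<beta> \<Omega> U P"
    and "u0 \<in> U" and "\<phi>0 \<in> P0_disc T" and "\<mu>0 \<in> P1_cont T"
    and "AE x in lebesgue_on \<Omega>. \<phi>0 x \<in> {-1..1}"
    and "scheme_solution \<Omega> T n U P \<rho>1 \<rho>2 lam \<epsilon> \<Delta>t \<eta> u0 \<phi>0 \<mu>0 u1 p1 \<phi>1 \<mu>1"
  shows "(AE x in lebesgue_on \<Omega>. \<phi>1 x \<in> {-1..1}) \<and> (\<forall>x\<in>\<Omega>. Pi1h \<Omega> T \<phi>1 x \<in> {-1..1})"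
proof -
  interpret simplicial_domain \<Omega> T
    using assms(2,11) by unfold_locales (auto simp: polygonal_domain_def)
  have card2: "2 \<le> CARD('n)" using assms(1) by auto
  note sol = assms(22)[unfolded scheme_solution_def]
  have u: "continuous_on (closure \<Omega>) u1" "(\<lambda>x. u1 x $ k) \<in> H1_0 \<Omega>" for k
    using sol assms(15) by (auto simp: velocity_space_def)
  obtain val0 where val0: "\<And>L x. L \<in> T \<Longrightarrow> x \<in> interior L \<Longrightarrow> \<phi>0 x = val0 L"
    using P0_values[OF assms(19)] by blast
  have "\<phi>1 \<in> P0_disc T" using sol by blast
  then obtain val1 where val1: "\<And>L x. L \<in> T \<Longrightarrow> x \<in> interior L \<Longrightarrow> \<phi>1 x = val1 L"
    using P0_values by blast
  have bd0: "\<bar>val0 L\<bar> \<le> 1" if "L \<in> T" for L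
    using ae_bound_values[of \<phi>0 val0 "\<lambda>r. r \<in> {-1..1}", OF val0 assms(21) that] by auto
  have bd1: "\<bar>val1 L\<bar> \<le> 1" if "L \<in> T" for L
  proof (rule phase_bounds[OF card2 assms(14) assms(7) u _ _ val0 val1 bd0 that])
    fix K assume K: "K \<in> T"
    \<comment> \<open>Piecewise constants are admissible pressures; this turns the incompressibility
      equation into one statement per cell.\<close>
    have "indicator (interior K) \<in> P" using indicator_P0[OF K] assms(16) by (auto simp: pressure_space_def)
    then show "eq_incompressible \<Omega> u1 (indicator (interior K))" using sol by blast
    show "eq_phase \<Omega> T n \<Delta>t \<phi>0 u1 \<phi>1 \<mu>1 (indicator (interior K))" using sol indicator_P0[OF K] by blast
  qed
  show ?thesis
  proof
    show "AE x in lebesgue_on \<Omega>. \<phi>1 x \<in> {-1..1}"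
      using ae_cells
    proof eventually_elim
      case (elim x)
      then obtain K where "K \<in> T" "x \<in> interior K" by blast
      then show ?case using val1[of K x] bd1[of K] by auto
    qed
    \<comment> \<open>The projection is continuous and bounded cell by cell on closed cells, so its
      bound holds at every point, whereas the phase is unrestricted on the skeleton.\<close>
    show "\<forall>x\<in>\<Omega>. Pi1h \<Omega> T \<phi>1 x \<in> {-1..1}"
    proof
      fix x assume "x \<in> \<Omega>"
      then have "\<bar>Pi1h \<Omega> T \<phi>1 x\<bar> \<le> 1"
        using closure_subset by (intro Pi1h_bounds[OF val1 bd1]) auto
      then show "Pi1h \<Omega> T \<phi>1 x \<in> {-1..1}" by auto
    qed
  qed
qed

end
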